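(* For every $S$ with $\{\mathsf{ea}\}\subseteq S\subseteq\{\mathsf{ea},\mathsf{ed}\}$, the problem $\textsc{CDBE}(S)$ can be solved in time $O(n^3\log n\log\log n)$, where $n$ is the number of vertices of the input digraph.
   Context: Digraphs have no loops and no multiple arcs (both input and output). The operations are $\mathsf{ea}$ (add an arc $(u,v)$ between distinct vertices with $(u,v)$ not already present) and $\mathsf{ed}$ (delete an arc). For a set $S$ of operations and $k\ge0$, $G$ can be $(S,k)$-modified into $H$ if $H$ is obtained from $G$ by at most $k$ operations from $S$. $\textsc{CDBE}(S)$ (Connected Degree Balance Editing) takes as input a digraph $G$, an integer $k$ and a function $\delta\colon V(G)\to\mathbb Z$, and asks whether $G$ can be $(S,k)$-modified into a weakly connected digraph $H$ with $d^+_H(v)-d^-_H(v)=\delta(v)$ for each $v\in V(H)$, where $d^+,d^-$ denote out- and in-degree. *)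

theory Defs
  imports
    Complex_Main
    "HOL-Library.Landau_Symbols"
    "Graph_Theory.Digraph_Component"
begin

section \<open>Connected Degree Balance Editing\<close>

datatype edit_op = EA | ED

text \<open>
  Digraphs are \<open>pair_digraph\<close>s: finite, loop-free, and without multiple arcs because arcs are
  ordered pairs of vertices. Both operations below preserve this.
\<close>

inductive edit_step :: "edit_op set \<Rightarrow> 'a pair_pre_digraph \<Rightarrow> 'a pair_pre_digraph \<Rightarrow> bool"
  for S where
  add_arc: "\<lbrakk>EA \<in> S; u \<in> pverts G; v \<in> pverts G; u \<noteq> v; (u, v) \<notin> parcs G\<rbrakk>
    \<Longrightarrow> edit_step S G (G\<lparr>parcs := insert (u, v) (parcs G)\<rparr>)"
| del_arc: "\<lbrakk>ED \<in> S; (u, v) \<in> parcs G\<rbrakk>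
    \<Longrightarrow> edit_step S G (G\<lparr>parcs := parcs G - {(u, v)}\<rparr>)"

definition modifiable_into ::
    "edit_op set \<Rightarrow> int \<Rightarrow> 'a pair_pre_digraph \<Rightarrow> 'a pair_pre_digraph \<Rightarrow> bool" where
  "modifiable_into S k G H \<longleftrightarrow> (\<exists>m::nat. int m \<le> k \<and> (edit_step S ^^ m) G H)"

record cdbe_input =
  graph :: "nat pair_pre_digraph"
  budget :: int
  balance :: "nat \<Rightarrow> int"

abbreviation order :: "cdbe_input \<Rightarrow> nat" where
  "order I \<equiv> card (pverts (graph I))"

text \<open>As an input to an algorithm, a digraph on \<open>n\<close> vertices has the vertices \<open>0, \<dots>, n - 1\<close>.\<close>

definition valid_input :: "cdbe_input \<Rightarrow> bool" where
  "valid_input I \<longleftrightarrow> pair_digraph (graph I) \<and> pverts (graph I) = {..<order I}"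

text \<open>\<open>Digraph_Component.connected\<close> is weak connectedness; it does not hold for the null graph.\<close>

definition CDBE :: "edit_op set \<Rightarrow> cdbe_input \<Rightarrow> bool" where
  "CDBE S I \<longleftrightarrow>
    (\<exists>H. modifiable_into S (budget I) (graph I) H \<and>
         Digraph_Component.connected (with_proj H) \<and>
         (\<forall>v \<in> pverts H. int (out_degree (with_proj H) v) - int (in_degree (with_proj H) v)
            = balance I v))"


section \<open>Word RAM programs\<close>

text \<open>
  The model of computation is the word RAM: a machine with random access memory whose cells hold
  integers of bounded absolute value, with unit cost for memory access, arithmetic and comparison.
  Programs are structured, and the memory is divided into named cells and named arrays, of which
  a program mentions only finitely many.
\<close>

record ram_state =
  var :: "string \<Rightarrow> int"
  arr :: "string \<Rightarrow> nat \<Rightarrow> int"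

datatype aexp =
    Num int
  | Var string
  | Get string aexp
  | Plus aexp aexp
  | Minus aexp aexp
  | Times aexp aexp
  | Quot aexp aexp

datatype bexp =
    Less aexp aexp
  | Equal aexp aexp
  | Neg bexp
  | Conj bexp bexp

datatype com =
    Skip
  | Assign string aexp
  | Put string aexp aexp
  | Seq com com
  | Cond bexp com com
  | While bexp com

fun aval :: "aexp \<Rightarrow> ram_state \<Rightarrow> int" where
  "aval (Num c) s = c"
| "aval (Var x) s = var s x"
| "aval (Get x a) s = arr s x (nat (aval a s))"
| "aval (Plus a b) s = aval a s + aval b s"
| "aval (Minus a b) s = aval a s - aval b s"
| "aval (Times a b) s = aval a s * aval b s"
| "aval (Quot a b) s = aval a s div aval b s"

fun bval :: "bexp \<Rightarrow> ram_state \<Rightarrow> bool" where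
  "bval (Less a b) s \<longleftrightarrow> aval a s < aval b s"
| "bval (Equal a b) s \<longleftrightarrow> aval a s = aval b s"
| "bval (Neg p) s \<longleftrightarrow> \<not> bval p s"
| "bval (Conj p q) s \<longleftrightarrow> bval p s \<and> bval q s"

text \<open>
  \<open>asafe W a s\<close>: no value computed in the evaluation of \<open>a\<close>, addresses and intermediate results
  included, exceeds \<open>W\<close> in absolute value; no address is negative; no divisor is zero.
  A program that violates this gets stuck.
\<close>

fun asafe :: "int \<Rightarrow> aexp \<Rightarrow> ram_state \<Rightarrow> bool" where
  "asafe W (Num c) s \<longleftrightarrow> \<bar>c\<bar> \<le> W"
| "asafe W (Var x) s \<longleftrightarrow> \<bar>var s x\<bar> \<le> W"
| "asafe W (Get x a) s \<longleftrightarrow> asafe W a s \<and> 0 \<le> aval a s \<and> \<bar>aval (Get x a) s\<bar> \<le> W"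
| "asafe W (Plus a b) s \<longleftrightarrow> asafe W a s \<and> asafe W b s \<and> \<bar>aval (Plus a b) s\<bar> \<le> W"
| "asafe W (Minus a b) s \<longleftrightarrow> asafe W a s \<and> asafe W b s \<and> \<bar>aval (Minus a b) s\<bar> \<le> W"
| "asafe W (Times a b) s \<longleftrightarrow> asafe W a s \<and> asafe W b s \<and> \<bar>aval (Times a b) s\<bar> \<le> W"
| "asafe W (Quot a b) s \<longleftrightarrow>
     asafe W a s \<and> asafe W b s \<and> aval b s \<noteq> 0 \<and> \<bar>aval (Quot a b) s\<bar> \<le> W"

fun bsafe :: "int \<Rightarrow> bexp \<Rightarrow> ram_state \<Rightarrow> bool" where
  "bsafe W (Less a b) s \<longleftrightarrow> asafe W a s \<and> asafe W b s"
| "bsafe W (Equal a b) s \<longleftrightarrow> asafe W a s \<and> asafe W b s"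
| "bsafe W (Neg p) s \<longleftrightarrow> bsafe W p s"
| "bsafe W (Conj p q) s \<longleftrightarrow> bsafe W p s \<and> bsafe W q s"

fun acost :: "aexp \<Rightarrow> nat" where
  "acost (Num c) = 1"
| "acost (Var x) = 1"
| "acost (Get x a) = acost a + 1"
| "acost (Plus a b) = acost a + acost b + 1"
| "acost (Minus a b) = acost a + acost b + 1"
| "acost (Times a b) = acost a + acost b + 1"
| "acost (Quot a b) = acost a + acost b + 1"

fun bcost :: "bexp \<Rightarrow> nat" where
  "bcost (Less a b) = acost a + acost b + 1"
| "bcost (Equal a b) = acost a + acost b + 1"
| "bcost (Neg p) = bcost p + 1"
| "bcost (Conj p q) = bcost p + bcost q + 1"

text \<open>
  \<open>exec W c s t s'\<close>: on a machine with word bound \<open>W\<close>, the program \<open>c\<close> started in state \<open>s\<close>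
  terminates after exactly \<open>t\<close> elementary operations in state \<open>s'\<close>.
\<close>

inductive exec :: "int \<Rightarrow> com \<Rightarrow> ram_state \<Rightarrow> nat \<Rightarrow> ram_state \<Rightarrow> bool" for W where
  Skip: "exec W Skip s 1 s"
| Assign: "asafe W a s \<Longrightarrow>
    exec W (Assign x a) s (acost a + 1) (s\<lparr>var := (var s)(x := aval a s)\<rparr>)"
| Put: "\<lbrakk>asafe W i s; 0 \<le> aval i s; asafe W a s\<rbrakk> \<Longrightarrow>
    exec W (Put x i a) s (acost i + acost a + 1)
      (s\<lparr>arr := (arr s)(x := (arr s x)(nat (aval i s) := aval a s))\<rparr>)"
| Seq: "\<lbrakk>exec W c1 s t1 s1; exec W c2 s1 t2 s2\<rbrakk> \<Longrightarrow> exec W (Seq c1 c2) s (t1 + t2) s2"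
| CondTrue: "\<lbrakk>bsafe W b s; bval b s; exec W c1 s t s'\<rbrakk> \<Longrightarrow>
    exec W (Cond b c1 c2) s (bcost b + t) s'"
| CondFalse: "\<lbrakk>bsafe W b s; \<not> bval b s; exec W c2 s t s'\<rbrakk> \<Longrightarrow>
    exec W (Cond b c1 c2) s (bcost b + t) s'"
| WhileFalse: "\<lbrakk>bsafe W b s; \<not> bval b s\<rbrakk> \<Longrightarrow> exec W (While b c) s (bcost b) s"
| WhileTrue: "\<lbrakk>bsafe W b s; bval b s; exec W c s t1 s1; exec W (While b c) s1 t2 s2\<rbrakk> \<Longrightarrow>
    exec W (While b c) s (bcost b + t1 + t2) s2"

inductive_cases exec_SkipE: "exec W Skip s t s'"
  and exec_AssignE: "exec W (Assign x a) s t s'"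
  and exec_PutE: "exec W (Put x i a) s t s'"
  and exec_SeqE: "exec W (Seq c1 c2) s t s'"
  and exec_CondE: "exec W (Cond b c1 c2) s t s'"
  and exec_WhileE: "exec W (While b c) s t s'"

lemma exec_deterministic:
  "exec W c s t s' \<Longrightarrow> exec W c s u s'' \<Longrightarrow> u = t \<and> s'' = s'"
proof (induction arbitrary: u s'' rule: exec.induct)
  case (Skip s)
  then show ?case by (rule exec_SkipE) simp
next
  case (Assign a s x)
  from Assign.prems show ?case by (rule exec_AssignE) simp
next
  case (Put i s a x)
  from Put.prems show ?case by (rule exec_PutE) simp
next
  case (Seq c1 s t1 s1 c2 t2 s2)
  from Seq.prems show ?case
  proof (rule exec_SeqE)
    fix u1 r1 u2
    assume u: "u = u1 + u2" and 1: "exec W c1 s u1 r1" and 2: "exec W c2 r1 u2 s''"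
    have "u1 = t1 \<and> r1 = s1" by (rule Seq.IH(1)[OF 1])
    with 2 have "u2 = t2 \<and> s'' = s2" by (intro Seq.IH(2)) simp
    with u \<open>u1 = t1 \<and> r1 = s1\<close> show ?thesis by simp
  qed
next
  case (CondTrue b s c1 t s' c2)
  from CondTrue.prems show ?case
    by (rule exec_CondE) (simp_all add: CondTrue.hyps CondTrue.IH)
next
  case (CondFalse b s c2 t s' c1)
  from CondFalse.prems show ?case
    by (rule exec_CondE) (simp_all add: CondFalse.hyps CondFalse.IH)
next
  case (WhileFalse b s c)
  from WhileFalse.prems show ?case
    by (rule exec_WhileE) (simp_all add: WhileFalse.hyps)
next
  case (WhileTrue b s c t1 s1 t2 s2)
  from WhileTrue.prems show ?case
  proof (rule exec_WhileE)
    assume "\<not> bval b s"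
    with WhileTrue.hyps show ?thesis by simp
  next
    fix u1 r1 u2
    assume u: "u = bcost b + u1 + u2" and 1: "exec W c s u1 r1"
      and 2: "exec W (While b c) r1 u2 s''"
    have "u1 = t1 \<and> r1 = s1" by (rule WhileTrue.IH(1)[OF 1])
    with 2 have "u2 = t2 \<and> s'' = s2" by (intro WhileTrue.IH(2)) simp
    with u \<open>u1 = t1 \<and> r1 = s1\<close> show ?thesis by simp
  qed
qed


section \<open>Solving a problem within a time bound\<close>

text \<open>The digraph is given by its adjacency matrix, stored row by row.\<close>

definition initial_state :: "cdbe_input \<Rightarrow> ram_state" where
  "initial_state I = (let n = order I in
     \<lparr>var = (\<lambda>_. 0)(''n'' := int n, ''k'' := budget I),
      arr = (\<lambda>_ _. 0)
        (''adj'' := (\<lambda>i. if i < n * n \<and> (i div n, i mod n) \<in> parcs (graph I) then 1 else 0),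
         ''delta'' := (\<lambda>v. if v < n then balance I v else 0))\<rparr>)"

text \<open>
  With this word bound a word has logarithmically many bits in \<open>n\<close> and in the absolute values of
  the input numbers. The latter are unbounded, so every input number has to fit into a word.
\<close>

definition word_bound :: "nat \<Rightarrow> cdbe_input \<Rightarrow> int" where
  "word_bound d I = (int (order I) + \<bar>budget I\<bar> + (\<Sum>v<order I. \<bar>balance I v\<bar>) + 2) ^ d"

text \<open>
  \<open>T n\<close> bounds the running time over all inputs with \<open>n\<close> vertices, whatever the size of the
  numbers in the input.
\<close>

definition solvable_in_time :: "(cdbe_input \<Rightarrow> bool) \<Rightarrow> (nat \<Rightarrow> real) \<Rightarrow> bool" where
  "solvable_in_time Q f \<longleftrightarrow>
    (\<exists>(c :: com) (d :: nat) (T :: nat \<Rightarrow> nat).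
       (\<lambda>n. real (T n)) \<in> O(f) \<and>
       (\<forall>I. valid_input I \<longrightarrow>
          (\<exists>t s. exec (word_bound d I) c (initial_state I) t s \<and>
                 t \<le> T (order I) \<and>
                 var s ''out'' = (if Q I then 1 else 0))))"

end

theory Submission
  imports Defs "HOL-Real_Asymp.Real_Asymp"
begin

text \<open>
  Let the vertex \<open>v\<close> need the balance \<open>T v\<close> more than it has. An edit sequence is then a flow with
  these supplies in which an arc can be used once by adding it and, if deletions are allowed, once
  by deleting the opposite arc. A deletion is needed only where the opposite arc is present in the
  result, so weak connections of the input are never lost. Let \<open>G\<close> have \<open>p \<ge> 2\<close> components, \<open>z\<close> of
  them with \<open>T = 0\<close> throughout, and let \<open>P\<close> be the sum of the positive \<open>T v\<close>. Exchanging, rerouting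
  and subdividing arcs turns a flow of minimum size \<open>m\<close> into a connecting one of size
  \<open>max {m, P + z, p - 1}\<close>, and no connecting flow is smaller.

  The minimum \<open>m\<close> is computed by cost scaling in the style of Goldberg and Tarjan. Every arc costs
  \<open>K\<close>, which is doubled in each scale until an approximately optimal flow is optimal. As the
  excess is moved one unit at a time, the work in a scale is bounded by the number of relabellings
  times \<open>n\<close>, that is by \<open>O(n\<^sup>3)\<close>, and there are \<open>O(log n)\<close> scales.
\<close>

section \<open>Flows and merging of components\<close>

text \<open>Between two components the input has no arc, so a cross pair can always carry one unit,
  by addition, and never more; this is why the three lower bounds are jointly attainable whatever
  the components look like inside. \<open>P + z\<close> is necessary because a component without
  supplies can only be joined by units passing through it, \<open>p - 1\<close> because fewer arcs
  cannot connect \<open>p\<close> classes. For sufficiency, a spare unit pays for subdividing an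
  arc, and without one the counts themselves supply a passing unit to reroute or an arc that is no
  bridge. With a single component both counts must be dropped: it is connected already, yet
  \<open>z\<close> may be 1. Infeasibility needs no separate algorithm: it shows as a vertex that is
  relabelled too often, or as supplies that do not sum to zero.\<close>

definition out_flow :: "nat \<Rightarrow> (nat \<Rightarrow> nat \<Rightarrow> int) \<Rightarrow> nat \<Rightarrow> int" where
  "out_flow n F u = (\<Sum>v<n. F u v)"

definition in_flow :: "nat \<Rightarrow> (nat \<Rightarrow> nat \<Rightarrow> int) \<Rightarrow> nat \<Rightarrow> int" where
  "in_flow n F u = (\<Sum>v<n. F v u)"

definition total :: "nat \<Rightarrow> (nat \<Rightarrow> nat \<Rightarrow> int) \<Rightarrow> int" where
  "total n F = (\<Sum>u<n. out_flow n F u)"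

definition flow :: "nat \<Rightarrow> (nat \<Rightarrow> nat \<Rightarrow> int) \<Rightarrow> (nat \<Rightarrow> int) \<Rightarrow> (nat \<Rightarrow> nat \<Rightarrow> int) \<Rightarrow> bool" where
  "flow n c T F \<longleftrightarrow> (\<forall>u<n. \<forall>v<n. 0 \<le> F u v \<and> F u v \<le> c u v) \<and>
     (\<forall>u<n. out_flow n F u - in_flow n F u = T u)"

definition unit_arc :: "nat \<Rightarrow> nat \<Rightarrow> nat \<Rightarrow> nat \<Rightarrow> int" where
  "unit_arc a b u v = of_bool (u = a \<and> v = b)"

lemma out_flow_add: "out_flow n (\<lambda>u v. F u v + F' u v) u = out_flow n F u + out_flow n F' u"
  and out_flow_diff: "out_flow n (\<lambda>u v. F u v - F' u v) u = out_flow n F u - out_flow n F' u"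
  and in_flow_add: "in_flow n (\<lambda>u v. F u v + F' u v) u = in_flow n F u + in_flow n F' u"
  and in_flow_diff: "in_flow n (\<lambda>u v. F u v - F' u v) u = in_flow n F u - in_flow n F' u"
  by (simp_all add: out_flow_def in_flow_def sum.distrib sum_subtractf)

lemma total_add: "total n (\<lambda>u v. F u v + F' u v) = total n F + total n F'"
  and total_diff: "total n (\<lambda>u v. F u v - F' u v) = total n F - total n F'"
  by (simp_all add: total_def out_flow_add out_flow_diff sum.distrib sum_subtractf)

lemma out_flow_unit: "b < n \<Longrightarrow> out_flow n (unit_arc a b) u = of_bool (u = a)"
  by (simp add: out_flow_def unit_arc_def of_bool_def if_distrib sum.delta cong: if_cong)

lemma in_flow_unit: "a < n \<Longrightarrow> in_flow n (unit_arc a b) u = of_bool (u = b)"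
  by (simp add: in_flow_def unit_arc_def of_bool_def if_distrib sum.delta cong: if_cong)

lemma total_unit: "a < n \<Longrightarrow> b < n \<Longrightarrow> total n (unit_arc a b) = 1"
  by (simp add: total_def out_flow_unit)

lemmas flow_simps = out_flow_add out_flow_diff in_flow_add in_flow_diff total_add total_diff
  out_flow_unit in_flow_unit total_unit

lemma sum_in_flow: "(\<Sum>u<n. in_flow n F u) = total n F"
  unfolding total_def in_flow_def out_flow_def by (rule sum.swap)

section \<open>Equivalence classes under added arcs\<close>

lemma card_quotient_strict_mono:
  assumes "finite V" "equiv V R" "equiv V R'" "R \<subset> R'"
  shows "card (V // R') < card (V // R)"
proof -
  let ?h = "\<lambda>X. R' `` X"
  have im: "R' `` (R `` {x}) = R' `` {x}" if "x \<in> V" for x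
  proof -
    have "(x, x) \<in> R" using assms(2) that by (simp add: equiv_def refl_on_def)
    moreover have "(x, y) \<in> R'" if "(x, z) \<in> R" "(z, y) \<in> R'" for y z
      using that assms(3,4) by (meson equivE psubsetD transD)
    ultimately show ?thesis by blast
  qed
  \<comment> \<open>Every class of the coarser relation is the image of a class of the finer one; a
    pair in \<open>R' - R\<close> keeps this map from being injective, and finiteness turns that
    into a strict drop.\<close>
  have surj: "?h ` (V // R) = V // R'"
    unfolding quotient_def by (simp add: image_UN im)
  obtain x y where xy: "(x, y) \<in> R'" "(x, y) \<notin> R" using assms(4) by auto
  have V: "x \<in> V" "y \<in> V" using xy assms(3) by (auto simp: equiv_def refl_on_def)
  have "R `` {x} \<noteq> R `` {y}" using xy(2) assms(2) V eq_equiv_class by fastforce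
  moreover have "?h (R `` {x}) = ?h (R `` {y})"
    using im V xy assms(3) by (metis equiv_class_eq)
  ultimately have "\<not> inj_on ?h (V // R)"
    using V by (meson inj_onD quotientI)
  moreover have "finite (V // R)" using assms by (meson equiv_type finite_quotient)
  ultimately have "card (?h ` (V // R)) < card (V // R)"
    by (metis card_image_le eq_card_imp_inj_on le_neq_implies_less)
  then show ?thesis by (simp add: surj)
qed

text \<open>
  The vertices with the same label \<open>l\<close> form a component of the input, which is all that
  the arguments about connectivity use of it.
\<close>

definition merged :: "nat \<Rightarrow> (nat \<Rightarrow> nat) \<Rightarrow> (nat \<times> nat) set \<Rightarrow> (nat \<times> nat) set" where
  "merged n l X = ({(u, v). u < n \<and> v < n \<and> (l u = l v \<or> (u, v) \<in> X \<or> (v, u) \<in> X)})\<^sup>+"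

lemma equiv_merged: "equiv {..<n} (merged n l X)"
proof -
  let ?B = "{(u, v). u < n \<and> v < n \<and> (l u = l v \<or> (u, v) \<in> X \<or> (v, u) \<in> X)}"
  have "sym ?B" by (auto simp: sym_def)
  then have "sym (?B\<^sup>+)" by (rule sym_trancl)
  moreover have "?B\<^sup>+ \<subseteq> {..<n} \<times> {..<n}" by (rule trancl_subset_Sigma) auto
  moreover have "refl_on {..<n} (?B\<^sup>+)" using calculation(2) by (auto simp: refl_on_def)
  ultimately show ?thesis by (auto simp: equiv_def merged_def)
qed

lemma merged_mono: "X \<subseteq> Y \<Longrightarrow> merged n l X \<subseteq> merged n l Y"
  unfolding merged_def by (rule trancl_mono_subset) auto

lemma merged_subset: "merged n l X \<subseteq> {..<n} \<times> {..<n}"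
  using equiv_merged by (rule equiv_type)

lemma merged_lab: "u < n \<Longrightarrow> v < n \<Longrightarrow> l u = l v \<Longrightarrow> (u, v) \<in> merged n l X"
  unfolding merged_def by blast

lemma merged_arc: "u < n \<Longrightarrow> v < n \<Longrightarrow> (u, v) \<in> X \<Longrightarrow> (u, v) \<in> merged n l X"
  unfolding merged_def by blast

lemma merged_sym: "(u, v) \<in> merged n l X \<Longrightarrow> (v, u) \<in> merged n l X"
  using equiv_merged[of n l X] by (auto simp: equiv_def sym_def)

lemma merged_trans: "(u, v) \<in> merged n l X \<Longrightarrow> (v, w) \<in> merged n l X \<Longrightarrow> (u, w) \<in> merged n l X"
  unfolding merged_def by (rule trancl_trans)

text \<open>\<open>merged n l Y\<close> is already transitive and symmetric and contains all pairs
  of equal label, so only arcs of \<open>X\<close> between different labels remain to be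
  checked.\<close>

lemma merged_subsetI:
  assumes "\<And>u v. \<lbrakk>u < n; v < n; (u, v) \<in> X; l u \<noteq> l v\<rbrakk> \<Longrightarrow> (u, v) \<in> merged n l Y"
  shows "merged n l X \<subseteq> merged n l Y"
proof -
  have "(u, v) \<in> merged n l Y" if "u < n" "v < n" "l u = l v \<or> (u, v) \<in> X \<or> (v, u) \<in> X" for u v
    using that assms by (metis merged_lab merged_sym)
  then have "{(u, v). u < n \<and> v < n \<and> (l u = l v \<or> (u, v) \<in> X \<or> (v, u) \<in> X)} \<subseteq> merged n l Y"
    by blast
  then have "merged n l X \<subseteq> (merged n l Y)\<^sup>+" unfolding merged_def[of n l X] by (rule trancl_mono_subset)
  then show ?thesis by (simp add: merged_def trancl_id)
qed

lemma card_quotient_lab: "card ({..<n} // merged n l {}) \<le> card (l ` {..<n})"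
proof -
  have m: "merged n l {} = {(u, v). u < n \<and> v < n \<and> l u = l v}"
    unfolding merged_def by (subst trancl_id) (auto simp: trans_def)
  have "{..<n} // merged n l {} \<subseteq> (\<lambda>x. {v. v < n \<and> x = l v}) ` (l ` {..<n})"
    unfolding quotient_def m by (auto simp: image_iff)
  then show ?thesis by (rule surj_card_le[rotated]) simp
qed

text \<open>
  If every arc of \<open>X\<close> is a bridge, each one lowers the number of components.
\<close>

lemma forest_card:
  assumes "finite X" "X \<subseteq> {..<n} \<times> {..<n}" "\<And>a b. (a, b) \<in> X \<Longrightarrow> (a, b) \<notin> merged n l (X - {(a, b)})"
  shows "card ({..<n} // merged n l X) + card X \<le> card (l ` {..<n})"
  using assms
proof (induction X rule: finite_induct)
  case empty
  then show ?case using card_quotient_lab by simp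
next
  case (insert e X)
  obtain a b where e: "e = (a, b)" by fastforce
  have "card ({..<n} // merged n l X) + card X \<le> card (l ` {..<n})"
  proof (rule insert.IH)
    fix a' b' assume *: "(a', b') \<in> X"
    have "merged n l (X - {(a', b')}) \<subseteq> merged n l (insert e X - {(a', b')})"
      by (rule merged_mono) auto
    then show "(a', b') \<notin> merged n l (X - {(a', b')})" using insert.prems(2)[of a' b'] * by auto
  qed (use insert.prems in auto)
  moreover have "card ({..<n} // merged n l (insert e X)) < card ({..<n} // merged n l X)"
  proof (rule card_quotient_strict_mono[OF _ equiv_merged equiv_merged])
    have "(a, b) \<notin> merged n l X" using insert.prems(2)[of a b] insert.hyps e by auto
    moreover have "(a, b) \<in> merged n l (insert e X)" using insert.prems e by (auto intro: merged_arc)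
    moreover have "merged n l X \<subseteq> merged n l (insert e X)" by (rule merged_mono) auto
    ultimately show "merged n l X \<subset> merged n l (insert e X)" by blast
  qed simp
  ultimately show ?case using insert.hyps by simp
qed

text \<open>Serves as the induction principle for connections: with \<open>f\<close> a membership
  test it separates a component from the rest, with \<open>f\<close> class-valued it proves that two
  vertices stay connected.\<close>

lemma merged_invariant:
  assumes "\<And>u v. \<lbrakk>u < n; v < n; l u = l v\<rbrakk> \<Longrightarrow> f u = f v"
    and "\<And>u v. \<lbrakk>u < n; v < n; (u, v) \<in> X\<rbrakk> \<Longrightarrow> f u = f v"
    and "(u, v) \<in> merged n l X"
  shows "f u = f v"
proof -
  have *: "f x = f y" if h: "(x, y) \<in> {(u, v). u < n \<and> v < n \<and> (l u = l v \<or> (u, v) \<in> X \<or> (v, u) \<in> X)}" for x y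
  proof -
    have "x < n" "y < n" using h by simp_all
    moreover have "l x = l y \<or> (x, y) \<in> X \<or> (y, x) \<in> X" using h by simp
    ultimately show ?thesis using assms(1)[of x y] assms(2)[of x y] assms(2)[of y x] by argo
  qed
  from assms(3) show ?thesis unfolding merged_def
  proof (induction rule: trancl_induct)
    case (base y)
    then show ?case by (rule *)
  next
    case (step y z)
    show ?case using step.IH *[OF step.hyps(2)] by (rule trans)
  qed
qed

text \<open>A connection of \<open>p\<close> classes needs \<open>p - 1\<close> arcs. Instead of the
  quotient, the induction carries a labelling \<open>f\<close> that is constant on the classes of
  \<open>merged n l X\<close>; each arc costs at most one value of \<open>f\<close>, and in the
  connected case one value is left.\<close>

lemma card_lab_le:
  assumes "finite X" "X \<subseteq> {..<n} \<times> {..<n}" "merged n l X = {..<n} \<times> {..<n}"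
  shows "card (l ` {..<n}) \<le> card X + 1"
proof -
  have "\<exists>f :: nat \<Rightarrow> nat. (\<forall>u v. (u, v) \<in> merged n l X \<longrightarrow> f u = f v) \<and> card (l ` {..<n}) \<le> card (f ` {..<n}) + card X"
    using assms(1)
  proof induction
    case empty
    have "l u = l v" if "(u, v) \<in> merged n l {}" for u v
      using that by (rule merged_invariant[rotated 2]) auto
    then show ?case by (intro exI[of _ l] conjI allI impI) simp_all
  next
    case (insert e X)
    obtain a b where e: "e = (a, b)" by fastforce
    obtain f :: "nat \<Rightarrow> nat" where f: "\<And>u v. (u, v) \<in> merged n l X \<Longrightarrow> f u = f v" "card (l ` {..<n}) \<le> card (f ` {..<n}) + card X"
      using insert.IH by blast
    \<comment> \<open>Renaming the value \<open>f a\<close> to \<open>f b\<close> makes the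
      labelling constant across the new arc \<open>(a, b)\<close> and removes at most the value
      \<open>f a\<close> from its range.\<close>
    define g where "g x = (if f x = f a then f b else f x)" for x
    have 1: "g u = g v" if "(u, v) \<in> merged n l (insert e X)" for u v
      using that
    proof (rule merged_invariant[rotated 2])
      fix u v assume *: "u < n" "v < n"
      show "g u = g v" if "l u = l v"
        using f(1)[OF merged_lab[OF * that]] by (simp add: g_def)
      show "g u = g v" if "(u, v) \<in> insert e X"
        using f(1)[OF merged_arc[OF * , of X]] that e unfolding g_def by (cases "(u, v) = e") auto
    qed
    have "f ` {..<n} \<subseteq> insert (f a) (g ` {..<n})"
    proof (rule image_subsetI)
      fix x assume "x \<in> {..<n}"
      then have "g x \<in> g ` {..<n}" by (rule imageI)
      then show "f x \<in> insert (f a) (g ` {..<n})" by (cases "f x = f a") (simp_all add: g_def)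
    qed
    then have "card (f ` {..<n}) \<le> card (insert (f a) (g ` {..<n}))" by (rule card_mono[rotated]) simp
    also have "\<dots> \<le> card (g ` {..<n}) + 1" by (simp add: card_insert_if)
    finally have "card (l ` {..<n}) \<le> card (g ` {..<n}) + card (insert e X)"
      using f(2) insert.hyps by simp
    with 1 show ?case by blast
  qed
  then obtain f :: "nat \<Rightarrow> nat" where f: "\<forall>u v. (u, v) \<in> merged n l X \<longrightarrow> f u = f v" "card (l ` {..<n}) \<le> card (f ` {..<n}) + card X"
    by blast
  have "f ` {..<n} \<subseteq> {f 0}"
  proof (rule image_subsetI)
    fix x assume "x \<in> {..<n}"
    then have "(x, 0) \<in> merged n l X" using assms(3) by auto
    then show "f x \<in> {f 0}" using f(1) by blast
  qed
  then have "card (f ` {..<n}) \<le> card {f 0}" by (rule card_mono[rotated]) simp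
  then show ?thesis using f(2) by simp
qed

section \<open>Flows in a network with unit capacities between components\<close>

locale conn_network =
  fixes n :: nat and c :: "nat \<Rightarrow> nat \<Rightarrow> int" and T :: "nat \<Rightarrow> int" and l :: "nat \<Rightarrow> nat"
  assumes c_loop: "c u u = 0"
    and c_cross: "\<lbrakk>u < n; v < n; l u \<noteq> l v\<rbrakk> \<Longrightarrow> c u v = 1"
begin

abbreviation "V \<equiv> {..<n}"

definition supp :: "(nat \<Rightarrow> nat \<Rightarrow> int) \<Rightarrow> (nat \<times> nat) set" where
  "supp F = {(u, v). u < n \<and> v < n \<and> F u v > 0}"

definition linked :: "(nat \<Rightarrow> nat \<Rightarrow> int) \<Rightarrow> (nat \<times> nat) set" where
  "linked F = merged n l (supp F)"

definition untouched :: "nat set" where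
  "untouched = {x \<in> l ` V. \<forall>u<n. l u = x \<longrightarrow> T u = 0}"

definition demand :: int where
  "demand = (\<Sum>u<n. max (T u) 0)"

text \<open>Arcs inside the component count as well. At an untouched label inflow and outflow agree
  at every vertex, so load 0 means that no unit enters, leaves or circulates there.\<close>

definition load :: "(nat \<Rightarrow> nat \<Rightarrow> int) \<Rightarrow> nat \<Rightarrow> int" where
  "load F x = (\<Sum>u | u < n \<and> l u = x. out_flow n F u)"

lemma load_add: "load (\<lambda>u v. F u v + F' u v) x = load F x + load F' x"
  and load_diff: "load (\<lambda>u v. F u v - F' u v) x = load F x - load F' x"
  by (simp_all add: load_def out_flow_add out_flow_diff sum.distrib sum_subtractf)

lemma load_unit: "a < n \<Longrightarrow> b < n \<Longrightarrow> load (unit_arc a b) x = of_bool (l a = x)"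
  by (auto simp: load_def out_flow_unit of_bool_def sum.delta intro: sum.neutral)

lemma flowD:
  assumes "flow n c T F" "u < n" "v < n"
  shows "0 \<le> F u v" "F u v \<le> c u v" "out_flow n F u - in_flow n F u = T u"
  using assms by (auto simp: flow_def)

lemma out_flow_nonneg: "flow n c T F \<Longrightarrow> u < n \<Longrightarrow> 0 \<le> out_flow n F u"
  unfolding out_flow_def by (rule sum_nonneg) (auto dest: flowD)

lemma in_flow_nonneg: "flow n c T F \<Longrightarrow> u < n \<Longrightarrow> 0 \<le> in_flow n F u"
  unfolding in_flow_def by (rule sum_nonneg) (auto dest: flowD)

lemma out_flow_pos_iff:
  assumes "flow n c T F" "u < n"
  shows "0 < out_flow n F u \<longleftrightarrow> (\<exists>v<n. F u v > 0)"
proof -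
  have "out_flow n F u = 0 \<longleftrightarrow> (\<forall>v\<in>V. F u v = 0)"
    unfolding out_flow_def using assms by (intro sum_nonneg_eq_0_iff) (auto dest: flowD)
  then show ?thesis using out_flow_nonneg[OF assms] flowD(1)[OF assms]
    by (metis lessThan_iff less_le)
qed

lemma in_flow_pos_iff:
  assumes "flow n c T F" "u < n"
  shows "0 < in_flow n F u \<longleftrightarrow> (\<exists>v<n. F v u > 0)"
proof -
  have "in_flow n F u = 0 \<longleftrightarrow> (\<forall>v\<in>V. F v u = 0)"
    unfolding in_flow_def using assms by (intro sum_nonneg_eq_0_iff) (auto dest: flowD)
  then show ?thesis using in_flow_nonneg[OF assms] flowD(1)[OF assms(1) _ assms(2)]
    by (metis lessThan_iff less_le)
qed

lemma load_nonneg: "flow n c T F \<Longrightarrow> 0 \<le> load F x"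
  unfolding load_def by (rule sum_nonneg) (auto simp: out_flow_nonneg)

lemma load_pos_iff:
  assumes "flow n c T F"
  shows "0 < load F x \<longleftrightarrow> (\<exists>u v. u < n \<and> v < n \<and> l u = x \<and> F u v > 0)"
proof -
  have "load F x = 0 \<longleftrightarrow> (\<forall>u\<in>{u. u < n \<and> l u = x}. out_flow n F u = 0)"
    unfolding load_def using assms by (intro sum_nonneg_eq_0_iff) (auto simp: out_flow_nonneg)
  then have "0 < load F x \<longleftrightarrow> (\<exists>u<n. l u = x \<and> 0 < out_flow n F u)"
    using load_nonneg[OF assms, of x] out_flow_nonneg[OF assms] by (auto simp: less_le)
  then show ?thesis using out_flow_pos_iff[OF assms] by blast
qed

lemma total_pos_iff:
  assumes "flow n c T F"
  shows "0 < total n F \<longleftrightarrow> (\<exists>u v. u < n \<and> v < n \<and> F u v > 0)"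
proof -
  have "total n F = 0 \<longleftrightarrow> (\<forall>u\<in>V. out_flow n F u = 0)"
    unfolding total_def using assms by (intro sum_nonneg_eq_0_iff) (auto simp: out_flow_nonneg)
  moreover have "0 \<le> total n F"
    unfolding total_def by (rule sum_nonneg) (auto simp: out_flow_nonneg assms)
  ultimately have "0 < total n F \<longleftrightarrow> (\<exists>u<n. 0 < out_flow n F u)"
    using out_flow_nonneg[OF assms] by (auto simp: less_le)
  then show ?thesis using out_flow_pos_iff[OF assms] by blast
qed

text \<open>Of the units leaving \<open>u\<close>, \<open>max (T u) 0\<close> start there; the
  others pass through, and their number is the smaller of outflow and inflow because the two differ
  by \<open>T u\<close>.\<close>

lemma total_eq_demand:
  assumes "flow n c T F"
  shows "total n F = demand + (\<Sum>u<n. min (out_flow n F u) (in_flow n F u))"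
proof -
  have "out_flow n F u = max (T u) 0 + min (out_flow n F u) (in_flow n F u)" if "u < n" for u
    using flowD(3)[OF assms that that] by linarith
  then show ?thesis unfolding total_def demand_def by (simp add: sum.distrib[symmetric])
qed

lemma sum_by_label:
  fixes g :: "nat \<Rightarrow> int"
  shows "(\<Sum>u<n. g u) = (\<Sum>x\<in>l ` V. \<Sum>u | u < n \<and> l u = x. g u)"
  using sum.image_gen[of V g l] by simp

lemma load_untouched:
  assumes "flow n c T F" "x \<in> untouched"
  shows "(\<Sum>u | u < n \<and> l u = x. min (out_flow n F u) (in_flow n F u)) = load F x"
  unfolding load_def
proof (rule sum.cong)
  fix u assume "u \<in> {u. u < n \<and> l u = x}"
  then show "min (out_flow n F u) (in_flow n F u) = out_flow n F u"
    using flowD(3)[OF assms(1), of u u] assms(2) by (auto simp: untouched_def)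
qed simp

text \<open>In an untouched component all outgoing units pass through, so each loaded one
  contributes at least 1 to the sum in \<open>total_eq_demand\<close>; different components have
  disjoint vertex sets.\<close>

lemma demand_le_total:
  assumes F: "flow n c T F" and pos: "\<And>x. x \<in> untouched \<Longrightarrow> 0 < load F x"
  shows "demand + int (card untouched) \<le> total n F"
proof -
  let ?m = "\<lambda>u. min (out_flow n F u) (in_flow n F u)"
  have m: "0 \<le> ?m u" if "u < n" for u using F that by (simp add: out_flow_nonneg in_flow_nonneg)
  have "int (card untouched) = (\<Sum>x\<in>untouched. 1)" by simp
  also have "\<dots> \<le> (\<Sum>x\<in>untouched. \<Sum>u | u < n \<and> l u = x. ?m u)"
  proof (rule sum_mono)
    fix x assume x: "x \<in> untouched"
    show "1 \<le> (\<Sum>u | u < n \<and> l u = x. ?m u)" using pos[OF x] by (simp add: load_untouched[OF F x])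
  qed
  also have "\<dots> \<le> (\<Sum>x\<in>l ` V. \<Sum>u | u < n \<and> l u = x. ?m u)"
    by (rule sum_mono2) (auto simp: untouched_def out_flow_nonneg[OF F] in_flow_nonneg[OF F] intro!: sum_nonneg)
  also have "\<dots> = (\<Sum>u<n. ?m u)" by (rule sum_by_label[symmetric])
  finally show ?thesis using total_eq_demand[OF F] by simp
qed

lemma no_arc_unloaded:
  assumes F: "flow n c T F" and x: "x \<in> untouched" "load F x = 0" and u: "u < n" "v < n" "l u = x"
  shows "F u v = 0" "F v u = 0"
proof -
  have "\<not> 0 < out_flow n F u"
    using load_pos_iff[OF F, of x] out_flow_pos_iff[OF F, of u] x u by auto
  then have o: "out_flow n F u = 0" using out_flow_nonneg[OF F, of u] u by simp
  then have i: "in_flow n F u = 0" using flowD(3)[OF F, of u u] x u by (simp add: untouched_def)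
  show "F u v = 0" using o out_flow_pos_iff[OF F, of u] flowD(1)[OF F, of u v] u by force
  show "F v u = 0" using i in_flow_pos_iff[OF F, of u] flowD(1)[OF F, of v u] u by force
qed

text \<open>By \<open>no_arc_unloaded\<close> no arc of the flow meets an untouched component with
  load 0, so membership in it is invariant under \<open>merged\<close>; yet with at least two labels
  there is a vertex outside.\<close>

lemma connected_imp_load:
  assumes F: "flow n c T F" and linked: "linked F = V \<times> V" and p: "2 \<le> card (l ` V)" and x: "x \<in> untouched"
  shows "0 < load F x"
proof (rule ccontr)
  assume "\<not> 0 < load F x"
  then have 0: "load F x = 0" using load_nonneg[OF F, of x] by simp
  have "\<not> l ` V \<subseteq> {x}" using p card_mono[of "{x}" "l ` V"] by auto
  then obtain v where v: "v < n" "l v \<noteq> x" by auto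
  obtain u where u: "u < n" "l u = x" using x by (auto simp: untouched_def)
  have "(u, v) \<in> merged n l (supp F)" using linked u v by (auto simp: linked_def)
  then have "(l u = x) = (l v = x)"
  proof (rule merged_invariant[rotated 2, where f = "\<lambda>u. l u = x"])
    fix u v assume "u < n" "v < n" "(u, v) \<in> supp F"
    then show "(l u = x) = (l v = x)"
      using no_arc_unloaded[OF F x 0, of u v] no_arc_unloaded[OF F x 0, of v u] by (auto simp: supp_def)
  qed simp
  then show False using u v by simp
qed

text \<open>A detour of one unit from \<open>a\<close> over \<open>r\<close> to \<open>b\<close>.
  The two new arcs join different components, hence have capacity 1, and they were empty. The arc
  \<open>(a, b)\<close> may vanish from the support, but its ends remain joined through
  \<open>r\<close>.\<close>

lemma subdivide:
  assumes F: "flow n c T F" and ab: "a < n" "b < n" "0 < F a b" and r: "r < n" "l a \<noteq> l r" "l b \<noteq> l r"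
    "F a r = 0" "F r b = 0"
  defines "F' \<equiv> \<lambda>u v. F u v - unit_arc a b u v + unit_arc a r u v + unit_arc r b u v"
  shows "flow n c T F'" "total n F' = total n F + 1" "load F' x = load F x + of_bool (l r = x)"
    "\<And>u v. (u, v) \<in> supp F \<Longrightarrow> (u, v) \<noteq> (a, b) \<Longrightarrow> (u, v) \<in> supp F'" "(a, r) \<in> supp F'" "(r, b) \<in> supp F'"
proof -
  have ne: "a \<noteq> r" "b \<noteq> r" using r by auto
  have cc: "c a r = 1" "c r b = 1" using c_cross ab r by metis+
  show "flow n c T F'"
    unfolding flow_def
  proof (intro conjI allI impI)
    fix u v assume *: "u < n" "v < n"
    show "0 \<le> F' u v" "F' u v \<le> c u v"
      using flowD(1,2)[OF F *] ab r ne cc unfolding F'_def unit_arc_def of_bool_def by auto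
  next
    fix u assume "u < n"
    then show "out_flow n F' u - in_flow n F' u = T u"
      using flowD(3)[OF F, of u u] ab r by (simp add: F'_def flow_simps)
  qed
  show "total n F' = total n F + 1" using ab r by (simp add: F'_def flow_simps)
  show "load F' x = load F x + of_bool (l r = x)"
    using ab r by (simp add: F'_def load_add load_diff load_unit)
  show "(u, v) \<in> supp F'" if "(u, v) \<in> supp F" "(u, v) \<noteq> (a, b)" for u v
    using that by (auto simp: supp_def F'_def unit_arc_def of_bool_def)
  show "(a, r) \<in> supp F'" "(r, b) \<in> supp F'"
    using ab r ne by (auto simp: supp_def F'_def unit_arc_def of_bool_def)
qed

text \<open>A unit that passes through \<open>x\<close> is led through \<open>r\<close> instead, so
  one unit of load moves between their components at no cost.\<close>

lemma reroute:
  assumes F: "flow n c T F" and u: "u < n" "x < n" "v < n" "0 < F u x" "0 < F x v"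
    and r: "r < n" "l u \<noteq> l r" "l v \<noteq> l r" "F u r = 0" "F r v = 0"
  defines "F' \<equiv> \<lambda>y w. F y w - unit_arc u x y w - unit_arc x v y w + unit_arc u r y w + unit_arc r v y w"
  shows "flow n c T F'" "total n F' = total n F"
    "load F' y = load F y - of_bool (l x = y) + of_bool (l r = y)"
proof -
  have ne: "u \<noteq> r" "v \<noteq> r" using r by auto
  \<comment> \<open>Otherwise \<open>(u, x)\<close> and \<open>(x, v)\<close> could be the same
    loop, from which two units would be taken; loops carry nothing.\<close>
  have ux: "u \<noteq> x" using flowD(2)[OF F, of x x] u c_loop[of x] by auto
  have cc: "c u r = 1" "c r v = 1" using c_cross u r by metis+
  show "flow n c T F'"
    unfolding flow_def
  proof (intro conjI allI impI)
    fix y w assume *: "y < n" "w < n"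
    show "0 \<le> F' y w" "F' y w \<le> c y w"
      using flowD(1,2)[OF F *] u r ne ux cc unfolding F'_def unit_arc_def of_bool_def by auto
  next
    fix y assume "y < n"
    then show "out_flow n F' y - in_flow n F' y = T y"
      using flowD(3)[OF F, of y y] u r by (simp add: F'_def flow_simps)
  qed
  show "total n F' = total n F" using u r by (simp add: F'_def flow_simps)
  show "load F' y = load F y - of_bool (l x = y) + of_bool (l r = y)"
    using u r by (simp add: F'_def load_add load_diff load_unit)
qed

text \<open>Two arcs swap their heads, so every vertex keeps its outflow and its inflow, and with
  them size and loads stay. The hypotheses on the labels make both new arcs cross arcs of capacity
  1.\<close>

lemma exchange:
  assumes F: "flow n c T F" and ab: "a < n" "b < n" "0 < F a b" and de: "d < n" "e < n" "0 < F d e"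
    and lab: "l a \<noteq> l e" "l d \<noteq> l b" "F a e = 0" "F d b = 0"
  defines "F' \<equiv> \<lambda>u v. F u v - unit_arc a b u v - unit_arc d e u v + unit_arc a e u v + unit_arc d b u v"
  shows "flow n c T F'" "total n F' = total n F" "load F' x = load F x"
    "\<And>u v. (u, v) \<in> supp (\<lambda>u v. F u v - unit_arc a b u v) \<Longrightarrow> (u, v) \<noteq> (d, e) \<Longrightarrow> (u, v) \<in> supp F'"
    "(a, e) \<in> supp F'" "(d, b) \<in> supp F'"
proof -
  have ne: "a \<noteq> d" "b \<noteq> e" using ab de lab by auto
  have cc: "c a e = 1" "c d b = 1" using c_cross ab de lab by metis+
  show "flow n c T F'"
    unfolding flow_def
  proof (intro conjI allI impI)
    fix u v assume *: "u < n" "v < n"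
    show "0 \<le> F' u v" "F' u v \<le> c u v"
      using flowD(1,2)[OF F *] ab de lab ne cc unfolding F'_def unit_arc_def of_bool_def by auto
  next
    fix u assume "u < n"
    then show "out_flow n F' u - in_flow n F' u = T u"
      using flowD(3)[OF F, of u u] ab de by (simp add: F'_def flow_simps)
  qed
  show "total n F' = total n F" using ab de by (simp add: F'_def flow_simps)
  show "load F' x = load F x" using ab de by (simp add: F'_def load_add load_diff load_unit)
  show "(u, v) \<in> supp F'" if "(u, v) \<in> supp (\<lambda>u v. F u v - unit_arc a b u v)" "(u, v) \<noteq> (d, e)" for u v
    using that by (auto simp: supp_def F'_def unit_arc_def of_bool_def)
  show "(a, e) \<in> supp F'" "(d, b) \<in> supp F'"
    using ab de lab ne by (auto simp: supp_def F'_def unit_arc_def of_bool_def)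
qed

text \<open>For the zero flow there is nothing to subdivide or to reroute. Two opposite arcs keep
  all balances and load two components at once.\<close>

lemma two_cycle:
  assumes F: "flow n c T F" and r: "r < n" "s < n" "l r \<noteq> l s" "F r s = 0" "F s r = 0"
  defines "F' \<equiv> \<lambda>u v. F u v + unit_arc r s u v + unit_arc s r u v"
  shows "flow n c T F'" "total n F' = total n F + 2"
    "load F' x = load F x + of_bool (l r = x) + of_bool (l s = x)"
proof -
  have ne: "r \<noteq> s" using r by auto
  have cc: "c r s = 1" "c s r = 1" using c_cross r by metis+
  show "flow n c T F'"
    unfolding flow_def
  proof (intro conjI allI impI)
    fix u v assume *: "u < n" "v < n"
    show "0 \<le> F' u v" "F' u v \<le> c u v"
      using flowD(1,2)[OF F *] r ne cc unfolding F'_def unit_arc_def of_bool_def by auto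
  next
    fix u assume "u < n"
    then show "out_flow n F' u - in_flow n F' u = T u"
      using flowD(3)[OF F, of u u] r by (simp add: F'_def flow_simps)
  qed
  show "total n F' = total n F + 2" using r by (simp add: F'_def flow_simps)
  show "load F' x = load F x + of_bool (l r = x) + of_bool (l s = x)"
    using r by (simp add: F'_def load_add load_unit)
qed


section \<open>Loading the untouched components\<close>

definition idle :: "(nat \<Rightarrow> nat \<Rightarrow> int) \<Rightarrow> nat set" where
  "idle F = {x \<in> untouched. load F x = 0}"

lemma finite_untouched: "finite untouched"
  by (simp add: untouched_def)

lemma exists_other_label: "2 \<le> card (l ` V) \<Longrightarrow> \<exists>v<n. l v \<noteq> x"
  using card_mono[of "{x}" "l ` V"] by auto

text \<open>
  The size of a flow is the demand plus the number of paths that pass through vertices. If at least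
  as many pass as there are untouched components, one of them can be rerouted through an idle
  component without making another one idle.
\<close>

lemma touch_step:
  assumes F: "flow n c T F" and M: "total n F \<le> M" "demand + int (card untouched) \<le> M"
    and p: "2 \<le> card (l ` V)" and x: "x \<in> idle F"
  shows "\<exists>F'. flow n c T F' \<and> total n F' \<le> M \<and> card (idle F') < card (idle F)"
proof -
  have x': "x \<in> untouched" "load F x = 0" using x by (auto simp: idle_def)
  then obtain r where r: "r < n" "l r = x" by (auto simp: untouched_def)
  note na = no_arc_unloaded[OF F x']
  have progress: "card (idle F') < card (idle F)"
    if "0 < load F' x" "\<And>y. y \<in> untouched \<Longrightarrow> 0 < load F y \<Longrightarrow> 0 < load F' y" for F'
  proof (rule psubset_card_mono)
    show "finite (idle F)" using finite_untouched by (simp add: idle_def)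
    have "idle F' \<subseteq> idle F" using that(2) load_nonneg[OF F] by (fastforce simp: idle_def less_le)
    moreover have "x \<notin> idle F'" using that(1) by (simp add: idle_def)
    ultimately show "idle F' \<subset> idle F" using x by blast
  qed
  have nonneg: "0 \<le> total n F" using out_flow_nonneg[OF F] by (auto simp: total_def intro: sum_nonneg)
  consider "total n F = 0" | "0 < total n F" "total n F < M" | "total n F = M" "0 < total n F"
    using nonneg M(1) by linarith
  then show ?thesis
  proof cases
    case 1
    have zero: "F u v = 0" if "u < n" "v < n" for u v
      using total_pos_iff[OF F] 1 flowD(1)[OF F that] that by force
    then have "T u = 0" if "u < n" for u
      using flowD(3)[OF F that that] that by (simp add: out_flow_def in_flow_def)
    \<comment> \<open>The zero flow forces all supplies to be 0, so every component counts as
      untouched; as there are at least two, \<open>M\<close> is at least 2 and pays for a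
      two-cycle.\<close>
    then have "untouched = l ` V" by (auto simp: untouched_def)
    then have "2 \<le> int (card untouched)" using p by simp
    moreover have "0 \<le> demand" by (auto simp: demand_def intro: sum_nonneg)
    ultimately have M2: "2 \<le> M" using M(2) by linarith
    obtain s where s: "s < n" "l s \<noteq> x" using exists_other_label[OF p] by blast
    have ls: "l r \<noteq> l s" using r s by simp
    note tc = two_cycle[OF F r(1) s(1) ls zero[OF r(1) s(1)] zero[OF s(1) r(1)]]
    show ?thesis
      by (rule exI, rule conjI[OF tc(1)], rule conjI)
         (use 1 M2 tc(2) in simp, rule progress, use r x'(2) tc(3) in \<open>simp_all add: load_nonneg[OF F]\<close>)
  next
    case 2
    obtain a b where ab: "a < n" "b < n" "0 < F a b" using total_pos_iff[OF F] 2 by blast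
    have lab: "l a \<noteq> l r" "l b \<noteq> l r" using na[of a b] na[of b a] ab r by auto
    note sd = subdivide[OF F ab r(1) lab na(2)[OF r(1) ab(1) r(2)] na(1)[OF r(1) ab(2) r(2)]]
    show ?thesis
      by (rule exI, rule conjI[OF sd(1)], rule conjI)
         (use 2 sd(2) in simp, rule progress, use r x'(2) sd(3) in \<open>simp_all\<close>)
  next
    case 3
    let ?m = "\<lambda>u. min (out_flow n F u) (in_flow n F u)"
    have m0: "0 \<le> ?m u" if "u < n" for u
      using out_flow_nonneg[OF F that] in_flow_nonneg[OF F that] by simp
    \<comment> \<open>Pigeonhole: if no such vertex existed, touched components would have no
      passing unit, every untouched one at most one, and \<open>x\<close> none. Fewer than
      \<open>card untouched\<close> units would pass, although \<open>total n F = M\<close> leaves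
      at least that many.\<close>
    have "\<exists>y<n. 0 < ?m y \<and> (l y \<in> untouched \<longrightarrow> 2 \<le> load F (l y))"
    proof (rule ccontr)
      assume neg: "\<not> ?thesis"
      have "(\<Sum>u<n. ?m u) = (\<Sum>y\<in>l ` V. \<Sum>u | u < n \<and> l u = y. ?m u)" by (rule sum_by_label)
      also have "\<dots> \<le> (\<Sum>y\<in>l ` V. of_bool (y \<in> untouched - {x}))"
      proof (rule sum_mono)
        fix y assume "y \<in> l ` V"
        show "(\<Sum>u | u < n \<and> l u = y. ?m u) \<le> of_bool (y \<in> untouched - {x})"
        proof (cases "y \<in> untouched")
          case True
          have "load F y \<le> of_bool (y \<noteq> x)"
          proof (cases "y = x")
            case False
            have "load F y \<le> 1"
            proof (rule ccontr)
              assume *: "\<not> load F y \<le> 1"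
              then have "(\<Sum>u | u < n \<and> l u = y. ?m u) \<noteq> 0" using load_untouched[OF F True] by simp
              then obtain u where u: "u < n" "l u = y" "?m u \<noteq> 0" by (auto elim!: sum.not_neutral_contains_not_neutral)
              then have "0 < ?m u" using m0[OF u(1)] by linarith
              moreover have "2 \<le> load F (l u)" using * u(2) by simp
              ultimately show False using neg u(1) by blast
            qed
            then show ?thesis using False by simp
          qed (simp add: x')
          then show ?thesis using load_untouched[OF F True] True by simp
        next
          case False
          have "?m u = 0" if "u < n" "l u = y" for u
          proof -
            have "\<not> 0 < ?m u" using neg that False by blast
            then show ?thesis using m0[OF that(1)] by linarith
          qed
          then show ?thesis by (simp add: sum.neutral)
        qed
      qed
      also have "\<dots> = int (card (untouched - {x}))"
        by (auto simp: untouched_def intro!: arg_cong[where f = card])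
      also have "\<dots> < int (card untouched)"
        using card_Diff1_less[OF finite_untouched x'(1)] by simp
      finally show False using 3 M(2) total_eq_demand[OF F] by linarith
    qed
    then obtain y where y: "y < n" "0 < out_flow n F y" "0 < in_flow n F y"
      "l y \<in> untouched \<longrightarrow> 2 \<le> load F (l y)" by auto
    obtain v where v: "v < n" "0 < F y v" using out_flow_pos_iff[OF F y(1)] y(2) by blast
    obtain u where u: "u < n" "0 < F u y" using in_flow_pos_iff[OF F y(1)] y(3) by blast
    have lab: "l u \<noteq> l r" "l v \<noteq> l r" using na[of u y] na[of v y] u v y(1) r by auto
    have yx: "l y \<noteq> x" using na[of y v] v y(1) by auto
    note rr = reroute[OF F u(1) y(1) v(1) u(2) v(2) r(1) lab na(2)[OF r(1) u(1) r(2)] na(1)[OF r(1) v(1) r(2)]]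
    show ?thesis
      by (rule exI, rule conjI[OF rr(1)], rule conjI)
         (use 3 rr(2) in simp, rule progress, use r x'(2) yx y(4) rr(3) in \<open>auto simp: of_bool_def\<close>)
  qed
qed

lemma touch_all:
  assumes "flow n c T F" "total n F \<le> M" "demand + int (card untouched) \<le> M" "2 \<le> card (l ` V)"
  shows "\<exists>F'. flow n c T F' \<and> total n F' \<le> M \<and> (\<forall>x\<in>untouched. 0 < load F' x)"
  using assms(1,2)
proof (induction "card (idle F)" arbitrary: F rule: less_induct)
  case less
  show ?case
  proof (cases "idle F = {}")
    case True
    then have "\<forall>x\<in>untouched. 0 < load F x"
      using load_nonneg[OF less.prems(1)] by (auto simp: idle_def less_le)
    then show ?thesis using less.prems by blast
  next
    case False
    then show ?thesis using touch_step[OF less.prems assms(3,4)] less.hyps by blast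
  qed
qed

section \<open>Joining all components\<close>

lemma exists_nonbridge:
  assumes F: "flow n c T F" and tot: "int (card (l ` V)) - 1 \<le> total n F" and disc: "linked F \<noteq> V \<times> V"
  shows "\<exists>a b. a < n \<and> b < n \<and> 0 < F a b \<and> (a, b) \<in> linked (\<lambda>u v. F u v - unit_arc a b u v)"
proof (rule ccontr)
  assume neg: "\<not> ?thesis"
  \<comment> \<open>An arc inside a component is no bridge, as the labels alone join its ends. If
    all arcs were bridges, each would thus cross and carry a single unit, and the size would be the
    number of arcs: at least \<open>p - 1\<close> bridges on \<open>p\<close> components leave only
    one class.\<close>
  have lab: "l a \<noteq> l b" if "(a, b) \<in> supp F" for a b
    using neg that by (auto simp: supp_def linked_def intro: merged_lab)
  have one: "F a b = 1" if "(a, b) \<in> supp F" for a b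
    using lab[OF that] that flowD(2)[OF F, of a b] c_cross[of a b] by (auto simp: supp_def)
  have fin: "finite (supp F)" by (rule finite_subset[of _ "V \<times> V"]) (auto simp: supp_def)
  have "total n F = (\<Sum>(u, v)\<in>V \<times> V. F u v)"
    by (simp add: total_def out_flow_def sum.cartesian_product)
  also have "\<dots> = (\<Sum>(u, v)\<in>supp F. F u v)"
  proof (rule sum.mono_neutral_right)
    show "\<forall>i\<in>V \<times> V - supp F. (case i of (u, v) \<Rightarrow> F u v) = 0"
      using flowD(1)[OF F] by (auto simp: supp_def not_less intro: order.antisym)
  qed (auto simp: supp_def)
  also have "\<dots> = (\<Sum>(u, v)\<in>supp F. 1)" by (rule sum.cong) (auto simp: one)
  also have "\<dots> = int (card (supp F))" by (simp add: case_prod_beta)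
  finally have tot': "total n F = int (card (supp F))" .
  have "card (V // merged n l (supp F)) + card (supp F) \<le> card (l ` V)"
  proof (rule forest_card[OF fin])
    fix a b assume ab: "(a, b) \<in> supp F"
    have "supp F - {(a, b)} = supp (\<lambda>u v. F u v - unit_arc a b u v)"
      using one[OF ab] by (auto simp: supp_def unit_arc_def)
    then show "(a, b) \<notin> merged n l (supp F - {(a, b)})"
      using neg ab by (auto simp: linked_def supp_def)
  qed (auto simp: supp_def)
  then have c1: "card (V // linked F) \<le> 1" using tot tot' by (simp add: linked_def)
  have eq: "equiv V (linked F)" by (simp add: linked_def equiv_merged)
  have "(u, v) \<in> linked F" if "u < n" "v < n" for u v
  proof -
    have "linked F `` {u} \<in> V // linked F" "linked F `` {v} \<in> V // linked F" using that by (auto intro: quotientI)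
    moreover have "finite (V // linked F)" using eq by (meson equiv_type finite_lessThan finite_quotient)
    ultimately have "linked F `` {u} = linked F `` {v}" using c1 card_le_Suc0_iff_eq[of "V // linked F"] by auto
    then show ?thesis using eq that by (simp add: eq_equiv_class_iff)
  qed
  moreover have "linked F \<subseteq> V \<times> V" by (simp add: linked_def merged_subset)
  ultimately show False using disc by auto
qed

text \<open>
  Replacing arcs \<open>(a, b)\<close> and \<open>(d, e)\<close> of different components by
  \<open>(a, e)\<close> and \<open>(d, b)\<close> merges the components if one of the two arcs is no
  bridge.
\<close>

lemma connect_step:
  assumes F: "flow n c T F" and M: "total n F \<le> M" "int (card (l ` V)) - 1 \<le> M"
    and p: "2 \<le> card (l ` V)" and loaded: "\<forall>x\<in>untouched. 0 < load F x" and disc: "linked F \<noteq> V \<times> V"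
  shows "\<exists>F'. flow n c T F' \<and> total n F' \<le> M \<and> (\<forall>x\<in>untouched. 0 < load F' x) \<and> linked F \<subset> linked F'"
proof -
  have eq: "equiv V (linked F)" by (simp add: linked_def equiv_merged)
  have sub: "linked F \<subseteq> V \<times> V" by (simp add: linked_def merged_subset)
  have sym: "(v, u) \<in> linked G" if "(u, v) \<in> linked G" for u v G using that by (simp add: linked_def merged_sym)
  have tr: "(u, w) \<in> linked G" if "(u, v) \<in> linked G" "(v, w) \<in> linked G" for u v w G
    using that unfolding linked_def by (rule merged_trans)
  have arc: "(u, v) \<in> linked G" if "(u, v) \<in> supp G" for u v G
    using that by (auto simp: linked_def supp_def intro: merged_arc)
  have lab: "(u, v) \<in> linked G" if "l u = l v" "u < n" "v < n" for u v G
    using that by (simp add: linked_def merged_lab)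
  have other: "\<exists>r<n. (a, r) \<notin> linked F" if a: "a < n" for a
  proof (rule ccontr)
    assume "\<not> ?thesis"
    then have "(u, v) \<in> linked F" if "u < n" "v < n" for u v using sym tr that by blast
    then show False using disc sub by auto
  qed
  \<comment> \<open>Each class contains an arc of the flow: an untouched component because it is
    loaded, any other because a vertex with nonzero supply must be an end of such an arc.\<close>
  have incident: "\<exists>d e. d < n \<and> e < n \<and> 0 < F d e \<and> (r, d) \<in> linked F \<and> (r, e) \<in> linked F" if r: "r < n" for r
  proof -
    have fin: ?thesis if "(d, e) \<in> supp F" "l r = l d \<or> l r = l e" for d e
    proof -
      have "d < n" "e < n" "0 < F d e" using that by (auto simp: supp_def)
      moreover have "(r, d) \<in> linked F \<and> (r, e) \<in> linked F"
        using that(2) lab[of r d F] lab[of r e F] arc[OF that(1)] r calculation tr sym by blast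
      ultimately show ?thesis by blast
    qed
    show ?thesis
    proof (cases "l r \<in> untouched")
      case True
      then obtain u v where "u < n" "v < n" "l u = l r" "0 < F u v" using loaded load_pos_iff[OF F] by blast
      then show ?thesis using fin[of u v] by (auto simp: supp_def)
    next
      case False
      then obtain u where u: "u < n" "l u = l r" "T u \<noteq> 0" using r by (auto simp: untouched_def)
      have "0 < out_flow n F u \<or> 0 < in_flow n F u"
        using flowD(3)[OF F, of u u] u out_flow_nonneg[OF F u(1)] in_flow_nonneg[OF F u(1)] by linarith
      then obtain v where v: "v < n" "0 < F u v \<or> 0 < F v u"
        using out_flow_pos_iff[OF F u(1)] in_flow_pos_iff[OF F u(1)] by blast
      then show ?thesis using fin[of u v] fin[of v u] u by (auto simp: supp_def)
    qed
  qed
  have sep: "l u \<noteq> l v \<and> F u v = 0 \<and> F v u = 0" if "(u, v) \<notin> linked F" "u < n" "v < n" for u v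
  proof -
    have "(v, u) \<notin> linked F" using that sym by blast
    then have "\<not> 0 < F u v" "\<not> 0 < F v u" using that arc[of u v F] arc[of v u F] by (auto simp: supp_def)
    then show ?thesis using that lab[of u v F] flowD(1)[OF F that(2,3)] flowD(1)[OF F that(3,2)] by auto
  qed
  show ?thesis
  proof (cases "total n F < M")
    \<comment> \<open>A spare unit pays for subdividing any arc at a vertex of another
      class.\<close>
    case True
    obtain v where "v < n" using exists_other_label[OF p] by blast
    then obtain a b where ab: "a < n" "b < n" "0 < F a b" using incident by blast
    then have abc: "(a, b) \<in> linked F" by (intro arc) (simp add: supp_def)
    obtain r where r: "r < n" "(a, r) \<notin> linked F" using other ab by blast
    have rb: "(b, r) \<notin> linked F" using r abc tr by blast
    note s1 = sep[OF r(2) ab(1) r(1)] and s2 = sep[OF rb ab(2) r(1)]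
    note sd = subdivide[OF F ab r(1) conjunct1[OF s1] conjunct1[OF s2] conjunct1[OF conjunct2[OF s1]]
        conjunct2[OF conjunct2[OF s2]]]
    define F' where "F' = (\<lambda>u v. F u v - unit_arc a b u v + unit_arc a r u v + unit_arc r b u v)"
    note sd = sd[folded F'_def]
    have "(u, v) \<in> linked F'" if "(u, v) \<in> supp F" for u v
      using that sd(4)[of u v] arc tr[OF arc[OF sd(5)] arc[OF sd(6)]] by blast
    then have "linked F \<subseteq> linked F'" unfolding linked_def by (intro merged_subsetI) (simp add: linked_def)
    then have "linked F \<subset> linked F'" using arc[OF sd(5)] r(2) by blast
    moreover have "\<forall>x\<in>untouched. 0 < load F' x" using loaded sd(3) by (simp add: add_pos_nonneg)
    ultimately show ?thesis using sd(1,2) True by (intro exI[of _ F']) auto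
  next
    case False
    then have eqM: "total n F = M" using M by simp
    obtain a b where ab: "a < n" "b < n" "0 < F a b" and nb: "(a, b) \<in> linked (\<lambda>u v. F u v - unit_arc a b u v)"
      using exists_nonbridge[OF F _ disc] M(2) eqM by blast
    have abc: "(a, b) \<in> linked F" using ab by (intro arc) (simp add: supp_def)
    obtain r where r: "r < n" "(a, r) \<notin> linked F" using other ab by blast
    obtain d e where de: "d < n" "e < n" "0 < F d e" "(r, d) \<in> linked F" "(r, e) \<in> linked F" using incident r by blast
    have n1: "(a, e) \<notin> linked F" and n2: "(d, b) \<notin> linked F" and n3: "(a, d) \<notin> linked F" using r de abc tr sym by blast+
    note s1 = sep[OF n1 ab(1) de(2)] and s2 = sep[OF n2 de(1) ab(2)]
    note ex = exchange[OF F ab de(1-3) conjunct1[OF s1] conjunct1[OF s2] conjunct1[OF conjunct2[OF s1]]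
        conjunct1[OF conjunct2[OF s2]]]
    define F' where "F' = (\<lambda>u v. F u v - unit_arc a b u v - unit_arc d e u v + unit_arc a e u v + unit_arc d b u v)"
    note ex = ex[folded F'_def]
    \<comment> \<open>Inside the old class of \<open>a\<close>, \<open>f\<close> is the new class,
      elsewhere it is constantly empty. Since \<open>(d, e)\<close> lies in another class, the
      connection of \<open>a\<close> and \<open>b\<close> that survives the loss of a unit on
      \<open>(a, b)\<close> does not use it, and \<open>f\<close> is invariant along that
      connection.\<close>
    define f where "f x = (if (a, x) \<in> linked F then linked F' `` {x} else {})" for x
    have eq': "equiv V (linked F')" by (simp add: linked_def equiv_merged)
    have fcong: "f u = f v" if "(u, v) \<in> linked F" "(a, u) \<in> linked F \<Longrightarrow> (u, v) \<in> linked F'" for u v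
    proof (cases "(a, u) \<in> linked F")
      case True
      then show ?thesis using that tr[OF True that(1)] equiv_class_eq[OF eq'] by (simp add: f_def)
    next
      case False
      then have "(a, v) \<notin> linked F" using that(1) tr sym by blast
      then show ?thesis using False by (simp add: f_def)
    qed
    have "f a = f b"
      using nb unfolding linked_def
    proof (rule merged_invariant[rotated 2])
      show "f u = f v" if "u < n" "v < n" "l u = l v" for u v using that lab by (intro fcong) auto
      show "f u = f v" if "(u, v) \<in> supp (\<lambda>u v. F u v - unit_arc a b u v)" for u v
      proof (rule fcong)
        show "(u, v) \<in> linked F" using that by (intro arc) (auto simp: supp_def unit_arc_def of_bool_def split: if_splits)
        assume "(a, u) \<in> linked F"
        then have "(u, v) \<noteq> (d, e)" using n3 by auto
        then show "(u, v) \<in> linked F'" using ex(4)[OF that] arc by blast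
      qed
    qed
    moreover have "(a, a) \<in> linked F" using ab by (intro lab) auto
    ultimately have "linked F' `` {a} = linked F' `` {b}" using abc by (simp add: f_def)
    then have ab': "(a, b) \<in> linked F'" using eq' ab by (simp add: eq_equiv_class_iff)
    \<comment> \<open>The path runs \<open>d\<close>, \<open>b\<close>, \<open>a\<close>,
      \<open>e\<close>: the two new arcs and the surviving connection of \<open>a\<close> and
      \<open>b\<close>.\<close>
    have "(d, e) \<in> linked F'" using tr[OF tr[OF arc[OF ex(6)] sym[OF ab']] arc[OF ex(5)]] .
    then have "(u, v) \<in> linked F'" if "(u, v) \<in> supp F" for u v
    proof (cases "(u, v) = (a, b)")
      case False
      then have "(u, v) \<in> supp (\<lambda>u v. F u v - unit_arc a b u v)" using that by (auto simp: supp_def unit_arc_def)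
      then show ?thesis using ex(4)[of u v] arc \<open>(d, e) \<in> linked F'\<close> by blast
    qed (simp add: ab')
    then have "linked F \<subseteq> linked F'" unfolding linked_def by (intro merged_subsetI) (simp add: linked_def)
    then have "linked F \<subset> linked F'" using arc[OF ex(5)] n1 by blast
    then show ?thesis using ex(1-3) eqM loaded by (intro exI[of _ F']) auto
  qed
qed

lemma connect_all:
  assumes "flow n c T F" "total n F \<le> M" "\<forall>x\<in>untouched. 0 < load F x"
    and "int (card (l ` V)) - 1 \<le> M" "2 \<le> card (l ` V)"
  shows "\<exists>F'. flow n c T F' \<and> total n F' \<le> M \<and> linked F' = V \<times> V"
  using assms(1-3)
proof (induction "n * n - card (linked F)" arbitrary: F rule: less_induct)
  case less
  show ?case
  proof (cases "linked F = V \<times> V")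
    case False
    obtain F' where F': "flow n c T F'" "total n F' \<le> M" "\<forall>x\<in>untouched. 0 < load F' x" "linked F \<subset> linked F'"
      using connect_step[OF less.prems(1,2) assms(4,5) less.prems(3) False] by blast
    have sub: "linked F' \<subseteq> V \<times> V" by (simp add: linked_def merged_subset)
    then have "card (linked F') \<le> card (V \<times> V)" by (intro card_mono) auto
    moreover have "card (linked F) < card (linked F')"
      using F'(4) sub by (meson finite_SigmaI finite_lessThan finite_subset psubset_card_mono)
    ultimately have "n * n - card (linked F') < n * n - card (linked F)" by (simp add: card_cartesian_product)
    then show ?thesis using less.hyps F'(1-3) by blast
  qed (use less.prems in blast)
qed

lemma card_supp_le:
  assumes F: "flow n c T F"
  shows "int (card (supp F)) \<le> total n F"
proof -
  have "int (card (supp F)) = (\<Sum>(u, v)\<in>supp F. 1)" by (simp add: case_prod_beta)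
  also have "\<dots> \<le> (\<Sum>(u, v)\<in>supp F. F u v)" by (rule sum_mono) (auto simp: supp_def)
  also have "\<dots> \<le> (\<Sum>(u, v)\<in>V \<times> V. F u v)"
    by (rule sum_mono2) (auto simp: supp_def flowD(1)[OF F])
  also have "\<dots> = total n F" by (simp add: total_def out_flow_def sum.cartesian_product)
  finally show ?thesis .
qed

text \<open>Sufficiency loads the components before joining them, because
  \<open>connect_step\<close> needs an arc in every class. Necessity counts twice: arcs by
  \<open>card_lab_le\<close>, passing units by \<open>demand_le_total\<close>.\<close>

theorem connected_flow_iff:
  assumes p: "2 \<le> card (l ` V)"
  shows "(\<exists>F. flow n c T F \<and> total n F \<le> k \<and> linked F = V \<times> V) \<longleftrightarrow>
    (\<exists>F. flow n c T F \<and> total n F \<le> k) \<and> demand + int (card untouched) \<le> k \<and> int (card (l ` V)) - 1 \<le> k"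
    (is "?L \<longleftrightarrow> ?R")
proof
  assume ?L
  then obtain F where F: "flow n c T F" "total n F \<le> k" "linked F = V \<times> V" by blast
  have "card (l ` V) \<le> card (supp F) + 1"
    using F(3) unfolding linked_def
    by (intro card_lab_le) (auto simp: supp_def intro: finite_subset[of _ "V \<times> V"])
  moreover have "demand + int (card untouched) \<le> total n F"
    by (rule demand_le_total[OF F(1) connected_imp_load[OF F(1,3) p]])
  ultimately show ?R using F card_supp_le[OF F(1)] by auto
next
  assume ?R
  then show ?L using touch_all connect_all p by meson
qed

end

section \<open>Editing as a flow problem\<close>

text \<open>
  The second term stands for the deletion of the opposite arc \<open>(v, u)\<close>.
\<close>

definition capacity :: "edit_op set \<Rightarrow> (nat \<times> nat) set \<Rightarrow> nat \<Rightarrow> nat \<Rightarrow> int" where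
  "capacity S A u v = (if u = v then 0
     else 1 - of_bool ((u, v) \<in> A) + of_bool (ED \<in> S) * of_bool ((v, u) \<in> A))"

definition incidence :: "(nat \<times> nat) set \<Rightarrow> nat \<Rightarrow> nat \<Rightarrow> int" where
  "incidence A u v = of_bool ((u, v) \<in> A)"

definition need :: "cdbe_input \<Rightarrow> nat \<Rightarrow> int" where
  "need I v = balance I v - (out_flow (order I) (incidence (parcs (graph I))) v
     - in_flow (order I) (incidence (parcs (graph I))) v)"

section \<open>Degrees, edit sequences and weak connectedness\<close>

lemma degrees_eq_flow:
  assumes "parcs H \<subseteq> {..<n} \<times> {..<n}"
  shows "int (out_degree (with_proj H) v) = out_flow n (incidence (parcs H)) v"
    and "int (in_degree (with_proj H) v) = in_flow n (incidence (parcs H)) v"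
proof -
  have "out_arcs (with_proj H) v = Pair v ` {w. w < n \<and> (v, w) \<in> parcs H}"
    using assms by (auto simp: out_arcs_def)
  then show "int (out_degree (with_proj H) v) = out_flow n (incidence (parcs H)) v"
    by (simp add: out_degree_def out_flow_def incidence_def card_image inj_on_def Int_def)
  have "in_arcs (with_proj H) v = (\<lambda>w. (w, v)) ` {w. w < n \<and> (w, v) \<in> parcs H}"
    using assms by (auto simp: in_arcs_def)
  then show "int (in_degree (with_proj H) v) = in_flow n (incidence (parcs H)) v"
    by (simp add: in_degree_def in_flow_def incidence_def card_image inj_on_def Int_def)
qed

text \<open>One step changes the symmetric difference with \<open>G\<close> by at most one arc. Only
  an inequality can hold, as steps may undo each other.\<close>

lemma edit_steps_bound:
  assumes "(edit_step S ^^ m) G H" "finite (pverts G)" "parcs G \<subseteq> pverts G \<times> pverts G - Id"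
  shows "pverts H = pverts G \<and> parcs H \<subseteq> pverts G \<times> pverts G - Id \<and>
    card (parcs H - parcs G) + card (parcs G - parcs H) \<le> m \<and> (ED \<notin> S \<longrightarrow> parcs G \<subseteq> parcs H)"
  using assms(1)
proof (induction m arbitrary: H)
  case 0
  then show ?case using assms by auto
next
  case (Suc m)
  then obtain G' where G': "(edit_step S ^^ m) G G'" "edit_step S G' H" by auto
  note IH = Suc.IH[OF G'(1)]
  have fin: "finite (parcs G)" "finite (parcs G')"
    using assms IH by (meson finite_Diff finite_SigmaI finite_subset)+
  from G'(2) show ?case
  proof cases
    case (add_arc u v)
    have "parcs H - parcs G \<subseteq> insert (u, v) (parcs G' - parcs G)" using add_arc by auto
    then have "card (parcs H - parcs G) \<le> card (insert (u, v) (parcs G' - parcs G))"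
      using fin by (intro card_mono) auto
    also have "\<dots> \<le> Suc (card (parcs G' - parcs G))" using fin by (simp add: card_insert_if)
    finally have "card (parcs H - parcs G) \<le> Suc (card (parcs G' - parcs G))" .
    moreover have "card (parcs G - parcs H) \<le> card (parcs G - parcs G')"
      using add_arc fin by (intro card_mono) auto
    ultimately show ?thesis using IH add_arc by auto
  next
    case (del_arc u v)
    have "parcs G - parcs H \<subseteq> insert (u, v) (parcs G - parcs G')" using del_arc by auto
    then have "card (parcs G - parcs H) \<le> card (insert (u, v) (parcs G - parcs G'))"
      using fin by (intro card_mono) auto
    also have "\<dots> \<le> Suc (card (parcs G - parcs G'))" using fin by (simp add: card_insert_if)
    finally have "card (parcs G - parcs H) \<le> Suc (card (parcs G - parcs G'))" .
    moreover have "card (parcs H - parcs G) \<le> card (parcs G' - parcs G)"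
      using del_arc fin by (intro card_mono) auto
    ultimately show ?thesis using IH del_arc by auto
  qed
qed

lemma add_arcs:
  assumes "finite D" "EA \<in> S" "D \<subseteq> pverts G \<times> pverts G - Id" "D \<inter> parcs G = {}"
  shows "(edit_step S ^^ card D) G (G\<lparr>parcs := parcs G \<union> D\<rparr>)"
  using assms
proof (induction D rule: finite_induct)
  case (insert e D)
  obtain u v where e: "e = (u, v)" by fastforce
  let ?G = "G\<lparr>parcs := parcs G \<union> D\<rparr>"
  have "edit_step S ?G (?G\<lparr>parcs := insert (u, v) (parcs ?G)\<rparr>)"
    using insert e by (intro edit_step.add_arc) auto
  then have "edit_step S ?G (G\<lparr>parcs := parcs G \<union> insert e D\<rparr>)" using e by simp
  moreover have "(edit_step S ^^ card D) G ?G" using insert by auto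
  ultimately show ?case using insert.hyps by (simp add: relpowp_Suc_I del: relpowp.simps)
qed simp

lemma delete_arcs:
  assumes "finite D" "ED \<in> S" "D \<subseteq> parcs G"
  shows "(edit_step S ^^ card D) G (G\<lparr>parcs := parcs G - D\<rparr>)"
  using assms
proof (induction D rule: finite_induct)
  case (insert e D)
  obtain u v where e: "e = (u, v)" by fastforce
  let ?G = "G\<lparr>parcs := parcs G - D\<rparr>"
  have "edit_step S ?G (?G\<lparr>parcs := parcs ?G - {(u, v)}\<rparr>)"
    using insert e by (intro edit_step.del_arc) auto
  moreover have "parcs G - D - {(u, v)} = parcs G - insert e D" using e by auto
  ultimately have "edit_step S ?G (G\<lparr>parcs := parcs G - insert e D\<rparr>)" by simp
  moreover have "(edit_step S ^^ card D) G ?G" using insert by auto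
  ultimately show ?case using insert.hyps by (simp add: relpowp_Suc_I del: relpowp.simps)
qed simp

text \<open>All deletions come before the additions, each arc of the symmetric difference being
  touched once; without \<open>ED\<close> the last hypothesis leaves nothing to delete.\<close>

lemma edit_steps_exist:
  assumes "EA \<in> S" "finite (pverts G)" "parcs G \<subseteq> pverts G \<times> pverts G"
    "A \<subseteq> pverts G \<times> pverts G - Id" "ED \<notin> S \<longrightarrow> parcs G \<subseteq> A"
  shows "(edit_step S ^^ (card (parcs G - A) + card (A - parcs G))) G (G\<lparr>parcs := A\<rparr>)"
proof -
  have fin: "finite (parcs G)" "finite A" using assms by (meson finite_Diff finite_SigmaI finite_subset)+
  let ?G = "G\<lparr>parcs := parcs G - (parcs G - A)\<rparr>"
  have 1: "(edit_step S ^^ card (parcs G - A)) G ?G"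
  proof (cases "ED \<in> S")
    case False
    then have "parcs G - A = {}" using assms(5) by blast
    then show ?thesis by (simp only: card.empty relpowp.simps) simp
  next
    case True
    then show ?thesis using fin by (intro delete_arcs) auto
  qed
  have "(edit_step S ^^ card (A - parcs G)) ?G (?G\<lparr>parcs := parcs ?G \<union> (A - parcs G)\<rparr>)"
    using fin assms by (intro add_arcs) auto
  moreover have "parcs ?G \<union> (A - parcs G) = A" by auto
  ultimately have "(edit_step S ^^ card (A - parcs G)) ?G (G\<lparr>parcs := A\<rparr>)" by simp
  with 1 show ?thesis by (rule relpowp_trans)
qed

lemma connected_iff_rtrancl:
  assumes "parcs H \<subseteq> pverts H \<times> pverts H"
  shows "Digraph_Component.connected (with_proj H) \<longleftrightarrow>
    pverts H \<noteq> {} \<and> (\<forall>u\<in>pverts H. \<forall>v\<in>pverts H. (u, v) \<in> (parcs H \<union> (parcs H)\<inverse>)\<^sup>*)"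
proof -
  have s: "(parcs H)\<^sup>s = parcs H \<union> (parcs H)\<inverse>" by (auto simp: symcl_def)
  have "(u, v) \<in> rtrancl_on (pverts H) (parcs H \<union> (parcs H)\<inverse>) \<longleftrightarrow> (u, v) \<in> (parcs H \<union> (parcs H)\<inverse>)\<^sup>*"
    if "u \<in> pverts H" "v \<in> pverts H" for u v
  proof
    assume "(u, v) \<in> (parcs H \<union> (parcs H)\<inverse>)\<^sup>*"
    then show "(u, v) \<in> rtrancl_on (pverts H) (parcs H \<union> (parcs H)\<inverse>)"
      by (rule rtrancl_consistent_rtrancl_on) (use assms that in auto)
  qed (rule rtrancl_on_rtranclI)
  then show ?thesis by (simp add: connected_conv s)
qed

lemma incidence_diff_sum:
  assumes "A \<subseteq> {..<n} \<times> {..<n}" "B \<subseteq> {..<n} \<times> {..<n}"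
  shows "(\<Sum>u<n. \<Sum>v<n. \<bar>incidence A u v - incidence B u v\<bar>) = int (card (A - B) + card (B - A))"
proof -
  have "(\<Sum>u<n. \<Sum>v<n. \<bar>incidence A u v - incidence B u v\<bar>)
      = (\<Sum>e\<in>{..<n} \<times> {..<n}. of_bool (e \<in> A - B) + of_bool (e \<in> B - A))"
    by (auto simp: sum.cartesian_product incidence_def intro!: sum.cong)
  also have "\<dots> = int (card (A - B) + card (B - A))"
  proof -
    have "{..<n} \<times> {..<n} \<inter> (A - B) = A - B" "{..<n} \<times> {..<n} \<inter> (B - A) = B - A" using assms by auto
    then show ?thesis by (simp add: sum.distrib Int_def)
  qed
  finally show ?thesis .
qed

text \<open>
  The Booleans \<open>a\<close>, \<open>b\<close> and \<open>p\<close>, \<open>q\<close> tell which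
  of the two arcs on a pair of vertices are present before and after the edit; \<open>x\<close>,
  \<open>y\<close> is the flow on them.
\<close>

lemma pair_update:
  fixes x y d :: int and a b e p q r :: bool
  assumes "0 \<le> x" "x \<le> 1 - of_bool a + of_bool e * of_bool b" "0 \<le> y" "y \<le> 1 - of_bool b + of_bool e * of_bool a"
    and "d = of_bool a - of_bool b + (x - y)" and "r \<longleftrightarrow> a \<or> b \<or> 0 < x \<or> 0 < y"
    and "p \<longleftrightarrow> d = 1 \<or> d = 0 \<and> r" "q \<longleftrightarrow> d = - 1 \<or> d = 0 \<and> r"
  shows "of_bool p - of_bool q = d" "\<bar>of_bool p - of_bool a\<bar> + \<bar>of_bool q - of_bool b\<bar> \<le> x + y"
    "r \<Longrightarrow> p \<or> q" "\<not> e \<Longrightarrow> a \<Longrightarrow> p"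
proof -
  have "of_bool e * of_bool b \<le> (1::int)" "of_bool e * of_bool a \<le> (1::int)" by (simp_all add: of_bool_def)
  moreover have "(0::int) \<le> of_bool a" "(0::int) \<le> of_bool b" by simp_all
  ultimately have "x \<le> 2" "y \<le> 2" using assms(2,4) by linarith+
  then have x: "x = 0 \<or> x = 1 \<or> x = 2" and y: "y = 0 \<or> y = 1 \<or> y = 2" using assms(1,3) by arith+
  have "(of_bool p - of_bool q = d \<and> \<bar>of_bool p - of_bool a\<bar> + \<bar>of_bool q - of_bool b\<bar> \<le> x + y) \<and>
     (r \<longrightarrow> p \<or> q) \<and> (\<not> e \<longrightarrow> a \<longrightarrow> p)"
    using x y
    by (elim disjE) (use assms in \<open>cases a; cases b; cases e; simp\<close>)+
  then show "of_bool p - of_bool q = d" "\<bar>of_bool p - of_bool a\<bar> + \<bar>of_bool q - of_bool b\<bar> \<le> x + y"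
    "r \<Longrightarrow> p \<or> q" "\<not> e \<Longrightarrow> a \<Longrightarrow> p" by simp_all
qed

section \<open>Edit sequences as connecting flows and back\<close>

locale cdbe =
  fixes S :: "edit_op set" and I :: cdbe_input and l :: "nat \<Rightarrow> nat" and n :: nat
  assumes EA: "EA \<in> S" and valid: "valid_input I" and order: "order I = n"
    and l: "\<And>u v. u < n \<Longrightarrow> v < n \<Longrightarrow>
      l u = l v \<longleftrightarrow> (u, v) \<in> (parcs (graph I) \<union> (parcs (graph I))\<inverse>)\<^sup>*"
begin

abbreviation "A \<equiv> parcs (graph I)"

lemma vertices: "pverts (graph I) = {..<n}"
  using valid order by (simp add: valid_input_def)

lemma arcs: "A \<subseteq> {..<n} \<times> {..<n} - Id"
proof -
  interpret pair_digraph "graph I" using valid by (simp add: valid_input_def)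
  have "u \<noteq> v" if "(u, v) \<in> A" for u v using no_loops'[of u v] that by auto
  moreover have "u < n \<and> v < n" if "(u, v) \<in> A" for u v
    using in_arcsD1[OF that] in_arcsD2[OF that] vertices by blast
  ultimately show ?thesis by auto
qed

sublocale conn_network "n" "capacity S A" "need I" l
proof
  show "capacity S A u u = 0" for u by (simp add: capacity_def)
  fix u v assume "u < n" "v < n" "l u \<noteq> l v"
  then have "(u, v) \<notin> A" "(v, u) \<notin> A" "u \<noteq> v" using l[of u v] by auto
  then show "capacity S A u v = 1" by (simp add: capacity_def)
qed

text \<open>An added arc is a unit along it, a deleted one a unit against it. For the connection,
  arcs of \<open>H\<close> that were in \<open>A\<close> lie inside components, and all others were
  added and so belong to the support.\<close>

lemma CDBE_imp_flow:
  assumes "CDBE S I"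
  shows "0 < n \<and> (\<exists>F. flow (n) (capacity S A) (need I) F \<and> total (n) F \<le> budget I \<and> linked F = V \<times> V)"
proof -
  obtain H m where m: "int m \<le> budget I" "(edit_step S ^^ m) (graph I) H"
    and conn: "Digraph_Component.connected (with_proj H)"
    and bal: "\<forall>v\<in>pverts H. int (out_degree (with_proj H) v) - int (in_degree (with_proj H) v) = balance I v"
    using assms by (auto simp: CDBE_def modifiable_into_def)
  have H: "pverts H = V" "parcs H \<subseteq> V \<times> V - Id" "card (parcs H - A) + card (A - parcs H) \<le> m"
    "ED \<notin> S \<longrightarrow> A \<subseteq> parcs H"
    using edit_steps_bound[OF m(2)] arcs unfolding vertices by auto
  have HV: "parcs H \<subseteq> V \<times> V" and AV: "A \<subseteq> V \<times> V" using H(2) arcs by auto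
  define F where "F u v = (of_bool ((u, v) \<in> parcs H - A) + of_bool ((v, u) \<in> A - parcs H) :: int)" for u v
  have net: "F u v - F v u = (incidence (parcs H) u v - incidence (parcs H) v u) - (incidence A u v - incidence A v u)" for u v
    by (auto simp: F_def incidence_def)
  have "flow n (capacity S A) (need I) F"
    unfolding flow_def
  proof (intro conjI allI impI)
    fix u v assume "u < n" "v < n"
    show "0 \<le> F u v" by (simp add: F_def)
    show "F u v \<le> capacity S A u v" using H(2,4) arcs by (auto simp: F_def capacity_def)
  next
    fix u assume u: "u < n"
    have "out_flow n F u - in_flow n F u = (\<Sum>v<n. F u v - F v u)"
      by (simp add: out_flow_def in_flow_def sum_subtractf)
    also have "\<dots> = (out_flow n (incidence (parcs H)) u - in_flow n (incidence (parcs H)) u)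
        - (out_flow n (incidence A) u - in_flow n (incidence A) u)"
      unfolding net by (simp add: out_flow_def in_flow_def sum_subtractf)
    also have "\<dots> = need I u"
      using bal u degrees_eq_flow[OF HV] by (simp add: H(1) need_def order)
    finally show "out_flow n F u - in_flow n F u = need I u" .
  qed
  moreover have "total n F \<le> budget I"
  proof -
    have "total n F = (\<Sum>u<n. \<Sum>v<n. of_bool ((u, v) \<in> parcs H - A)) + (\<Sum>u<n. \<Sum>v<n. of_bool ((v, u) \<in> A - parcs H))"
      by (simp add: total_def out_flow_def F_def sum.distrib)
    also have "(\<Sum>u<n. \<Sum>v<n. of_bool ((v, u) \<in> A - parcs H)) = (\<Sum>u<n. \<Sum>v<n. (of_bool ((u, v) \<in> A - parcs H)::int))"
      by (rule sum.swap)
    also have "(\<Sum>u<n. \<Sum>v<n. of_bool ((u, v) \<in> parcs H - A)) + (\<Sum>u<n. \<Sum>v<n. (of_bool ((u, v) \<in> A - parcs H)::int))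
       = (\<Sum>u<n. \<Sum>v<n. \<bar>incidence (parcs H) u v - incidence A u v\<bar>)"
      unfolding sum.distrib[symmetric] by (intro sum.cong) (auto simp: incidence_def)
    also have "\<dots> = int (card (parcs H - A) + card (A - parcs H))" by (rule incidence_diff_sum[OF HV AV])
    finally show ?thesis using H(3) m(1) by linarith
  qed
  moreover have "linked F = V \<times> V"
  proof
    have step: "(u, v) \<in> linked F" if "(u, v) \<in> parcs H" for u v
    proof -
      have uv: "u < n" "v < n" using that H(2) by auto
      show ?thesis
      proof (cases "(u, v) \<in> A")
        case True
        then have "l u = l v" using l[OF uv] by blast
        then show ?thesis using uv by (simp add: linked_def merged_lab)
      next
        case False
        then have "(u, v) \<in> supp F" using that uv by (simp add: supp_def F_def)
        then show ?thesis using uv by (simp add: linked_def merged_arc)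
      qed
    qed
    have "(u, v) \<in> linked F" if "(u, v) \<in> (parcs H \<union> (parcs H)\<inverse>)\<^sup>*" "u < n" for u v
      using that(1)
    proof induction
      case base
      then show ?case using that(2) by (simp add: linked_def merged_lab)
    next
      case (step v w)
      have "(v, w) \<in> linked F" using step.hyps(2) \<open>\<And>u v. (u, v) \<in> parcs H \<Longrightarrow> (u, v) \<in> linked F\<close>
        by (auto simp: linked_def intro: merged_sym)
      then show ?case using step.IH unfolding linked_def by (rule merged_trans[rotated])
    qed
    then show "V \<times> V \<subseteq> linked F" using conn HV by (auto simp: connected_iff_rtrancl H(1))
  qed (simp add: linked_def merged_subset)
  moreover have "0 < n" using conn by (auto simp: connected_conv H(1))
  ultimately show ?thesis by blast
qed

text \<open>Each unordered pair is settled independently by \<open>pair_update\<close>: it gets the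
  balance prescribed by the flow at a cost of at most the units on the pair, and it is adjacent
  afterwards if it was before or carries flow.\<close>

lemma flow_imp_CDBE:
  assumes n: "0 < n" and F: "flow (n) (capacity S A) (need I) F"
    and k: "total (n) F \<le> budget I" and cnF: "linked F = V \<times> V"
  shows "CDBE S I"
proof -
  let ?i = "incidence A"
  define net where "net u v = ?i u v - ?i v u + (F u v - F v u)" for u v
  \<comment> \<open>On a pair with net balance 0 both arcs are chosen as soon as it was adjacent or
    carries flow. Instead of deleting the only arc, its opposite is added, with the same effect on
    the balance and the same cost.\<close>
  define B where "B = {(u, v). u < n \<and> v < n \<and> u \<noteq> v \<and>
    (net u v = 1 \<or> net u v = 0 \<and> ((u, v) \<in> A \<or> (v, u) \<in> A \<or> 0 < F u v \<or> 0 < F v u))}"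
  have AV: "A \<subseteq> V \<times> V" using arcs by auto
  have BV: "B \<subseteq> V \<times> V" and BI: "B \<subseteq> V \<times> V - Id" by (auto simp: B_def)
  have pair: "incidence B u v - incidence B v u = net u v"
    "\<bar>incidence B u v - ?i u v\<bar> + \<bar>incidence B v u - ?i v u\<bar> \<le> F u v + F v u"
    "(u, v) \<in> A \<or> 0 < F u v \<Longrightarrow> (u, v) \<in> B \<or> (v, u) \<in> B"
    "ED \<notin> S \<Longrightarrow> (u, v) \<in> A \<Longrightarrow> (u, v) \<in> B"
    if uv: "u < n" "v < n" for u v
  proof -
    note fl = flowD(1,2)[OF F uv(1) uv(2)] flowD(1,2)[OF F uv(2) uv(1)]
    have neg: "net v u = - net u v" by (simp add: net_def)
    have "(incidence B u v - incidence B v u = net u v \<and>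
      \<bar>incidence B u v - ?i u v\<bar> + \<bar>incidence B v u - ?i v u\<bar> \<le> F u v + F v u) \<and>
      ((u, v) \<in> A \<or> 0 < F u v \<longrightarrow> (u, v) \<in> B \<or> (v, u) \<in> B) \<and> (ED \<notin> S \<longrightarrow> (u, v) \<in> A \<longrightarrow> (u, v) \<in> B)"
    proof (cases "u = v")
      case True
      have "(v, v) \<notin> A" using arcs by auto
      then show ?thesis using fl True by (simp add: capacity_def incidence_def net_def B_def)
    next
      case False
      have p: "(u, v) \<in> B \<longleftrightarrow> net u v = 1 \<or> net u v = 0 \<and> ((u, v) \<in> A \<or> (v, u) \<in> A \<or> 0 < F u v \<or> 0 < F v u)"
        and q: "(v, u) \<in> B \<longleftrightarrow> net u v = - 1 \<or> net u v = 0 \<and> ((u, v) \<in> A \<or> (v, u) \<in> A \<or> 0 < F u v \<or> 0 < F v u)"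
        using uv False unfolding B_def by (auto simp: neg)
      have c: "F u v \<le> 1 - of_bool ((u, v) \<in> A) + of_bool (ED \<in> S) * of_bool ((v, u) \<in> A)"
        "F v u \<le> 1 - of_bool ((v, u) \<in> A) + of_bool (ED \<in> S) * of_bool ((u, v) \<in> A)"
        using fl(2,4) False by (simp_all add: capacity_def)
      have net: "net u v = of_bool ((u, v) \<in> A) - of_bool ((v, u) \<in> A) + (F u v - F v u)"
        by (simp add: net_def incidence_def)
      note pu = pair_update[OF fl(1) c(1) fl(3) c(2) net refl p q]
      show ?thesis using pu by (simp add: incidence_def)
    qed
    then show "incidence B u v - incidence B v u = net u v"
      "\<bar>incidence B u v - ?i u v\<bar> + \<bar>incidence B v u - ?i v u\<bar> \<le> F u v + F v u"
      "(u, v) \<in> A \<or> 0 < F u v \<Longrightarrow> (u, v) \<in> B \<or> (v, u) \<in> B"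
      "ED \<notin> S \<Longrightarrow> (u, v) \<in> A \<Longrightarrow> (u, v) \<in> B" by simp_all
  qed
  let ?H = "(graph I)\<lparr>parcs := B\<rparr>"
  have "(edit_step S ^^ (card (A - B) + card (B - A))) (graph I) ?H"
    using AV BI pair(4) by (intro edit_steps_exist[OF EA]) (auto simp: vertices)
  moreover have "int (card (A - B) + card (B - A)) \<le> budget I"
  proof -
    \<comment> \<open>The cost estimate is known only per unordered pair, hence the doubling:
      summing over ordered pairs counts each of them twice.\<close>
    have "2 * int (card (A - B) + card (B - A)) = 2 * (\<Sum>u<n. \<Sum>v<n. \<bar>incidence B u v - ?i u v\<bar>)"
      using incidence_diff_sum[OF BV AV] by simp
    also have "\<dots> = (\<Sum>u<n. \<Sum>v<n. \<bar>incidence B u v - ?i u v\<bar> + \<bar>incidence B v u - ?i v u\<bar>)"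
      using sum.swap[of "\<lambda>u v. \<bar>incidence B v u - ?i v u\<bar>" "{..<n}" "{..<n}"] by (simp add: sum.distrib)
    also have "\<dots> \<le> (\<Sum>u<n. \<Sum>v<n. F u v + F v u)"
      by (intro sum_mono) (simp add: pair(2))
    also have "\<dots> = 2 * total n F"
      using sum_in_flow[of n F] by (simp add: total_def out_flow_def in_flow_def sum.distrib)
    finally show ?thesis using k by simp
  qed
  ultimately have "modifiable_into S (budget I) (graph I) ?H"
    unfolding modifiable_into_def by blast
  moreover have "int (out_degree (with_proj ?H) u) - int (in_degree (with_proj ?H) u) = balance I u"
    if u: "u < n" for u
  proof -
    have "int (out_degree (with_proj ?H) u) - int (in_degree (with_proj ?H) u) =
        (\<Sum>v<n. incidence B u v - incidence B v u)"
      using degrees_eq_flow[of ?H n u] BV by (simp add: out_flow_def in_flow_def sum_subtractf)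
    also have "\<dots> = (\<Sum>v<n. net u v)" using pair(1) u by simp
    also have "\<dots> = out_flow n ?i u - in_flow n ?i u + (out_flow n F u - in_flow n F u)"
      by (simp add: net_def out_flow_def in_flow_def sum_subtractf sum.distrib)
    also have "\<dots> = balance I u" using flowD(3)[OF F u u] by (simp add: need_def order)
    finally show ?thesis .
  qed
  moreover have "Digraph_Component.connected (with_proj ?H)"
  proof -
    let ?R = "(B \<union> B\<inverse>)\<^sup>*"
    have B: "(u, v) \<in> ?R" if "u < n" "v < n" "(u, v) \<in> A \<or> (v, u) \<in> A \<or> 0 < F u v \<or> 0 < F v u" for u v
      using pair(3)[OF that(1,2)] pair(3)[OF that(2,1)] that(3) by (auto intro: r_into_rtrancl)
    have A: "(u, v) \<in> ?R" if "(u, v) \<in> (A \<union> A\<inverse>)\<^sup>*" for u v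
      using that
    proof induction
      case (step v w)
      then have "(v, w) \<in> ?R" using AV by (intro B) auto
      then show ?case using step.IH by (rule rtrancl_trans[rotated])
    qed simp
    have "(u, v) \<in> ?R" if "(u, v) \<in> linked F" for u v
      using that unfolding linked_def merged_def
    proof (induction rule: trancl_induct)
      case (base v)
      then show ?case using A B l by (auto simp: supp_def)
    next
      case (step v w)
      then have "(v, w) \<in> ?R" using A B l by (auto simp: supp_def)
      then show ?case using step.IH by (rule rtrancl_trans[rotated])
    qed
    then show ?thesis using cnF n BV by (subst connected_iff_rtrancl) (auto simp: vertices)
  qed
  ultimately show ?thesis unfolding CDBE_def by (intro exI[of _ ?H]) (simp add: vertices)
qed

text \<open>A single component is connected without any edit, so there only the flow remains; the
  bound with \<open>untouched\<close> would be wrong, as one component without supplies needs no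
  passing unit. \<open>0 < n\<close> reflects that the null graph is not connected.\<close>

theorem CDBE_iff:
  "CDBE S I \<longleftrightarrow> 0 < n \<and>
    (\<exists>F. flow (n) (capacity S A) (need I) F \<and> total (n) F \<le> budget I) \<and>
    (card (l ` V) = 1 \<or> demand + int (card untouched) \<le> budget I \<and> int (card (l ` V)) - 1 \<le> budget I)"
proof (cases "2 \<le> card (l ` V)")
  case True
  then show ?thesis using connected_flow_iff[OF True, of "budget I"] CDBE_imp_flow flow_imp_CDBE by auto
next
  case False
  show ?thesis
  proof (cases "n = 0")
    case True
    then show ?thesis using CDBE_imp_flow by auto
  next
    case n: False
    then have "card (l ` V) \<noteq> 0" by auto
    then have c1: "card (l ` V) = 1" using False by linarith
    then obtain x where "l ` V = {x}" by (auto simp: card_1_singleton_iff)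
    then have "l u = l v" if "u < n" "v < n" for u v using that by (metis image_eqI lessThan_iff singletonD)
    then have "V \<times> V \<subseteq> linked F" for F by (auto simp: linked_def intro: merged_lab)
    moreover have "linked F \<subseteq> V \<times> V" for F by (simp add: linked_def merged_subset)
    ultimately have "linked F = V \<times> V" for F by blast
    then show ?thesis using c1 n CDBE_imp_flow flow_imp_CDBE by auto
  qed
qed

end

section \<open>Cost scaling with unit pushes\<close>

text \<open>
  Flow, labels (negated prices), number of relabellings in the current scale, current arcs and
  excesses; the vertices below \<open>src\<close> have been emptied, and \<open>pos\<close> holds
  the unit that is being moved.
\<close>

record push_state =
  fl :: "nat \<Rightarrow> nat \<Rightarrow> int"
  lb :: "nat \<Rightarrow> int"
  rl :: "nat \<Rightarrow> nat"
  cu :: "nat \<Rightarrow> nat"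
  ex :: "nat \<Rightarrow> int"
  src :: nat
  pos :: nat
  failed :: bool

locale push_relabel =
  fixes n :: nat and c :: "nat \<Rightarrow> nat \<Rightarrow> int" and T :: "nat \<Rightarrow> int"
  assumes c_bound: "0 \<le> c u v" "c u v \<le> 2" and c_diag: "c u u = 0"
begin

definition limit :: nat where "limit = 3 * n + 3"

text \<open>
  Approximate complementary slackness when every arc costs \<open>K\<close>.
\<close>

definition optimal :: "int \<Rightarrow> int \<Rightarrow> (nat \<Rightarrow> int) \<Rightarrow> (nat \<Rightarrow> nat \<Rightarrow> int) \<Rightarrow> bool" where
  "optimal e K d F \<longleftrightarrow> (\<forall>u<n. \<forall>v<n. (F u v < c u v \<longrightarrow> d u \<le> d v + K + e) \<and> (0 < F v u \<longrightarrow> d u \<le> d v - K + e))"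

text \<open>The pseudoflow that saturates the arcs along which the label drops by more than the cost
  and empties all others. It satisfies \<open>optimal 0 K d\<close>, at the price of arbitrary
  excesses, which the scale then has to move. \<open>f\<close> hands over the failure flag of
  earlier scales.\<close>

definition initial :: "int \<Rightarrow> (nat \<Rightarrow> int) \<Rightarrow> bool \<Rightarrow> push_state" where
  "initial K d f = (let F = \<lambda>u v. if d u > d v + K then c u v else 0 in
     \<lparr>fl = F, lb = d, rl = (\<lambda>_. 0), cu = (\<lambda>_. 0), ex = (\<lambda>u. T u - out_flow n F u + in_flow n F u),
      src = 0, pos = 0, failed = f\<rparr>)"

definition move :: "nat \<Rightarrow> nat \<Rightarrow> (nat \<Rightarrow> int) \<Rightarrow> nat \<Rightarrow> int" where
  "move v w e x = e x - of_bool (x = v) + of_bool (x = w)"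

text \<open>Admissible residual arcs, with labels as negated prices: returning a unit from
  \<open>(w, v)\<close> costs \<open>- K\<close>, sending one along \<open>(v, w)\<close> costs
  \<open>K\<close>, and the drop of the label from \<open>v\<close> to \<open>w\<close> must exceed
  that.\<close>

definition bwd :: "int \<Rightarrow> push_state \<Rightarrow> nat \<Rightarrow> nat \<Rightarrow> bool" where
  "bwd K a v w \<longleftrightarrow> 0 < fl a w v \<and> lb a w - K < lb a v"

definition fwd :: "int \<Rightarrow> push_state \<Rightarrow> nat \<Rightarrow> nat \<Rightarrow> bool" where
  "fwd K a v w \<longleftrightarrow> fl a v w < c v w \<and> lb a w + K < lb a v"

text \<open>Each call is one action of constant cost. After a push, \<open>pos\<close> follows the
  unit, so that no list of active vertices is needed; a vertex that would have to be relabelled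
  beyond \<open>limit\<close> is the evidence that no flow exists.\<close>

definition step :: "int \<Rightarrow> push_state \<Rightarrow> push_state" where
  "step K a = (let v = pos a; w = cu a v in
     if ex a v \<le> 0 then
       (if ex a (src a) \<le> 0 then a\<lparr>src := src a + 1, pos := src a + 1\<rparr> else a\<lparr>pos := src a\<rparr>)
     else if w = n then
       (if limit \<le> rl a v then a\<lparr>failed := True, src := n\<rparr>
        else a\<lparr>lb := (lb a)(v := lb a v + 1), rl := (rl a)(v := rl a v + 1), cu := (cu a)(v := 0)\<rparr>)
     else if bwd K a v w then
       a\<lparr>fl := (\<lambda>x y. fl a x y - unit_arc w v x y), ex := move v w (ex a), pos := w\<rparr>
     else if fwd K a v w then
       a\<lparr>fl := (\<lambda>x y. fl a x y + unit_arc v w x y), ex := move v w (ex a), pos := w\<rparr>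
     else a\<lparr>cu := (cu a)(v := w + 1)\<rparr>)"

definition stuck :: "push_state \<Rightarrow> bool" where
  "stuck a \<longleftrightarrow> (\<exists>v<n. 0 < ex a v \<and> limit \<le> rl a v)"

text \<open>Below \<open>src\<close> only the travelling unit can be in excess. At the end
  \<open>pos = n\<close> names no vertex, so then no excess is positive anywhere.\<close>

definition search :: "bool \<Rightarrow> push_state \<Rightarrow> bool" where
  "search f a \<longleftrightarrow> failed a = f \<and> src a \<le> n \<and> (src a < n \<longrightarrow> pos a < n) \<and> (src a = n \<longrightarrow> pos a = n) \<and>
     (\<forall>x<src a. ex a x \<le> of_bool (x = pos a))"

text \<open>The clause on \<open>cu\<close> is the current-arc invariant. The last clause includes
  that a vertex in deficit has never been relabelled: pushes leave only vertices with positive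
  excess and so create no deficit.\<close>

definition core :: "int \<Rightarrow> (nat \<Rightarrow> int) \<Rightarrow> push_state \<Rightarrow> bool" where
  "core K d a \<longleftrightarrow>
     (\<forall>u<n. \<forall>v<n. 0 \<le> fl a u v \<and> fl a u v \<le> c u v) \<and>
     (\<forall>u<n. ex a u = T u - out_flow n (fl a) u + in_flow n (fl a) u) \<and>
     optimal 1 K (lb a) (fl a) \<and>
     (\<forall>u<n. cu a u \<le> n \<and> (\<forall>w<cu a u. \<not> bwd K a u w \<and> \<not> fwd K a u w)) \<and>
     (\<forall>u<n. rl a u \<le> limit \<and> lb a u = d u + int (rl a u) \<and> (ex a u < 0 \<longrightarrow> rl a u = 0))"

definition push_inv :: "int \<Rightarrow> (nat \<Rightarrow> int) \<Rightarrow> bool \<Rightarrow> push_state \<Rightarrow> bool" where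
  "push_inv K d f a \<longleftrightarrow> core K d a \<and> (search f a \<or> failed a \<and> stuck a \<and> src a = n)"

lemma coreD:
  assumes "core K d a"
  shows "\<And>u v. u < n \<Longrightarrow> v < n \<Longrightarrow> 0 \<le> fl a u v" "\<And>u v. u < n \<Longrightarrow> v < n \<Longrightarrow> fl a u v \<le> c u v"
    "\<And>u. u < n \<Longrightarrow> ex a u = T u - out_flow n (fl a) u + in_flow n (fl a) u"
    "\<And>u v. u < n \<Longrightarrow> v < n \<Longrightarrow> fl a u v < c u v \<Longrightarrow> lb a u \<le> lb a v + K + 1"
    "\<And>u v. u < n \<Longrightarrow> v < n \<Longrightarrow> 0 < fl a v u \<Longrightarrow> lb a u \<le> lb a v - K + 1"
    "\<And>u. u < n \<Longrightarrow> cu a u \<le> n"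
    "\<And>u w. u < n \<Longrightarrow> w < cu a u \<Longrightarrow> 0 < fl a w u \<Longrightarrow> lb a u \<le> lb a w - K"
    "\<And>u w. u < n \<Longrightarrow> w < cu a u \<Longrightarrow> fl a u w < c u w \<Longrightarrow> lb a u \<le> lb a w + K"
    "\<And>u. u < n \<Longrightarrow> rl a u \<le> limit" "\<And>u. u < n \<Longrightarrow> lb a u = d u + int (rl a u)"
    "\<And>u. u < n \<Longrightarrow> ex a u < 0 \<Longrightarrow> rl a u = 0"
proof -
  note c = assms[unfolded core_def optimal_def bwd_def fwd_def]
  note c1 = c[THEN conjunct1] and c2 = c[THEN conjunct2, THEN conjunct1]
    and c3 = c[THEN conjunct2, THEN conjunct2, THEN conjunct1]
    and c4 = c[THEN conjunct2, THEN conjunct2, THEN conjunct2, THEN conjunct1]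
    and c5 = c[THEN conjunct2, THEN conjunct2, THEN conjunct2, THEN conjunct2]
  fix u assume u: "u < n"
  show "ex a u = T u - out_flow n (fl a) u + in_flow n (fl a) u" using c2 u by simp
  show "cu a u \<le> n" using c4 u by simp
  show "rl a u \<le> limit" "lb a u = d u + int (rl a u)" "ex a u < 0 \<Longrightarrow> rl a u = 0" using c5 u by simp_all
  fix v
  show "lb a u \<le> lb a v - K" if "v < cu a u" "0 < fl a v u"
    using c4[rule_format, OF u] that by fastforce
  show "lb a u \<le> lb a v + K" if "v < cu a u" "fl a u v < c u v"
    using c4[rule_format, OF u] that by fastforce
  assume v: "v < n"
  show "0 \<le> fl a u v" "fl a u v \<le> c u v" using c1 u v by simp_all
  show "lb a u \<le> lb a v + K + 1" if "fl a u v < c u v" using c3 u v that by simp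
  show "lb a u \<le> lb a v - K + 1" if "0 < fl a v u" using c3 u v that by simp
qed

lemma core_cong:
  assumes "fl a' = fl a" "lb a' = lb a" "rl a' = rl a" "cu a' = cu a" "ex a' = ex a"
  shows "core K d a' = core K d a"
  unfolding core_def bwd_def fwd_def assms ..

lemma core_initial: "core K d (initial K d f)"
  using c_bound by (auto simp: core_def initial_def Let_def optimal_def)

lemma push_inv_initial: "push_inv K d f (initial K d f)"
  using core_initial by (auto simp: push_inv_def search_def initial_def Let_def)

text \<open>\<open>cu a v = n\<close> means that no residual arc out of \<open>v\<close> is
  admissible, so each of them still has the whole slack 1 to spare for the raised label. Current
  arcs elsewhere survive, because raising \<open>v\<close> only makes arcs into \<open>v\<close>
  less admissible.\<close>

lemma core_relabel:
  assumes a: "core K d a" and v: "v < n" "0 < ex a v" "cu a v = n" "rl a v < limit"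
  shows "core K d (a\<lparr>lb := (lb a)(v := lb a v + 1), rl := (rl a)(v := rl a v + 1), cu := (cu a)(v := 0)\<rparr>)"
proof -
  note D = coreD[OF a]
  have "optimal 1 K ((lb a)(v := lb a v + 1)) (fl a)"
    unfolding optimal_def
  proof (intro allI impI conjI)
    fix u w assume uw: "u < n" "w < n"
    show "((lb a)(v := lb a v + 1)) u \<le> ((lb a)(v := lb a v + 1)) w + K + 1" if "fl a u w < c u w"
      using D(4)[OF uw that] D(8)[of v w] that uw v by (cases "u = v"; cases "w = v") auto
    show "((lb a)(v := lb a v + 1)) u \<le> ((lb a)(v := lb a v + 1)) w - K + 1" if "0 < fl a w u"
      using D(5)[OF uw that] D(7)[of v w] that uw v D(2)[of v v] c_diag[of v] by (cases "u = v"; cases "w = v") auto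
  qed
  moreover have "\<not> bwd K (a\<lparr>lb := (lb a)(v := lb a v + 1), rl := (rl a)(v := rl a v + 1), cu := (cu a)(v := 0)\<rparr>) u w"
    "\<not> fwd K (a\<lparr>lb := (lb a)(v := lb a v + 1), rl := (rl a)(v := rl a v + 1), cu := (cu a)(v := 0)\<rparr>) u w"
    if "u < n" "w < ((cu a)(v := 0)) u" for u w
    using that D(7)[of u w] D(8)[of u w] by (auto simp: bwd_def fwd_def split: if_splits)
  ultimately show ?thesis using a v unfolding core_def by auto
qed

text \<open>The only residual capacity gained is opposite to an admissible arc. It is not admissible
  itself, so neither the optimality condition nor the part of the arc lists already passed over is
  affected.\<close>

lemma core_push:
  assumes a: "core K d a" and v: "v < n" "0 < ex a v" "w < n"
    and F: "F = (\<lambda>x y. fl a x y - unit_arc w v x y) \<and> bwd K a v w \<or>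
      F = (\<lambda>x y. fl a x y + unit_arc v w x y) \<and> fwd K a v w"
  shows "core K d (a\<lparr>fl := F, ex := move v w (ex a), pos := x\<rparr>)"
proof -
  note D = coreD[OF a]
  have "v \<noteq> w" using F D(1)[of v v] D(2)[of v v] c_diag[of v] v by (auto simp: bwd_def fwd_def)
  have range: "0 \<le> F u y \<and> F u y \<le> c u y" if "u < n" "y < n" for u y
    using F D(1,2)[OF that] by (auto simp: unit_arc_def of_bool_def bwd_def fwd_def)
  have exq: "move v w (ex a) u = T u - out_flow n F u + in_flow n F u" if "u < n" for u
    using F D(3)[OF that] v that by (auto simp: move_def flow_simps)
  have new: "(F u y < c u y \<longrightarrow> fl a u y < c u y \<or> u = w \<and> y = v \<and> lb a w < lb a v + K) \<and>
     (0 < F u y \<longrightarrow> 0 < fl a u y \<or> u = v \<and> y = w \<and> lb a w < lb a v - K)" for u y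
    using F by (auto simp: unit_arc_def of_bool_def bwd_def fwd_def split: if_splits)
  have opt: "optimal 1 K (lb a) F"
    unfolding optimal_def
  proof (intro allI impI conjI)
    fix u y assume uy: "u < n" "y < n"
    show "lb a u \<le> lb a y + K + 1" if "F u y < c u y" using new[of u y] that D(4)[OF uy] by auto
    show "lb a u \<le> lb a y - K + 1" if "0 < F y u" using new[of y u] that D(5)[OF uy] by auto
  qed
  have cur: "\<not> (0 < F y u \<and> lb a y - K < lb a u) \<and> \<not> (F u y < c u y \<and> lb a y + K < lb a u)"
    if "u < n" "y < cu a u" for u y
    using new[of u y] new[of y u] D(7)[OF that] D(8)[OF that] by auto
  have "rl a u = 0" if "u < n" "move v w (ex a) u < 0" for u
    using D(11)[of u] that v \<open>v \<noteq> w\<close> by (auto simp: move_def of_bool_def split: if_splits)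
  then show ?thesis
    using a range exq opt cur unfolding core_def bwd_def fwd_def by simp
qed

lemma core_step:
  assumes a: "core K d a" and s: "search f a" "src a < n"
  shows "core K d (step K a)"
proof -
  let ?v = "pos a" let ?w = "cu a ?v"
  have v: "?v < n" using s by (simp add: search_def)
  have w: "?w \<le> n" using coreD(6)[OF a v] .
  have irr: "core K d (a\<lparr>src := i, pos := j\<rparr>)" "core K d (a\<lparr>pos := j\<rparr>)" "core K d (a\<lparr>failed := True, src := i\<rparr>)" for i j
    using a core_cong[of "a\<lparr>src := i, pos := j\<rparr>" a K d] core_cong[of "a\<lparr>pos := j\<rparr>" a K d]
      core_cong[of "a\<lparr>failed := True, src := i\<rparr>" a K d] by simp_all
  consider "ex a ?v \<le> 0" | "0 < ex a ?v" "?w = n" | "0 < ex a ?v" "?w < n" "bwd K a ?v ?w \<or> fwd K a ?v ?w"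
    | "0 < ex a ?v" "?w < n" "\<not> bwd K a ?v ?w" "\<not> fwd K a ?v ?w" using w by linarith
  then show ?thesis
  proof cases
    case 1
    then show ?thesis using irr by (simp add: step_def Let_def)
  next
    case 2
    then show ?thesis using irr core_relabel[OF a v] by (simp add: step_def Let_def)
  next
    case 3
    then show ?thesis using core_push[OF a v 3(1,2)] by (auto simp: step_def Let_def)
  next
    case 4
    have "\<not> bwd K a u y \<and> \<not> fwd K a u y" if "u < n" "y < ((cu a)(?v := ?w + 1)) u" for u y
      using a that 4 by (cases "u = ?v"; cases "y = ?w") (auto simp: core_def)
    then have "core K d (a\<lparr>cu := (cu a)(?v := ?w + 1)\<rparr>)"
      using a 4(2) unfolding core_def bwd_def fwd_def by simp
    then show ?thesis using 4 by (simp add: step_def Let_def)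
  qed
qed

lemma push_inv_step:
  assumes a: "push_inv K d f a" and s: "src a < n"
  shows "push_inv K d f (step K a)"
proof -
  let ?v = "pos a" let ?w = "cu a ?v"
  have core: "core K d a" and se: "search f a" using a s by (auto simp: push_inv_def)
  have v: "?v < n" using se s by (simp add: search_def)
  have w: "?w \<le> n" using coreD(6)[OF core v] .
  have ne: "bwd K a ?v ?w \<or> fwd K a ?v ?w \<Longrightarrow> ?w \<noteq> ?v"
    using coreD(1,2)[OF core v v] c_diag[of ?v] by (auto simp: bwd_def fwd_def)
  have "search f (step K a) \<or> failed (step K a) \<and> stuck (step K a) \<and> src (step K a) = n"
  proof (cases "0 < ex a ?v \<and> ?w = n \<and> limit \<le> rl a ?v")
    case True
    then show ?thesis using v by (auto simp: step_def Let_def stuck_def)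
  next
    case False
    have small: "ex a x \<le> of_bool (x = ?v)" if "x < src a" for x using se that by (simp add: search_def)
    have "search f (step K a)"
    proof (cases "ex a ?v \<le> 0")
      case True
      then have "ex a x \<le> 0" if "x < src a" for x using small[OF that] by (cases "x = ?v") auto
      then show ?thesis using True se s by (auto simp: search_def step_def Let_def less_Suc_eq of_bool_def)
    next
      case pos: False
      show ?thesis
      proof (cases "?w < n \<and> (bwd K a ?v ?w \<or> fwd K a ?v ?w)")
        case True
        have "move ?v ?w (ex a) x \<le> of_bool (x = ?w)" if "x < src a" for x
          using small[OF that] ne True by (auto simp: move_def of_bool_def split: if_splits)
        then show ?thesis using True pos se s by (auto simp: search_def step_def Let_def)
      next
        case no: False
        show ?thesis
        proof (cases "?w = n")
          case True
          then have "\<not> limit \<le> rl a ?v" using False pos by auto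
          then show ?thesis using True pos se s by (simp add: search_def step_def Let_def)
        next
          case False
          then have "\<not> bwd K a ?v ?w" "\<not> fwd K a ?v ?w" using no w by auto
          then show ?thesis using False pos se s by (simp add: search_def step_def Let_def)
        qed
      qed
    qed
    then show ?thesis ..
  qed
  then show ?thesis using core_step[OF core se s] by (simp add: push_inv_def)
qed

section \<open>A potential for the push steps\<close>

definition admissible :: "int \<Rightarrow> push_state \<Rightarrow> nat \<Rightarrow> nat \<Rightarrow> int" where
  "admissible K a u w = (if lb a w - K < lb a u then fl a w u else 0) + (if lb a w + K < lb a u then c u w - fl a u w else 0)"

text \<open>
  The first sum counts the units that can be moved at the current labels. A push lowers it by one; a
  relabelling raises it by at most \<open>4 * n\<close>, which the second sum pays for.
\<close>

definition potential :: "int \<Rightarrow> push_state \<Rightarrow> int" where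
  "potential K a = 2 * (\<Sum>u<n. \<Sum>w<n. admissible K a u w)
     + 2 * (\<Sum>u<n. (int limit - int (rl a u)) * (5 * int n + 1) + (int n - int (cu a u)))
     + 2 * (int n - int (src a)) + of_bool (ex a (pos a) \<le> 0)"

lemma admissible_bounds:
  assumes "core K d a" "u < n" "w < n"
  shows "0 \<le> admissible K a u w" "admissible K a u w \<le> 4"
  using coreD(1,2)[OF assms] coreD(1,2)[OF assms(1,3,2)] c_bound[of u w] c_bound[of w u]
  by (auto simp: admissible_def)

lemma potential_nonneg:
  assumes "core K d a" "src a \<le> n"
  shows "0 \<le> potential K a"
proof -
  have "0 \<le> (\<Sum>u<n. \<Sum>w<n. admissible K a u w)"
    using admissible_bounds[OF assms(1)] by (intro sum_nonneg) auto
  moreover have "0 \<le> (\<Sum>u<n. (int limit - int (rl a u)) * (5 * int n + 1) + (int n - int (cu a u)))"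
    using coreD(6,9)[OF assms(1)] by (intro sum_nonneg add_nonneg_nonneg mult_nonneg_nonneg) auto
  ultimately show ?thesis using assms(2) by (simp add: potential_def)
qed

lemma potential_initial: "potential K (initial K d f) \<le> 8 * int n ^ 2 + 2 * int n * ((3 * int n + 3) * (5 * int n + 1) + int n) + 2 * int n + 1"
proof -
  let ?a = "initial K d f"
  have "(\<Sum>u<n. \<Sum>w<n. admissible K ?a u w) \<le> (\<Sum>u<n. \<Sum>w<n. 4)"
    using admissible_bounds[OF core_initial] by (intro sum_mono) auto
  also have "\<dots> = 4 * int n ^ 2" by (simp add: power2_eq_square)
  finally show ?thesis by (simp add: potential_def initial_def Let_def limit_def algebra_simps)
qed

lemma sum_change_one:
  fixes g h :: "nat \<Rightarrow> int"
  assumes "v < n" "h v = g v + k" "\<And>u. u < n \<Longrightarrow> u \<noteq> v \<Longrightarrow> h u = g u"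
  shows "(\<Sum>u<n. h u) = (\<Sum>u<n. g u) + k"
proof -
  have "(\<Sum>u<n. h u) = h v + (\<Sum>u\<in>{..<n} - {v}. h u)" using assms(1) by (simp add: sum.remove)
  also have "(\<Sum>u\<in>{..<n} - {v}. h u) = (\<Sum>u\<in>{..<n} - {v}. g u)" using assms(3) by (intro sum.cong) auto
  also have "h v + \<dots> = k + (g v + (\<Sum>u\<in>{..<n} - {v}. g u))" by (simp add: assms(2))
  also have "g v + (\<Sum>u\<in>{..<n} - {v}. g u) = (\<Sum>u<n. g u)" using assms(1) by (simp add: sum.remove)
  finally show ?thesis by simp
qed

text \<open>Admissibility of a residual arc excludes that of its reversal, so exactly one summand
  falls by 1. At the new position the excess may be used up and raise the last term by 1, which the
  factor 2 absorbs.\<close>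

lemma potential_push:
  assumes a: "core K d a" and v: "v < n" "w < n"
    and F: "F = (\<lambda>x y. fl a x y - unit_arc w v x y) \<and> bwd K a v w \<or>
      F = (\<lambda>x y. fl a x y + unit_arc v w x y) \<and> \<not> bwd K a v w \<and> fwd K a v w"
    and pos: "0 < ex a (pos a)" and K: "0 < K"
  shows "potential K (a\<lparr>fl := F, ex := e, pos := x\<rparr>) < potential K a"
proof -
  let ?a = "a\<lparr>fl := F, ex := e, pos := x\<rparr>"
  note D = coreD[OF a]
  have "v \<noteq> w" using F D(1,2)[of v v] c_diag[of v] v by (auto simp: bwd_def fwd_def)
  have adm: "admissible K ?a u y = admissible K a u y - of_bool (u = v \<and> y = w)" for u y
    using F K \<open>v \<noteq> w\<close> by (auto simp: admissible_def unit_arc_def of_bool_def bwd_def fwd_def)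
  have row: "(\<Sum>y<n. admissible K ?a v y) = (\<Sum>y<n. admissible K a v y) + - 1"
    by (rule sum_change_one[OF v(2)]) (auto simp: adm)
  have "(\<Sum>u<n. \<Sum>y<n. admissible K ?a u y) = (\<Sum>u<n. \<Sum>y<n. admissible K a u y) + - 1"
    by (rule sum_change_one[where v = v]) (use v(1) row in \<open>auto simp: adm\<close>)
  then show ?thesis using pos by (simp add: potential_def)
qed

lemma potential_relabel:
  assumes a: "core K d a" and v: "v < n" "cu a v = n" "rl a v < limit"
  defines "a' \<equiv> a\<lparr>lb := (lb a)(v := lb a v + 1), rl := (rl a)(v := rl a v + 1), cu := (cu a)(v := 0)\<rparr>"
  shows "potential K a' < potential K a"
proof -
  note D = coreD[OF a]
  have le: "admissible K a' u y \<le> admissible K a u y + of_bool (u = v) * 4" if uy: "u < n" "y < n" for u y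
  proof (cases "u = v")
    case True
    have "admissible K a' u y \<le> 4"
      using D(1,2)[OF uy] D(1,2)[OF uy(2,1)] c_bound[of u y] c_bound[of y u] by (auto simp: admissible_def a'_def)
    then show ?thesis using admissible_bounds[OF a uy] True by simp
  next
    case False
    then show ?thesis
      using D(1,2)[OF uy] D(1,2)[OF uy(2,1)] by (auto simp: admissible_def a'_def)
  qed
  have "(\<Sum>u<n. \<Sum>y<n. admissible K a' u y) \<le> (\<Sum>u<n. \<Sum>y<n. admissible K a u y + of_bool (u = v) * 4)"
    by (intro sum_mono le) auto
  also have "\<dots> = (\<Sum>u<n. \<Sum>y<n. admissible K a u y) + 4 * int n"
    using v by (simp add: sum.distrib mult.commute[of "of_bool _"] sum_distrib_left[symmetric] sum_distrib_right[symmetric])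
  finally have 1: "(\<Sum>u<n. \<Sum>y<n. admissible K a' u y) \<le> (\<Sum>u<n. \<Sum>y<n. admissible K a u y) + 4 * int n" .
  let ?t = "\<lambda>a u. (int limit - int (rl a u)) * (5 * int n + 1) + (int n - int (cu a u))"
  \<comment> \<open>One relabelling releases \<open>5 * n + 1\<close>; resetting the current arc
    from \<open>n\<close> to 0 takes back \<open>n\<close>, the new admissible units at most
    \<open>4 * n\<close>, and 1 is left for a strict decrease.\<close>
  have 2: "(\<Sum>u<n. ?t a' u) = (\<Sum>u<n. ?t a u) + (- (4 * int n) - 1)"
    by (rule sum_change_one[OF v(1)]) (use v in \<open>auto simp: a'_def algebra_simps\<close>)
  have 3: "src a' = src a" "ex a' (pos a') = ex a (pos a)" by (simp_all add: a'_def)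
  show ?thesis using 1 2 unfolding potential_def 3 by linarith
qed

text \<open>A return of \<open>pos\<close> to \<open>src\<close> lowers nothing but the last term,
  which drops from 1 to 0 because the excess at \<open>src\<close> is positive; all other actions
  lower the sums taken together or \<open>n - src\<close>.\<close>

lemma potential_step:
  assumes a: "push_inv K d f a" and s: "src a < n" and K: "0 < K"
  shows "potential K (step K a) < potential K a"
proof -
  let ?v = "pos a" let ?w = "cu a ?v"
  have core: "core K d a" and se: "search f a" using a s by (auto simp: push_inv_def)
  have v: "?v < n" using se s by (simp add: search_def)
  have w: "?w \<le> n" using coreD(6)[OF core v] .
  have adm: "admissible K (a\<lparr>src := i, pos := j\<rparr>) = admissible K a" "admissible K (a\<lparr>pos := j\<rparr>) = admissible K a"
    "admissible K (a\<lparr>failed := True, src := i\<rparr>) = admissible K a" "admissible K (a\<lparr>cu := q\<rparr>) = admissible K a" for i j q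
    by (simp_all add: admissible_def fun_eq_iff)
  consider "ex a ?v \<le> 0" | "0 < ex a ?v" "?w = n" | "0 < ex a ?v" "?w < n" "bwd K a ?v ?w \<or> fwd K a ?v ?w"
    | "0 < ex a ?v" "?w < n" "\<not> bwd K a ?v ?w" "\<not> fwd K a ?v ?w" using w by linarith
  then show ?thesis
  proof cases
    case 1
    then show ?thesis using s by (auto simp: step_def Let_def potential_def adm)
  next
    case 2
    show ?thesis
    proof (cases "limit \<le> rl a ?v")
      case True
      then have "step K a = a\<lparr>failed := True, src := n\<rparr>" using 2 by (simp add: step_def Let_def)
      then show ?thesis using s by (simp add: potential_def adm)
    next
      case False
      then show ?thesis using 2 potential_relabel[OF core v 2(2)] by (simp add: step_def Let_def)
    qed
  next
    case 3
    then show ?thesis using potential_push[OF core v 3(2) _ 3(1) K] by (auto simp: step_def Let_def)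
  next
    case 4
    let ?t = "\<lambda>a u. (int limit - int (rl a u)) * (5 * int n + 1) + (int n - int (cu a u))"
    have "(\<Sum>u<n. ?t (a\<lparr>cu := (cu a)(?v := ?w + 1)\<rparr>) u) = (\<Sum>u<n. ?t a u) + - 1"
      by (rule sum_change_one[OF v]) auto
    then show ?thesis using 4 by (simp add: step_def Let_def potential_def adm)
  qed
qed

section \<open>Feasibility and minimality at the end of a scale\<close>

lemma sum_excess:
  assumes "core K d a"
  shows "(\<Sum>u<n. ex a u) = (\<Sum>u<n. T u)"
proof -
  have "(\<Sum>u<n. ex a u) = (\<Sum>u<n. T u - out_flow n (fl a) u + in_flow n (fl a) u)"
    using coreD(3)[OF assms] by simp
  then show ?thesis using sum_in_flow[of n "fl a"] by (simp add: sum.distrib sum_subtractf total_def)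
qed

lemma sum_need_flow:
  assumes "flow n c T F"
  shows "(\<Sum>u<n. T u) = 0"
proof -
  have "(\<Sum>u<n. T u) = (\<Sum>u<n. out_flow n F u - in_flow n F u)" using assms by (simp add: flow_def)
  then show ?thesis using sum_in_flow[of n F] by (simp add: sum_subtractf total_def)
qed

text \<open>No excess is positive any more and together they sum to 0, so all vanish.\<close>

lemma flow_at_end:
  assumes core: "core K d a" and se: "search f a" "src a = n" and T: "(\<Sum>u<n. T u) = 0"
  shows "flow n c T (fl a)"
proof -
  have le: "ex a u \<le> 0" if "u < n" for u using se that by (auto simp: search_def)
  have "(\<Sum>u<n. - ex a u) = 0" using sum_excess[OF core] T by (simp add: sum_negf)
  then have "- ex a u = 0" if "u < n" for u
    using sum_nonneg_eq_0_iff[of "{..<n}" "\<lambda>u. - ex a u"] le that by auto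
  then have "out_flow n (fl a) u - in_flow n (fl a) u = T u" if "u < n" for u
    using coreD(3)[OF core that] that by simp
  then show ?thesis using coreD(1,2)[OF core] by (simp add: flow_def)
qed

text \<open>
  Along an arc on which \<open>F'\<close> and the current flow differ, the number of relabellings
  drops by at most 3. Of the \<open>n + 1\<close> classes of width 3 one contains no vertex, and the
  vertices above it form a cut that contradicts the feasibility of \<open>F'\<close>.
\<close>

lemma not_stuck:
  assumes core: "core K d a" and F': "flow n c T F'" and opt: "optimal 2 K d F'"
  shows "\<not> stuck a"
proof
  assume "stuck a"
  then obtain v where v: "v < n" "0 < ex a v" "limit \<le> rl a v" by (auto simp: stuck_def)
  note D = coreD[OF core]
  let ?F = "fl a"
  define level where "level x = rl a x div 3" for x
  have deficit: "\<exists>t<n. ex a t < 0"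
  proof (rule ccontr)
    assume "\<not> ?thesis"
    then have "0 \<le> ex a t" if "t < n" for t using that by force
    then have "0 < (\<Sum>u<n. ex a u)" using v by (intro sum_pos2[of _ v]) auto
    then show False using sum_excess[OF core] sum_need_flow[OF F'] by simp
  qed
  then have lev0: "0 \<in> level ` {..<n}" using D(11) by (force simp: level_def image_iff)
  have "\<not> {..n} \<subseteq> level ` {..<n}"
  proof
    assume "{..n} \<subseteq> level ` {..<n}"
    then have "card {..n} \<le> card (level ` {..<n})" by (intro card_mono) auto
    also have "\<dots> \<le> n" using card_image_le[of "{..<n}" level] by simp
    finally show False by simp
  qed
  then obtain j where j: "j \<le> n" "j \<notin> level ` {..<n}" by auto
  define R where "R = {x. x < n \<and> j < level x}"
  have RV: "R \<subseteq> {..<n}" "finite R" by (auto simp: R_def)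
  \<comment> \<open>\<open>limit = 3 * (n + 1)\<close> lifts the stuck vertex to level at least
    \<open>n + 1\<close>, above the empty level \<open>j\<close>.\<close>
  have vR: "v \<in> R" using v j by (auto simp: R_def level_def limit_def)
  have drop: "\<not> rl a x \<le> rl a y + 3" if "x \<in> R" "y \<in> {..<n} - R" for x y
  proof
    assume "rl a x \<le> rl a y + 3"
    then have "level x \<le> level y + 1" by (simp add: level_def)
    moreover have "level y < j" using that j by (auto simp: R_def le_less not_less)
    ultimately show False using that by (simp add: R_def)
  qed
  \<comment> \<open>The width 3 is the slack 1 of the current labels plus the slack 2 of the
    starting labels; the costs \<open>K\<close> and \<open>- K\<close> of the two opposite residual
    arcs cancel.\<close>
  have out: "F' x y \<le> ?F x y" "?F y x \<le> F' y x" if xy: "x \<in> R" "y \<in> {..<n} - R" for x y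
  proof -
    have n: "x < n" "y < n" using xy RV by auto
    show "F' x y \<le> ?F x y"
    proof (rule ccontr)
      assume *: "\<not> ?thesis"
      have "F' x y \<le> c x y" using F' n by (simp add: flow_def)
      then have "?F x y < c x y" "0 < F' x y" using * D(1)[OF n] by linarith+
      then have "lb a x \<le> lb a y + K + 1" "d y \<le> d x - K + 2" using D(4)[OF n] opt n by (auto simp: optimal_def)
      then show False using drop[OF xy] D(10)[OF n(1)] D(10)[OF n(2)] by linarith
    qed
    show "?F y x \<le> F' y x"
    proof (rule ccontr)
      assume *: "\<not> ?thesis"
      have "0 \<le> F' y x" using F' n by (simp add: flow_def)
      then have "F' y x < c y x" "0 < ?F y x" using * D(2)[OF n(2,1)] by linarith+
      then have "lb a x \<le> lb a y - K + 1" "d y \<le> d x + K + 2" using D(5)[OF n] opt n by (auto simp: optimal_def)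
      then show False using drop[OF xy] D(10)[OF n(1)] D(10)[OF n(2)] by linarith
    qed
  qed
  let ?\<delta> = "\<lambda>x y. F' x y - ?F x y"
  \<comment> \<open>The excess in \<open>R\<close> is the net amount by which \<open>F'\<close>
    sends more out of \<open>R\<close> than the current flow; differences inside \<open>R\<close>
    cancel in pairs.\<close>
  have "(\<Sum>x\<in>R. ex a x) = (\<Sum>x\<in>R. \<Sum>y<n. ?\<delta> x y - ?\<delta> y x)"
  proof (rule sum.cong)
    fix x assume "x \<in> R"
    then have x: "x < n" using RV by auto
    have "T x = out_flow n F' x - in_flow n F' x" using F' x by (simp add: flow_def)
    then show "ex a x = (\<Sum>y<n. ?\<delta> x y - ?\<delta> y x)"
      using D(3)[OF x] by (simp add: out_flow_def in_flow_def sum_subtractf)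
  qed simp
  also have "\<dots> = (\<Sum>x\<in>R. (\<Sum>y\<in>R. ?\<delta> x y - ?\<delta> y x) + (\<Sum>y\<in>{..<n} - R. ?\<delta> x y - ?\<delta> y x))"
    by (intro sum.cong refl, subst sum.subset_diff[OF RV(1) finite_lessThan]) (rule add.commute)
  also have "\<dots> = (\<Sum>x\<in>R. \<Sum>y\<in>R. ?\<delta> x y - ?\<delta> y x) + (\<Sum>x\<in>R. \<Sum>y\<in>{..<n} - R. ?\<delta> x y - ?\<delta> y x)"
    by (rule sum.distrib)
  also have "(\<Sum>x\<in>R. \<Sum>y\<in>R. ?\<delta> x y - ?\<delta> y x) = 0"
    using sum.swap[of ?\<delta> R R] by (simp add: sum_subtractf)
  also have "0 + (\<Sum>x\<in>R. \<Sum>y\<in>{..<n} - R. ?\<delta> x y - ?\<delta> y x) \<le> 0"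
  proof -
    have "?\<delta> x y - ?\<delta> y x \<le> 0" if "x \<in> R" "y \<in> {..<n} - R" for x y using out[OF that] by linarith
    then have "(\<Sum>x\<in>R. \<Sum>y\<in>{..<n} - R. ?\<delta> x y - ?\<delta> y x) \<le> 0" by (intro sum_nonpos)
    then show ?thesis by simp
  qed
  finally have "(\<Sum>x\<in>R. ex a x) \<le> 0" .
  \<comment> \<open>A vertex in deficit was never relabelled, so its level is 0 and it lies outside
    \<open>R\<close>.\<close>
  moreover have "0 \<le> ex a x" if "x \<in> R" for x
    using D(11)[of x] that by (force simp: R_def level_def)
  then have "0 < (\<Sum>x\<in>R. ex a x)" using vR v RV by (intro sum_pos2[of _ v]) auto
  ultimately show False by simp
qed

text \<open>
  With \<open>K\<close> larger than \<open>2 * n\<^sup>2\<close> rather than \<open>n\<close>, no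
  decomposition of the difference into cycles is needed.
\<close>

lemma optimal_imp_minimal:
  assumes F: "flow n c T F" and F': "flow n c T F'" and opt: "optimal 1 K d F" and K: "2 * int n ^ 2 < K"
  shows "total n F \<le> total n F'"
proof -
  let ?\<delta> = "\<lambda>u v. F' u v - F u v"
  \<comment> \<open>The reduced cost \<open>K - d u + d v\<close> is at least -1 where flow can be
    added and at most 1 where it can be removed, and the flows differ by at most 2.\<close>
  have "- 2 \<le> ?\<delta> u v * (K - d u + d v)" if uv: "u < n" "v < n" for u v
  proof -
    have r: "0 \<le> F u v" "F u v \<le> c u v" "0 \<le> F' u v" "F' u v \<le> c u v" "c u v \<le> 2"
      using F F' uv c_bound by (auto simp: flow_def)
    have o1: "F u v < c u v \<Longrightarrow> - 1 \<le> K - d u + d v" and o2: "0 < F u v \<Longrightarrow> K - d u + d v \<le> 1"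
      using opt uv by (fastforce simp: optimal_def)+
    consider "?\<delta> u v = 0" | "0 < ?\<delta> u v" | "?\<delta> u v < 0" by linarith
    then show ?thesis
    proof cases
      case 2
      then have "?\<delta> u v * - 1 \<le> ?\<delta> u v * (K - d u + d v)" using o1 r by (intro mult_left_mono) auto
      moreover have "- 2 \<le> ?\<delta> u v * - 1" using r by auto
      ultimately show ?thesis by (rule order_trans[rotated])
    next
      case 3
      then have "?\<delta> u v * 1 \<le> ?\<delta> u v * (K - d u + d v)" using o2 r by (intro mult_left_mono_neg) auto
      moreover have "- 2 \<le> ?\<delta> u v * 1" using r by auto
      ultimately show ?thesis by (rule order_trans[rotated])
    qed simp
  qed
  then have "(\<Sum>u<n. \<Sum>v<n. - 2) \<le> (\<Sum>u<n. \<Sum>v<n. ?\<delta> u v * (K - d u + d v))"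
    by (intro sum_mono) auto
  also have "\<dots> = K * (\<Sum>u<n. \<Sum>v<n. ?\<delta> u v) - (\<Sum>u<n. \<Sum>v<n. ?\<delta> u v * d u) + (\<Sum>u<n. \<Sum>v<n. ?\<delta> u v * d v)"
    by (simp add: algebra_simps sum.distrib sum_subtractf sum_distrib_left)
  also have "(\<Sum>u<n. \<Sum>v<n. ?\<delta> u v * d v) = (\<Sum>v<n. \<Sum>u<n. ?\<delta> u v * d v)" by (rule sum.swap)
  also have "\<dots> = (\<Sum>v<n. \<Sum>u<n. ?\<delta> v u * d v)"
  proof (rule sum.cong)
    fix v assume "v \<in> {..<n}"
    \<comment> \<open>Both flows have the same supplies, so their difference is a circulation and
      the labels drop out of the cost.\<close>
    then have "out_flow n F v - in_flow n F v = out_flow n F' v - in_flow n F' v" using F F' by (simp add: flow_def)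
    then have "(\<Sum>u<n. ?\<delta> u v) = (\<Sum>u<n. ?\<delta> v u)" by (simp add: out_flow_def in_flow_def sum_subtractf)
    then show "(\<Sum>u<n. ?\<delta> u v * d v) = (\<Sum>u<n. ?\<delta> v u * d v)" by (simp flip: sum_distrib_right)
  qed simp
  also have "(\<Sum>u<n. \<Sum>v<n. ?\<delta> u v) = total n F' - total n F"
    by (simp add: total_def out_flow_def sum_subtractf)
  finally have "- (2 * int n ^ 2) \<le> K * (total n F' - total n F)" by (simp add: power2_eq_square)
  \<comment> \<open>The \<open>n^2\<close> pairs lose at most 2 each, together less than the cost
    \<open>K\<close> of a single unit.\<close>
  then have "- K < K * (total n F' - total n F)" using K by linarith
  then have "K * (- 1) < K * (total n F' - total n F)" by simp
  moreover have "0 < K" using K by (smt (verit) zero_le_power2)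
  ultimately have "- 1 < total n F' - total n F" using mult_less_cancel_left_pos by blast
  then show ?thesis by simp
qed

lemma optimal_double: "optimal 1 K d F \<Longrightarrow> optimal 2 (2 * K) (\<lambda>u. 2 * d u) F"
  unfolding optimal_def by force

text \<open>Costs \<open>1\<close> and \<open>- 1\<close> stay within the slack when all labels
  vanish: the start of the scaling, for which any feasible flow may serve as witness.\<close>

lemma optimal_zero: "optimal 2 1 (\<lambda>_. 0) F"
  by (simp add: optimal_def)

end

section \<open>Program verification\<close>

definition runs :: "int \<Rightarrow> com \<Rightarrow> ram_state \<Rightarrow> nat \<Rightarrow> (ram_state \<Rightarrow> bool) \<Rightarrow> bool" where
  "runs W c s B Q \<longleftrightarrow> (\<exists>t s'. exec W c s t s' \<and> t \<le> B \<and> Q s')"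

text \<open>Meant for loop-free code: \<open>While\<close> is mapped to \<open>False\<close>, and
  loops are treated by \<open>runs_While\<close>. Hence a precondition together with the syntactic
  \<open>cost\<close> already yields a time bound.\<close>

fun wp :: "int \<Rightarrow> com \<Rightarrow> (ram_state \<Rightarrow> bool) \<Rightarrow> ram_state \<Rightarrow> bool" where
  "wp W Skip Q s = Q s"
| "wp W (Assign x a) Q s = (asafe W a s \<and> Q (s\<lparr>var := (var s)(x := aval a s)\<rparr>))"
| "wp W (Put x i a) Q s = (asafe W i s \<and> 0 \<le> aval i s \<and> asafe W a s \<and>
     Q (s\<lparr>arr := (arr s)(x := (arr s x)(nat (aval i s) := aval a s))\<rparr>))"
| "wp W (Seq c1 c2) Q s = wp W c1 (wp W c2 Q) s"
| "wp W (Cond b c1 c2) Q s = (bsafe W b s \<and> (if bval b s then wp W c1 Q s else wp W c2 Q s))"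
| "wp W (While b c) Q s = False"

fun cost :: "com \<Rightarrow> nat" where
  "cost Skip = 1"
| "cost (Assign x a) = acost a + 1"
| "cost (Put x i a) = acost i + acost a + 1"
| "cost (Seq c1 c2) = cost c1 + cost c2"
| "cost (Cond b c1 c2) = bcost b + max (cost c1) (cost c2)"
| "cost (While b c) = 0"

lemma wp_exec: "wp W c Q s \<Longrightarrow> \<exists>t s'. exec W c s t s' \<and> t \<le> cost c \<and> Q s'"
proof (induction c arbitrary: Q s)
  case Skip
  then show ?case using exec.Skip[of W s] by auto
next
  case (Assign x a)
  then show ?case using exec.Assign[of W a s x] by auto
next
  case (Put x i a)
  then show ?case using exec.Put[of W i s a x] by auto
next
  case (Seq c1 c2)
  then obtain t1 s1 where 1: "exec W c1 s t1 s1" "t1 \<le> cost c1" "wp W c2 Q s1" by fastforce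
  then obtain t2 s2 where 2: "exec W c2 s1 t2 s2" "t2 \<le> cost c2" "Q s2" using Seq.IH(2) by blast
  then show ?case using exec.Seq[OF 1(1) 2(1)] 1 by (intro exI[of _ "t1 + t2"] exI[of _ s2]) simp
next
  case (Cond b c1 c2)
  show ?case
  proof (cases "bval b s")
    case True
    then obtain t s' where *: "exec W c1 s t s'" "t \<le> cost c1" "Q s'" using Cond by fastforce
    then have "exec W (Cond b c1 c2) s (bcost b + t) s'" using True Cond.prems by (auto intro: exec.CondTrue)
    then show ?thesis using * by (intro exI[of _ "bcost b + t"] exI[of _ s']) simp
  next
    case False
    then obtain t s' where *: "exec W c2 s t s'" "t \<le> cost c2" "Q s'" using Cond by fastforce
    then have "exec W (Cond b c1 c2) s (bcost b + t) s'" using False Cond.prems by (auto intro: exec.CondFalse)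
    then show ?thesis using * by (intro exI[of _ "bcost b + t"] exI[of _ s']) simp
  qed
qed simp

lemma runs_wp: "wp W c Q s \<Longrightarrow> cost c \<le> B \<Longrightarrow> runs W c s B Q"
  unfolding runs_def using wp_exec by (meson order_trans)

lemma runs_weaken: "runs W c s B Q \<Longrightarrow> B \<le> B' \<Longrightarrow> (\<And>s. Q s \<Longrightarrow> Q' s) \<Longrightarrow> runs W c s B' Q'"
  unfolding runs_def by (meson order_trans)

lemma runs_Seq:
  assumes "runs W c1 s B1 R" "\<And>s. R s \<Longrightarrow> runs W c2 s B2 Q" "B1 + B2 \<le> B"
  shows "runs W (Seq c1 c2) s B Q"
proof -
  obtain t1 s1 where 1: "exec W c1 s t1 s1" "t1 \<le> B1" "R s1" using assms(1) by (auto simp: runs_def)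
  obtain t2 s2 where 2: "exec W c2 s1 t2 s2" "t2 \<le> B2" "Q s2" using assms(2)[OF 1(3)] by (auto simp: runs_def)
  show ?thesis unfolding runs_def using exec.Seq[OF 1(1) 2(1)] 1 2 assms(3)
    by (intro exI[of _ "t1 + t2"] exI[of _ s2]) simp
qed

lemma runs_Cond:
  assumes "bsafe W b s" "bval b s \<Longrightarrow> runs W c1 s B1 Q" "\<not> bval b s \<Longrightarrow> runs W c2 s B1 Q" "bcost b + B1 \<le> B"
  shows "runs W (Cond b c1 c2) s B Q"
proof (cases "bval b s")
  case True
  then obtain t s' where *: "exec W c1 s t s'" "t \<le> B1" "Q s'" using assms(2) by (auto simp: runs_def)
  then have "exec W (Cond b c1 c2) s (bcost b + t) s'" using True assms(1) by (auto intro: exec.CondTrue)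
  then show ?thesis unfolding runs_def using * assms(4) by (intro exI[of _ "bcost b + t"] exI[of _ s']) simp
next
  case False
  then obtain t s' where *: "exec W c2 s t s'" "t \<le> B1" "Q s'" using assms(3) by (auto simp: runs_def)
  then have "exec W (Cond b c1 c2) s (bcost b + t) s'" using False assms(1) by (auto intro: exec.CondFalse)
  then show ?thesis unfolding runs_def using * assms(4) by (intro exI[of _ "bcost b + t"] exI[of _ s']) simp
qed

text \<open>\<open>g\<close> is a ghost value that exists only in the proof, such as a loop index or
  an abstract \<open>push_state\<close>; the invariant links it to the memory, and its measure
  bounds the remaining rounds.\<close>

lemma runs_While:
  fixes m :: "'g \<Rightarrow> nat"
  assumes "J g s" "\<And>g s. J g s \<Longrightarrow> bsafe W b s"
    and "\<And>g s. J g s \<Longrightarrow> bval b s \<Longrightarrow> runs W c s C (\<lambda>s'. \<exists>g'. J g' s' \<and> m g' < m g)"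
    and "m g * (C + bcost b) + bcost b \<le> B" "\<And>g s. J g s \<Longrightarrow> \<not> bval b s \<Longrightarrow> Q s"
  shows "runs W (While b c) s B Q"
proof -
  have "\<exists>t s'. exec W (While b c) s t s' \<and> t \<le> m g * (C + bcost b) + bcost b \<and> Q s'"
    using assms(1)
  proof (induction "m g" arbitrary: g s rule: less_induct)
    case less
    show ?case
    proof (cases "bval b s")
      case True
      then obtain t1 s1 g1 where 1: "exec W c s t1 s1" "t1 \<le> C" "J g1 s1" "m g1 < m g"
        using assms(3)[OF less.prems] by (auto simp: runs_def)
      then obtain t2 s2 where 2: "exec W (While b c) s1 t2 s2" "t2 \<le> m g1 * (C + bcost b) + bcost b" "Q s2"
        using less.hyps by blast
      have "exec W (While b c) s (bcost b + t1 + t2) s2"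
        using True assms(2)[OF less.prems] 1 2 by (auto intro: exec.WhileTrue)
      moreover have "bcost b + t1 + t2 \<le> m g * (C + bcost b) + bcost b"
      proof -
        have "(m g1 + 1) * (C + bcost b) \<le> m g * (C + bcost b)" using 1(4) by (intro mult_le_mono1) simp
        then show ?thesis using 1(2) 2(2) by (simp add: algebra_simps)
      qed
      ultimately show ?thesis using 2(3) by blast
    next
      case False
      then have "exec W (While b c) s (bcost b) s" using assms(2)[OF less.prems] by (auto intro: exec.WhileFalse)
      then show ?thesis using assms(5)[OF less.prems False] by (intro exI[of _ "bcost b"] exI[of _ s]) simp
    qed
  qed
  then show ?thesis unfolding runs_def using assms(4) by (meson order_trans)
qed

definition For :: "string \<Rightarrow> com \<Rightarrow> com" where
  "For x body = Seq (Assign x (Num 0)) (While (Less (Var x) (Var ''n''))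
     (Seq body (Assign x (Plus (Var x) (Num 1)))))"

text \<open>Each round pays 4 for the increment and 3 for the test; the 5 is the initial assignment
  and the last test. As the invariant may mention the counter, it is demanded for the state after
  the increment.\<close>

lemma runs_For:
  assumes n: "var s ''n'' = int n" "x \<noteq> ''n''" "int n \<le> W" "1 \<le> W"
    and 0: "P 0 (s\<lparr>var := (var s)(x := 0)\<rparr>)"
    and body: "\<And>i s. i < n \<Longrightarrow> var s x = int i \<Longrightarrow> var s ''n'' = int n \<Longrightarrow> P i s \<Longrightarrow>
      runs W body s C (\<lambda>s'. var s' x = int i \<and> var s' ''n'' = int n \<and> P (Suc i) (s'\<lparr>var := (var s')(x := 1 + int i)\<rparr>))"
    and B: "n * (C + 7) + 5 \<le> B"
    and Q: "\<And>s. var s x = int n \<Longrightarrow> var s ''n'' = int n \<Longrightarrow> P n s \<Longrightarrow> Q s"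
  shows "runs W (For x body) s B Q"
  unfolding For_def
proof (rule runs_Seq[where ?B1.0 = 2 and ?B2.0 = "n * (C + 7) + 3"])
  let ?J = "\<lambda>i s. i \<le> n \<and> var s x = int i \<and> var s ''n'' = int n \<and> P i s"
  show "runs W (Assign x (Num 0)) s 2 (\<lambda>t. t = s\<lparr>var := (var s)(x := 0)\<rparr>)"
    using n by (intro runs_wp) auto
  fix t assume t: "t = s\<lparr>var := (var s)(x := 0)\<rparr>"
  show "runs W (While (Less (Var x) (Var ''n'')) (Seq body (Assign x (Plus (Var x) (Num 1))))) t (n * (C + 7) + 3) Q"
  proof (rule runs_While[where J = ?J and g = 0 and m = "\<lambda>i. n - i" and C = "C + 4"])
    show "?J 0 t" using t n 0 by simp
    fix i s assume J: "?J i s"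
    show "bsafe W (Less (Var x) (Var ''n'')) s" using J n by auto
    show "Q s" if "\<not> bval (Less (Var x) (Var ''n'')) s" using that J Q by auto
    assume b: "bval (Less (Var x) (Var ''n'')) s"
    then have i: "i < n" "var s x = int i" "var s ''n'' = int n" "P i s" using J by auto
    show "runs W (Seq body (Assign x (Plus (Var x) (Num 1)))) s (C + 4) (\<lambda>s'. \<exists>j. ?J j s' \<and> n - j < n - i)"
    proof (rule runs_Seq[OF body[OF i]])
      fix s' assume s': "var s' x = int i \<and> var s' ''n'' = int n \<and> P (Suc i) (s'\<lparr>var := (var s')(x := 1 + int i)\<rparr>)"
      show "runs W (Assign x (Plus (Var x) (Num 1))) s' 4 (\<lambda>s'. \<exists>j. ?J j s' \<and> n - j < n - i)"
      proof (rule runs_wp)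
        show "wp W (Assign x (Plus (Var x) (Num 1))) (\<lambda>s'. \<exists>j. ?J j s' \<and> n - j < n - i) s'"
          using s' i n by (auto simp: add.commute intro!: exI[of _ "Suc i"])
      qed simp
    qed simp
  qed (simp add: eval_nat_numeral)
qed (use B in simp)

lemma runs_For_stable:
  assumes n: "var s ''n'' = int n" "x \<noteq> ''n''" "int n \<le> W" "1 \<le> W"
    and stable: "\<And>i s a. P i s \<Longrightarrow> P i (s\<lparr>var := (var s)(x := a)\<rparr>)" and 0: "P 0 s"
    and body: "\<And>i s. i < n \<Longrightarrow> var s x = int i \<Longrightarrow> var s ''n'' = int n \<Longrightarrow> P i s \<Longrightarrow>
      runs W body s C (\<lambda>s'. var s' x = int i \<and> var s' ''n'' = int n \<and> P (Suc i) s')"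
    and B: "n * (C + 7) + 5 \<le> B"
    and Q: "\<And>s. var s ''n'' = int n \<Longrightarrow> P n s \<Longrightarrow> Q s"
  shows "runs W (For x body) s B Q"
proof (rule runs_For[where P = P and C = C, OF n])
  show "P 0 (s\<lparr>var := (var s)(x := 0)\<rparr>)" using stable[OF 0] .
  show "runs W body s C (\<lambda>s'. var s' x = int i \<and> var s' ''n'' = int n \<and> P (Suc i) (s'\<lparr>var := (var s')(x := 1 + int i)\<rparr>))"
    if "i < n" "var s x = int i" "var s ''n'' = int n" "P i s" for i s
    using body[OF that] by (rule runs_weaken) (simp_all add: stable)
qed (use B Q in auto)

lemma index_eq_iff:
  fixes u v u' v' n :: nat
  assumes "v < n" "v' < n"
  shows "u * n + v = u' * n + v' \<longleftrightarrow> u = u' \<and> v = v'"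
proof
  assume eq: "u * n + v = u' * n + v'"
  have "u = (u * n + v) div n" "u' = (u' * n + v') div n" using assms by simp_all
  then have "u = u'" using eq by simp
  then show "u = u' \<and> v = v'" using eq by simp
qed simp

lemma index_less:
  fixes u v n :: nat
  assumes "u < n" "v < n"
  shows "u * n + v < n * n"
proof -
  have "u * n + v < Suc u * n" using assms by simp
  also have "\<dots> \<le> n * n" using assms by (intro mult_le_mono1) simp
  finally show ?thesis .
qed

lemma nat_index: "nat (int u * int n + int v) = u * n + v"
  by (simp flip: of_nat_mult of_nat_add)

lemma int_index_bounds:
  assumes "u < n" "v < n"
  shows "0 \<le> int u * int n + int v" "int u * int n + int v < int n * int n" "\<bar>int u * int n\<bar> \<le> int n * int n"
proof -
  have "int (u * n + v) < int (n * n)" using index_less[OF assms] by (simp only: of_nat_less_iff)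
  then show "int u * int n + int v < int n * int n" by simp
  have "u * n \<le> n * n" using assms by (intro mult_le_mono1) simp
  then have "int (u * n) \<le> int (n * n)" by (simp only: of_nat_le_iff)
  then show "\<bar>int u * int n\<bar> \<le> int n * int n" by simp
qed simp

section \<open>Setting up capacities and component labels\<close>

abbreviation idx :: "string \<Rightarrow> string \<Rightarrow> aexp" where
  "idx x y \<equiv> Plus (Times (Var x) (Var ''n'')) (Var y)"

text \<open>
  Arrays: \<open>T\<close> for the needed balances, \<open>C\<close> capacities, \<open>lab\<close>
  component labels, \<open>seen\<close> marks on labels, and in the scaling phase \<open>F\<close>
  flow, \<open>d\<close> vertex labels, \<open>g\<close> numbers of relabellings, \<open>cu\<close>
  current arcs, \<open>ex\<close> excesses.
\<close>

definition init_cell :: "int \<Rightarrow> com" where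
  "init_cell e = Seq (Assign ''i'' (idx ''u'' ''v'')) (Seq (Assign ''j'' (idx ''v'' ''u''))
        (Seq (Put ''T'' (Var ''u'') (Plus (Minus (Get ''T'' (Var ''u'')) (Get ''adj'' (Var ''i''))) (Get ''adj'' (Var ''j''))))
        (Cond (Equal (Var ''u'') (Var ''v'')) (Put ''C'' (Var ''i'') (Num 0))
          (Put ''C'' (Var ''i'') (Plus (Minus (Num 1) (Get ''adj'' (Var ''i''))) (Times (Num e) (Get ''adj'' (Var ''j''))))))))"

definition init_row :: com where
  "init_row = Seq (Put ''T'' (Var ''u'') (Get ''delta'' (Var ''u''))) (Seq (Put ''lab'' (Var ''u'') (Var ''u''))
         (Seq (Put ''d'' (Var ''u'') (Num 0)) (Put ''seen'' (Var ''u'') (Num 0))))"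

definition init_prog :: "int \<Rightarrow> com" where
  "init_prog e = For ''u'' (Seq init_row (For ''v'' (init_cell e)))"

definition relabel_prog :: com where
  "relabel_prog = For ''w'' (Cond (Equal (Get ''lab'' (Var ''w'')) (Var ''a'')) (Put ''lab'' (Var ''w'') (Var ''b'')) Skip)"

text \<open>
  \<open>lab\<close> is maintained by quick-find: the component of \<open>u\<close> takes over the
  label of \<open>v\<close>.
\<close>

definition merge_cell :: com where
  "merge_cell = Cond (Equal (Get ''adj'' (idx ''u'' ''v'')) (Num 1))
     (Seq (Seq (Assign ''a'' (Get ''lab'' (Var ''u''))) (Assign ''b'' (Get ''lab'' (Var ''v'')))) relabel_prog) Skip"

definition merge_prog :: com where
  "merge_prog = For ''u'' (For ''v'' merge_cell)"

text \<open>
  \<open>Z\<close> bounds all numbers that are stored, up to a small factor.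
\<close>

locale ram_input =
  fixes S :: "edit_op set" and I :: cdbe_input and n :: nat and W Z :: int
  assumes EA: "EA \<in> S" and valid: "valid_input I" and order: "order I = n"
    and W: "100 * Z \<le> W" and Z1: "4 \<le> Z" and Zn: "int n * int n + 4 * int n \<le> Z"
    and Zbal: "\<And>v. v < n \<Longrightarrow> \<bar>balance I v\<bar> \<le> Z" and Zneed: "\<And>v. v < n \<Longrightarrow> \<bar>need I v\<bar> \<le> Z"
    and Zsum: "(\<Sum>v<n. \<bar>need I v\<bar>) \<le> Z" and Zk: "\<bar>budget I\<bar> \<le> Z"
    and Zlimit: "(6 * int n + 6) * (16 * int n * int n + 16) \<le> Z"
begin

abbreviation "A \<equiv> parcs (graph I)"

abbreviation "cap \<equiv> capacity S A"

definition "e = (of_bool (ED \<in> S) :: int)"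

lemma cap_eq: "cap i j = (if i = j then 0 else 1 - incidence A i j + e * incidence A j i)"
  by (simp add: capacity_def incidence_def e_def)

definition input_ok :: "ram_state \<Rightarrow> bool" where
  "input_ok s \<longleftrightarrow> var s ''n'' = int n \<and> var s ''k'' = budget I \<and>
     (\<forall>u<n. \<forall>v<n. arr s ''adj'' (u * n + v) = incidence A u v) \<and> (\<forall>v<n. arr s ''delta'' v = balance I v)"

lemma input_ok_cong:
  assumes "input_ok s" "var s' ''n'' = var s ''n''" "var s' ''k'' = var s ''k''"
    "arr s' ''adj'' = arr s ''adj''" "arr s' ''delta'' = arr s ''delta''"
  shows "input_ok s'"
  using assms by (simp add: input_ok_def)

definition rows :: "nat \<Rightarrow> ram_state \<Rightarrow> bool" where
  "rows i s \<longleftrightarrow> input_ok s \<and> (\<forall>u<i. \<forall>v<n. arr s ''C'' (u * n + v) = cap u v) \<and>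
     (\<forall>u<i. arr s ''T'' u = need I u \<and> arr s ''lab'' u = int u \<and> arr s ''d'' u = 0 \<and> arr s ''seen'' u = 0)"

definition row :: "nat \<Rightarrow> nat \<Rightarrow> ram_state \<Rightarrow> bool" where
  "row i j s \<longleftrightarrow> rows i s \<and> var s ''u'' = int i \<and> (\<forall>v<j. arr s ''C'' (i * n + v) = cap i v) \<and>
     arr s ''T'' i = balance I i - (\<Sum>v<j. incidence A i v) + (\<Sum>v<j. incidence A v i) \<and>
     arr s ''lab'' i = int i \<and> arr s ''d'' i = 0 \<and> arr s ''seen'' i = 0"

lemma incidence_range: "0 \<le> incidence A u v" "incidence A u v \<le> 1"
  by (simp_all add: incidence_def)

text \<open>Every intermediate value has to fit into a word, not just the final need, so the bound
  is shown for each prefix of the scan.\<close>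

lemma partial_need_bound:
  assumes "i < n" "j \<le> n"
  shows "\<bar>balance I i - (\<Sum>v<j. incidence A i v) + (\<Sum>v<j. incidence A v i)\<bar> \<le> 2 * Z"
proof -
  have "(\<Sum>v<j. incidence A i v) \<le> int j" "(\<Sum>v<j. incidence A v i) \<le> int j"
    using sum_bounded_above[of "{..<j}" _ "1::int"] incidence_range by (force)+
  moreover have "0 \<le> (\<Sum>v<j. incidence A i v)" "0 \<le> (\<Sum>v<j. incidence A v i)"
    by (auto intro: sum_nonneg incidence_range)
  moreover have "0 \<le> int n * int n" by simp
  ultimately show ?thesis using Zbal[OF assms(1)] assms(2) Zn by linarith
qed

lemma index_safe:
  assumes "i < n" "j < n"
  shows "0 \<le> int i * int n + int j" "int i * int n + int j \<le> Z" "int i * int n \<le> Z" "int i \<le> Z" "int j \<le> Z" "int n \<le> Z"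
proof -
  have "0 \<le> int n * int n" by simp
  then show "int n \<le> Z" using Zn by linarith
  then show "int i \<le> Z" "int j \<le> Z" using assms by linarith+
  show "0 \<le> int i * int n + int j" "int i * int n + int j \<le> Z" "int i * int n \<le> Z"
    using int_index_bounds[OF assms] Zn by linarith+
qed

lemma row_step:
  assumes row: "row i j s" and ij: "i < n" "j < n"
    and in': "var s' ''n'' = var s ''n''" "var s' ''k'' = var s ''k''"
      "arr s' ''adj'' = arr s ''adj''" "arr s' ''delta'' = arr s ''delta''"
    and s': "var s' ''u'' = var s ''u''" "arr s' ''C'' = (arr s ''C'')(i * n + j := cap i j)"
    "arr s' ''T'' = (arr s ''T'')(i := arr s ''T'' i - incidence A i j + incidence A j i)"
    "arr s' ''lab'' = arr s ''lab''" "arr s' ''d'' = arr s ''d''" "arr s' ''seen'' = arr s ''seen''"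
  shows "row i (Suc j) s'"
proof -
  have "arr s' ''C'' (u * n + v) = arr s ''C'' (u * n + v)" if "v < n" "(u, v) \<noteq> (i, j)" for u v
    using that ij s'(2) by (auto simp: index_eq_iff)
  moreover have "arr s' ''C'' (i * n + j) = cap i j" using s'(2) by simp
  moreover have "input_ok s'" using input_ok_cong[OF _ in'] row by (simp add: row_def rows_def)
  ultimately show ?thesis using row ij s' unfolding row_def rows_def
    by (simp add: less_Suc_eq)
qed

lemma init_inner:
  assumes row: "row i j s" and ij: "i < n" "j < n" and v: "var s ''v'' = int j"
  shows "runs W (init_cell e)
     s 100 (\<lambda>s'. var s' ''v'' = int j \<and> var s' ''n'' = int n \<and> row i (Suc j) (s'\<lparr>var := (var s')(''v'' := 1 + int j)\<rparr>))"
proof -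
  note b = index_safe[OF ij] index_safe[OF ij(2,1)]
  define t where "t = arr s ''T'' i"
  define a where "a = incidence A i j"
  define b where "b = incidence A j i"
  have i: "input_ok s" "var s ''u'' = int i" "var s ''n'' = int n" "arr s ''adj'' (i * n + j) = a"
    "arr s ''adj'' (j * n + i) = b" "arr s ''T'' i = t"
    using row ij by (simp_all add: row_def rows_def input_ok_def t_def a_def b_def)
  have "\<bar>t\<bar> \<le> 2 * Z"
    using partial_need_bound[of i j] row ij by (simp add: row_def t_def)
  moreover have "0 \<le> a" "a \<le> 1" "0 \<le> b" "b \<le> 1" by (simp_all add: a_def b_def incidence_range)
  moreover have "\<bar>e * b\<bar> \<le> 1" "\<bar>e\<bar> \<le> 1" by (simp_all add: e_def b_def incidence_def)
  moreover note index_safe[OF ij] index_safe[OF ij(2,1)] W Z1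
  note safe = calculation this
  have rs: "row i (Suc j) s'" if "var s' ''n'' = var s ''n''" "var s' ''k'' = var s ''k''"
    "arr s' ''adj'' = arr s ''adj''" "arr s' ''delta'' = arr s ''delta''" "var s' ''u'' = var s ''u''" "arr s' ''C'' = (arr s ''C'')(i * n + j := if i = j then 0 else 1 - a + e * b)"
    "arr s' ''T'' = (arr s ''T'')(i := t - a + b)"
    "arr s' ''lab'' = arr s ''lab''" "arr s' ''d'' = arr s ''d''" "arr s' ''seen'' = arr s ''seen''" for s'
    using that by (intro row_step[OF row ij]) (simp_all add: cap_eq a_def b_def t_def)
  show ?thesis
  proof (cases "i = j")
    case True
    then have ba: "b = a" by (simp add: a_def b_def)
    show ?thesis
      using safe unfolding init_cell_def
      apply (intro runs_wp)
       apply (simp_all add: i[unfolded True] v nat_index True)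
      apply (intro conjI impI; (linarith | (rule rs[unfolded True]; simp add: ba)))
      done
  next
    case False
    show ?thesis
      using safe unfolding init_cell_def
      apply (intro runs_wp)
       apply (simp_all add: i v nat_index False)
      apply (intro conjI impI; (linarith | (rule rs; simp add: False)))
      done
  qed
qed


definition base :: "ram_state \<Rightarrow> bool" where
  "base s \<longleftrightarrow> input_ok s \<and> (\<forall>u<n. \<forall>v<n. arr s ''C'' (u * n + v) = cap u v) \<and> (\<forall>u<n. arr s ''T'' u = need I u)"

definition clear :: "ram_state \<Rightarrow> bool" where
  "clear s \<longleftrightarrow> (\<forall>u<n. arr s ''d'' u = 0 \<and> arr s ''seen'' u = 0)"

lemma base_cong:
  assumes "base s" "var s' ''n'' = var s ''n''" "var s' ''k'' = var s ''k''"
    "arr s' ''adj'' = arr s ''adj''" "arr s' ''delta'' = arr s ''delta''" "arr s' ''C'' = arr s ''C''" "arr s' ''T'' = arr s ''T''"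
  shows "base s'"
  using assms input_ok_cong[of s s'] by (simp add: base_def)

lemma rows_cong:
  assumes "rows i s" "var s' ''n'' = var s ''n''" "var s' ''k'' = var s ''k''"
    "arr s' = arr s"
  shows "rows i s'"
  using assms input_ok_cong[of s s'] by (simp add: rows_def)

lemma row_cong:
  assumes "row i j s" "var s' ''n'' = var s ''n''" "var s' ''k'' = var s ''k''" "var s' ''u'' = var s ''u''"
    "arr s' = arr s"
  shows "row i j s'"
  using assms rows_cong[of i s s'] by (simp add: row_def)

lemma size_safe: "int n \<le> W" "1 \<le> W" "int n \<le> Z"
proof -
  have "0 \<le> int n * int n" by simp
  then show "int n \<le> W" "1 \<le> W" "int n \<le> Z" using Zn W Z1 by linarith+
qed

lemma init_runs:
  assumes "input_ok s"
  shows "runs W (init_prog e) s (n * (n * 107 + 32) + 5) (\<lambda>s. base s \<and> clear s \<and> (\<forall>u<n. arr s ''lab'' u = int u))"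
  unfolding init_prog_def
proof (rule runs_For[where P = rows and C = "n * 107 + 25"])
  show "var s ''n'' = int n" using assms by (simp add: input_ok_def)
  show "rows 0 (s\<lparr>var := (var s)(''u'' := 0)\<rparr>)" using assms by (simp add: rows_def input_ok_def)
  show "base s \<and> clear s \<and> (\<forall>u<n. arr s ''lab'' u = int u)" if "rows n s" for s
    using that by (simp add: rows_def base_def clear_def)
next
  fix i s assume i: "i < n" and u: "var s ''u'' = int i" and nn: "var s ''n'' = int n" and r: "rows i s"
  have d: "arr s ''delta'' i = balance I i" using r i by (simp add: rows_def input_ok_def)
  note facts = Zbal[OF i] W Z1 size_safe index_safe[OF i i]
  show "runs W
     (Seq init_row (For ''v'' (init_cell e))) s (n * 107 + 25) (\<lambda>s'. var s' ''u'' = int i \<and> var s' ''n'' = int n \<and> rows (Suc i) (s'\<lparr>var := (var s')(''u'' := 1 + int i)\<rparr>))"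
  proof (rule runs_Seq[where R = "row i 0"])
    show "runs W init_row s 20 (row i 0)"
    proof (rule runs_wp)
      show "wp W init_row (row i 0) s"
        using facts r by (simp add: init_row_def u d row_def rows_def input_ok_def)
    qed (simp add: init_row_def)
    fix s1 assume r1: "row i 0 s1"
    show "runs W (For ''v'' (init_cell e)) s1 (n * 107 + 5)
       (\<lambda>s'. var s' ''u'' = int i \<and> var s' ''n'' = int n \<and> rows (Suc i) (s'\<lparr>var := (var s')(''u'' := 1 + int i)\<rparr>))"
    proof (rule runs_For[where P = "row i" and C = 100])
      show "var s1 ''n'' = int n" using r1 by (simp add: row_def rows_def input_ok_def)
      show "row i 0 (s1\<lparr>var := (var s1)(''v'' := 0)\<rparr>)" using r1 by (rule row_cong) simp_all
      show "var s' ''u'' = int i \<and> var s' ''n'' = int n \<and> rows (Suc i) (s'\<lparr>var := (var s')(''u'' := 1 + int i)\<rparr>)"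
        if "row i n s'" for s'
      proof -
        have "rows (Suc i) s'" using that order by (auto simp: row_def rows_def less_Suc_eq need_def out_flow_def in_flow_def)
        then show ?thesis
          using that rows_cong[of "Suc i" s' "s'\<lparr>var := (var s')(''u'' := 1 + int i)\<rparr>"]
          by (simp add: row_def rows_def input_ok_def)
      qed
    qed (use init_inner i size_safe in auto)
  qed simp
qed (use size_safe in auto)

text \<open>A label is itself a vertex of the component it names, so that components can be counted
  as fixed points of \<open>l\<close>.\<close>

definition joined :: "(nat \<times> nat) set \<Rightarrow> (nat \<Rightarrow> nat) \<Rightarrow> bool" where
  "joined X l \<longleftrightarrow> (\<forall>u<n. l u < n \<and> l (l u) = l u) \<and> (\<forall>u<n. \<forall>v<n. l u = l v \<longleftrightarrow> (u, v) \<in> (X \<union> X\<inverse>)\<^sup>*)"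

lemma joined_empty: "joined {} id"
  by (simp add: joined_def)

lemma joined_insert:
  assumes l: "joined X l" and X: "X \<subseteq> {..<n} \<times> {..<n}" and uv: "u < n" "v < n"
  shows "joined (insert (u, v) X) (\<lambda>x. if l x = l u then l v else l x)"
proof -
  let ?l = "\<lambda>x. if l x = l u then l v else l x"
  let ?R = "(X \<union> X\<inverse>)\<^sup>*" and ?R' = "(insert (u, v) X \<union> (insert (u, v) X)\<inverse>)\<^sup>*"
  have l1: "l x < n" "l (l x) = l x" if "x < n" for x using l that by (auto simp: joined_def)
  have l2: "l x = l y \<longleftrightarrow> (x, y) \<in> ?R" if "x < n" "y < n" for x y using l that by (auto simp: joined_def)
  have mono: "?R \<subseteq> ?R'" by (rule rtrancl_mono) auto
  have uv': "(u, v) \<in> ?R'" "(v, u) \<in> ?R'" by auto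
  have "?l x = ?l y \<longleftrightarrow> (x, y) \<in> ?R'" if xy: "x < n" "y < n" for x y
  proof
    assume eq: "?l x = ?l y"
    consider "l x = l y" | "l x = l u" "l y = l v" | "l x = l v" "l y = l u"
      using eq by (auto split: if_splits)
    then show "(x, y) \<in> ?R'"
    proof cases
      case 1
      then show ?thesis using l2[OF xy] mono by blast
    next
      case 2
      then have "(x, u) \<in> ?R'" "(v, y) \<in> ?R'" using l2[of x u] l2[of v y] xy uv mono by auto
      then show ?thesis using uv'(1) by (meson rtrancl_trans)
    next
      case 3
      then have "(x, v) \<in> ?R'" "(u, y) \<in> ?R'" using l2[of x v] l2[of u y] xy uv mono by auto
      then show ?thesis using uv'(2) by (meson rtrancl_trans)
    qed
  next
    assume "(x, y) \<in> ?R'"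
    then show "?l x = ?l y"
    proof induction
      case (step y z)
      have yz: "y < n" "z < n" "(y, z) \<in> X \<union> X\<inverse> \<or> (y, z) = (u, v) \<or> (y, z) = (v, u)"
        using step.hyps(2) X uv by auto
      then have "l y = l z \<or> (y, z) = (u, v) \<or> (y, z) = (v, u)" using l2[of y z] by blast
      then have "?l y = ?l z" by auto
      then show ?case using step.IH by simp
    qed simp
  qed
  moreover have "?l x < n \<and> ?l (?l x) = ?l x" if "x < n" for x
    using l1[OF that] l1[OF uv(1)] l1[OF uv(2)] by auto
  ultimately show ?thesis unfolding joined_def by blast
qed

definition scanned :: "nat \<Rightarrow> nat \<Rightarrow> (nat \<times> nat) set" where
  "scanned i j = {(p, q) \<in> A. p < i \<or> p = i \<and> q < j}"

definition labelled :: "nat \<Rightarrow> nat \<Rightarrow> ram_state \<Rightarrow> bool" where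
  "labelled i j s \<longleftrightarrow> base s \<and> clear s \<and> (\<exists>l. joined (scanned i j) l \<and> (\<forall>u<n. arr s ''lab'' u = int (l u)))"

lemma labelled_cong:
  assumes "labelled i j s" "var s' ''n'' = var s ''n''" "var s' ''k'' = var s ''k''" "arr s' = arr s"
  shows "labelled i j s'"
  using assms base_cong[of s s'] by (simp add: labelled_def clear_def)

lemma arcs_subset: "A \<subseteq> {..<n} \<times> {..<n}"
proof -
  interpret pair_digraph "graph I" using valid by (simp add: valid_input_def)
  have V: "pverts (graph I) = {..<n}" using valid order by (simp add: valid_input_def)
  have "u < n \<and> v < n" if "(u, v) \<in> A" for u v
    using in_arcsD1[OF that] in_arcsD2[OF that] V by blast
  then show ?thesis by auto
qed

lemma relabel_runs:
  assumes b: "base s" "clear s" and lab: "\<And>x. x < n \<Longrightarrow> arr s ''lab'' x = int (l x)" and l: "\<And>x. x < n \<Longrightarrow> l x < n"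
    and ab: "var s ''a'' = int a" "var s ''b'' = int b" "a < n" "b < n"
    and uv: "var s ''u'' = int i" "var s ''v'' = int j"
  shows "runs W relabel_prog s (n * 20 + 5) (\<lambda>s'. base s' \<and> clear s' \<and> var s' ''u'' = int i \<and> var s' ''v'' = int j \<and>
    (\<forall>x<n. arr s' ''lab'' x = int (if l x = a then b else l x)))"
proof -
  let ?P = "\<lambda>w s'. base s' \<and> clear s' \<and> var s' ''u'' = int i \<and> var s' ''v'' = int j \<and> var s' ''a'' = int a \<and> var s' ''b'' = int b \<and>
    (\<forall>x<n. arr s' ''lab'' x = int (if x < w \<and> l x = a then b else l x))"
  show ?thesis
    unfolding relabel_prog_def
  proof (rule runs_For[where P = ?P and C = 13])
    show "var s ''n'' = int n" using b by (simp add: base_def input_ok_def)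
    show "?P 0 (s\<lparr>var := (var s)(''w'' := 0)\<rparr>)"
      using assms by (auto simp: clear_def intro: base_cong)
    fix w s assume w: "w < n" "var s ''w'' = int w" "var s ''n'' = int n" and P: "?P w s"
    have lw: "arr s ''lab'' w = int (l w)" using P w by simp
    show "runs W (Cond (Equal (Get ''lab'' (Var ''w'')) (Var ''a'')) (Put ''lab'' (Var ''w'') (Var ''b'')) Skip) s 13
      (\<lambda>s'. var s' ''w'' = int w \<and> var s' ''n'' = int n \<and> ?P (Suc w) (s'\<lparr>var := (var s')(''w'' := 1 + int w)\<rparr>))"
    proof (rule runs_wp)
      have bs: "base s'" if "var s' ''n'' = var s ''n''" "var s' ''k'' = var s ''k''"
         "arr s' ''adj'' = arr s ''adj''" "arr s' ''delta'' = arr s ''delta''" "arr s' ''C'' = arr s ''C''" "arr s' ''T'' = arr s ''T''" for s'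
        using base_cong[OF conjunct1[OF P] that] .
      show "wp W (Cond (Equal (Get ''lab'' (Var ''w'')) (Var ''a'')) (Put ''lab'' (Var ''w'') (Var ''b'')) Skip)
        (\<lambda>s'. var s' ''w'' = int w \<and> var s' ''n'' = int n \<and> ?P (Suc w) (s'\<lparr>var := (var s')(''w'' := 1 + int w)\<rparr>)) s"
        using P size_safe w ab l[OF w(1)]
        by (auto simp: lw clear_def less_Suc_eq intro: bs)
    qed simp
  qed (use size_safe in auto)
qed

lemma merge_step:
  assumes ij: "i < n" "j < n" and s: "labelled i j s" "var s ''u'' = int i" "var s ''v'' = int j"
  shows "runs W merge_cell
    s (n * 20 + 30) (\<lambda>s'. labelled i (Suc j) s' \<and> var s' ''u'' = int i \<and> var s' ''v'' = int j)"
proof -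
  have b: "base s" "clear s" using s by (simp_all add: labelled_def)
  obtain l where l: "joined (scanned i j) l" "\<And>x. x < n \<Longrightarrow> arr s ''lab'' x = int (l x)" using s by (auto simp: labelled_def)
  have ln: "l x < n" if "x < n" for x using l(1) that by (simp add: joined_def)
  have nn: "var s ''n'' = int n" and adj: "arr s ''adj'' (i * n + j) = incidence A i j"
    using b ij by (auto simp: base_def input_ok_def)
  note safe = index_safe[OF ij] W Z1 size_safe
  have suc: "scanned i (Suc j) = (if (i, j) \<in> A then insert (i, j) (scanned i j) else scanned i j)"
    by (auto simp: scanned_def less_Suc_eq)
  show ?thesis
    unfolding merge_cell_def
  proof (rule runs_Cond[where ?B1.0 = "n * 20 + 20"])
    show "bsafe W (Equal (Get ''adj'' (idx ''u'' ''v'')) (Num 1)) s"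
      using safe incidence_range[of i j] by (simp add: s nn nat_index adj)
    show "bcost (Equal (Get ''adj'' (idx ''u'' ''v'')) (Num 1)) + (n * 20 + 20) \<le> n * 20 + 30" by simp
  next
    assume "bval (Equal (Get ''adj'' (idx ''u'' ''v'')) (Num 1)) s"
    then have arc: "(i, j) \<in> A" by (simp add: s nn nat_index adj incidence_def split: if_splits)
    show "runs W (Seq (Seq (Assign ''a'' (Get ''lab'' (Var ''u''))) (Assign ''b'' (Get ''lab'' (Var ''v'')))) relabel_prog) s (n * 20 + 20)
      (\<lambda>s'. labelled i (Suc j) s' \<and> var s' ''u'' = int i \<and> var s' ''v'' = int j)"
    proof (rule runs_Seq[where R = "\<lambda>s'. s' = s\<lparr>var := (var s)(''a'' := int (l i), ''b'' := int (l j))\<rparr>" and ?B1.0 = 10])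
      show "runs W (Seq (Assign ''a'' (Get ''lab'' (Var ''u''))) (Assign ''b'' (Get ''lab'' (Var ''v'')))) s 10
        (\<lambda>s'. s' = s\<lparr>var := (var s)(''a'' := int (l i), ''b'' := int (l j))\<rparr>)"
        using safe ln[OF ij(1)] ln[OF ij(2)] by (intro runs_wp) (simp_all add: s l(2) ij)
      fix s1 assume s1: "s1 = s\<lparr>var := (var s)(''a'' := int (l i), ''b'' := int (l j))\<rparr>"
      have b1: "base s1" using b(1) by (rule base_cong) (simp_all add: s1)
      have "runs W relabel_prog s1 (n * 20 + 5) (\<lambda>s'. base s' \<and> clear s' \<and> var s' ''u'' = int i \<and> var s' ''v'' = int j \<and>
        (\<forall>x<n. arr s' ''lab'' x = int (if l x = l i then l j else l x)))"
        by (rule relabel_runs[OF b1]) (use b l(2) ln ij s in \<open>simp_all add: s1 clear_def\<close>)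
      then show "runs W relabel_prog s1 (n * 20 + 10) (\<lambda>s'. labelled i (Suc j) s' \<and> var s' ''u'' = int i \<and> var s' ''v'' = int j)"
      proof (rule runs_weaken)
        fix s' assume "base s' \<and> clear s' \<and> var s' ''u'' = int i \<and> var s' ''v'' = int j \<and>
          (\<forall>x<n. arr s' ''lab'' x = int (if l x = l i then l j else l x))"
        moreover have "joined (scanned i (Suc j)) (\<lambda>x. if l x = l i then l j else l x)"
          using joined_insert[OF l(1) _ ij] arcs_subset arc suc by (auto simp: scanned_def)
        ultimately show "labelled i (Suc j) s' \<and> var s' ''u'' = int i \<and> var s' ''v'' = int j"
          unfolding labelled_def by blast
      qed simp
    qed simp
  next
    assume "\<not> bval (Equal (Get ''adj'' (idx ''u'' ''v'')) (Num 1)) s"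
    then have arc: "(i, j) \<notin> A" by (simp add: s nn nat_index adj incidence_def split: if_splits)
    show "runs W Skip s (n * 20 + 20) (\<lambda>s'. labelled i (Suc j) s' \<and> var s' ''u'' = int i \<and> var s' ''v'' = int j)"
      using s arc suc by (intro runs_wp) (simp_all add: labelled_def)
  qed
qed

text \<open>Rewriting all labels takes linear time for each of at most \<open>n^2\<close> arcs. This
  stays within the cubic bound, so a faster union structure would gain nothing.\<close>

lemma merge_runs:
  assumes b: "base s" "clear s" "\<forall>u<n. arr s ''lab'' u = int u"
  shows "runs W merge_prog s (n * (n * (n * 20 + 37) + 12) + 5)
    (\<lambda>s. base s \<and> clear s \<and> (\<exists>l. joined A l \<and> (\<forall>u<n. arr s ''lab'' u = int (l u))))"
  unfolding merge_prog_def
proof (rule runs_For[where P = "\<lambda>i. labelled i 0" and C = "n * (n * 20 + 37) + 5"])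
  show "var s ''n'' = int n" using b by (simp add: base_def input_ok_def)
  have "base (s\<lparr>var := (var s)(''u'' := 0)\<rparr>)" using b(1) by (rule base_cong) simp_all
  moreover have "scanned 0 0 = {}" by (simp add: scanned_def)
  ultimately show "labelled 0 0 (s\<lparr>var := (var s)(''u'' := 0)\<rparr>)"
    using b(2,3) joined_empty unfolding labelled_def by (intro conjI exI[of _ id]) (simp_all add: clear_def)
  have "scanned n 0 = A" using arcs_subset by (auto simp: scanned_def)
  then show "base s \<and> clear s \<and> (\<exists>l. joined A l \<and> (\<forall>u<n. arr s ''lab'' u = int (l u)))" if "labelled n 0 s" for s
    using that by (simp add: labelled_def)
next
  fix i s assume i: "i < n" "var s ''u'' = int i" "var s ''n'' = int n" "labelled i 0 s"
  show "runs W (For ''v'' merge_cell) s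
     (n * (n * 20 + 37) + 5) (\<lambda>s'. var s' ''u'' = int i \<and> var s' ''n'' = int n \<and> labelled (Suc i) 0 (s'\<lparr>var := (var s')(''u'' := 1 + int i)\<rparr>))"
  proof (rule runs_For[where P = "\<lambda>j s. labelled i j s \<and> var s ''u'' = int i" and C = "n * 20 + 30"])
    show "labelled i 0 (s\<lparr>var := (var s)(''v'' := 0)\<rparr>) \<and> var (s\<lparr>var := (var s)(''v'' := 0)\<rparr>) ''u'' = int i"
      using i labelled_cong[of i 0 s "s\<lparr>var := (var s)(''v'' := 0)\<rparr>"] by simp
    fix j s assume j: "j < n" "var s ''v'' = int j" "var s ''n'' = int n" "labelled i j s \<and> var s ''u'' = int i"
    show "runs W merge_cell s (n * 20 + 30)
     (\<lambda>s'. var s' ''v'' = int j \<and> var s' ''n'' = int n \<and> labelled i (Suc j) (s'\<lparr>var := (var s')(''v'' := 1 + int j)\<rparr>) \<and>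
       var (s'\<lparr>var := (var s')(''v'' := 1 + int j)\<rparr>) ''u'' = int i)"
    proof (rule runs_weaken[OF merge_step[OF i(1) j(1) conjunct1[OF j(4)] conjunct2[OF j(4)] j(2)] order.refl])
      fix s' assume s': "labelled i (Suc j) s' \<and> var s' ''u'' = int i \<and> var s' ''v'' = int j"
      have "labelled i (Suc j) (s'\<lparr>var := (var s')(''v'' := 1 + int j)\<rparr>)"
        using labelled_cong[OF conjunct1[OF s'], of "s'\<lparr>var := (var s')(''v'' := 1 + int j)\<rparr>"] by simp
      moreover have "var s' ''n'' = int n" using s' unfolding labelled_def base_def input_ok_def by blast
      ultimately show "var s' ''v'' = int j \<and> var s' ''n'' = int n \<and> labelled i (Suc j) (s'\<lparr>var := (var s')(''v'' := 1 + int j)\<rparr>) \<and>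
       var (s'\<lparr>var := (var s')(''v'' := 1 + int j)\<rparr>) ''u'' = int i"
        using s' by simp
    qed
  next
    fix s assume n: "var s ''n'' = int n" "labelled i n s \<and> var s ''u'' = int i"
    have "scanned i n = scanned (Suc i) 0" using arcs_subset by (auto simp: scanned_def less_Suc_eq)
    then have "labelled (Suc i) 0 s" using n by (simp add: labelled_def)
    then show "var s ''u'' = int i \<and> var s ''n'' = int n \<and> labelled (Suc i) 0 (s\<lparr>var := (var s)(''u'' := 1 + int i)\<rparr>)"
      using n labelled_cong[of "Suc i" 0 s "s\<lparr>var := (var s)(''u'' := 1 + int i)\<rparr>"] by simp
  qed (use i size_safe in auto)
qed (use size_safe in auto)

end

section \<open>Counting components and demand\<close>

definition mark_cell :: com where
  "mark_cell = Cond (Equal (Get ''T'' (Var ''u'')) (Num 0)) Skip (Put ''seen'' (Get ''lab'' (Var ''u'')) (Num 1))"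

text \<open>\<open>p\<close> counts the components and \<open>z\<close> the unmarked ones among
  them, each once at the vertex that is its own label; \<open>q\<close> is the sum of the needs,
  which must vanish for a flow to exist, and \<open>D\<close> the demand.\<close>

definition count_cell :: com where
  "count_cell = Seq (Cond (Equal (Get ''lab'' (Var ''u'')) (Var ''u''))
       (Seq (Assign ''p'' (Plus (Var ''p'') (Num 1)))
         (Cond (Equal (Get ''seen'' (Var ''u'')) (Num 0)) (Assign ''z'' (Plus (Var ''z'') (Num 1))) Skip))
       Skip)
     (Seq (Assign ''q'' (Plus (Var ''q'') (Get ''T'' (Var ''u''))))
       (Cond (Less (Num 0) (Get ''T'' (Var ''u''))) (Assign ''D'' (Plus (Var ''D'') (Get ''T'' (Var ''u'')))) Skip))"

definition count_prog :: com where
  "count_prog = Seq (For ''u'' mark_cell)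
     (Seq (Seq (Assign ''p'' (Num 0)) (Seq (Assign ''z'' (Num 0)) (Seq (Assign ''q'' (Num 0)) (Assign ''D'' (Num 0)))))
       (For ''u'' count_cell))"

context ram_input begin

definition marked :: "(nat \<Rightarrow> nat) \<Rightarrow> nat \<Rightarrow> ram_state \<Rightarrow> bool" where
  "marked l i s \<longleftrightarrow> base s \<and> (\<forall>u<n. arr s ''d'' u = 0 \<and> arr s ''lab'' u = int (l u) \<and>
     arr s ''seen'' u = of_bool (\<exists>w<i. need I w \<noteq> 0 \<and> l w = u))"

definition counted :: "(nat \<Rightarrow> nat) \<Rightarrow> nat \<Rightarrow> ram_state \<Rightarrow> bool" where
  "counted l i s \<longleftrightarrow> marked l n s \<and> var s ''p'' = (\<Sum>u<i. of_bool (l u = u)) \<and>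
     var s ''z'' = (\<Sum>u<i. of_bool (l u = u \<and> \<not> (\<exists>w<n. need I w \<noteq> 0 \<and> l w = u))) \<and>
     var s ''q'' = (\<Sum>u<i. need I u) \<and> var s ''D'' = (\<Sum>u<i. max (need I u) 0)"

lemma marked_cong:
  assumes "marked l i s" "var s' ''n'' = var s ''n''" "var s' ''k'' = var s ''k''" "arr s' = arr s"
  shows "marked l i s'"
  using assms base_cong[of s s'] by (simp add: marked_def)

lemma marked_step:
  assumes m: "marked l i s" and i: "need I i \<noteq> 0"
    and s': "var s' ''n'' = var s ''n''" "var s' ''k'' = var s ''k''"
      "arr s' ''adj'' = arr s ''adj''" "arr s' ''delta'' = arr s ''delta''" "arr s' ''C'' = arr s ''C''" "arr s' ''T'' = arr s ''T''"
      "arr s' ''d'' = arr s ''d''" "arr s' ''lab'' = arr s ''lab''" "arr s' ''seen'' = (arr s ''seen'')(l i := 1)"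
  shows "marked l (Suc i) s'"
  using m i s' base_cong[OF _ s'(1-6)] by (auto simp: marked_def less_Suc_eq of_bool_def)

lemma mark_runs:
  assumes s: "base s" "clear s" "\<forall>u<n. arr s ''lab'' u = int (l u)" and l: "\<And>u. u < n \<Longrightarrow> l u < n"
  shows "runs W (For ''u'' mark_cell) s (n * 27 + 5) (marked l n)"
proof (rule runs_For_stable[where P = "marked l" and C = 20])
  show "var s ''n'' = int n" using s by (simp add: base_def input_ok_def)
  show "marked l 0 s" using s by (simp add: marked_def clear_def)
  show "marked l i (s\<lparr>var := (var s)(''u'' := a)\<rparr>)" if "marked l i s" for i s a
    using that by (rule marked_cong) simp_all
  fix i s assume i: "i < n" and u: "var s ''u'' = int i" and nn: "var s ''n'' = int n" and m: "marked l i s"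
  have T: "arr s ''T'' i = need I i" and li: "arr s ''lab'' i = int (l i)"
    using m i by (simp_all add: marked_def base_def)
  note safe = index_safe[OF i i] l[OF i] Zneed[OF i] size_safe W Z1
  show "runs W mark_cell s 20 (\<lambda>s'. var s' ''u'' = int i \<and> var s' ''n'' = int n \<and> marked l (Suc i) s')"
  proof (cases "need I i = 0")
    case True
    then have "marked l (Suc i) s" using m by (auto simp: marked_def less_Suc_eq)
    then show ?thesis using safe True unfolding mark_cell_def
      by (intro runs_wp) (simp_all add: u nn T)
  next
    case False
    show ?thesis using safe unfolding mark_cell_def
      apply (intro runs_wp)
       apply (simp_all add: u nn T li False)
      apply (rule marked_step[OF m False]; simp)
      done
  qed
qed (use size_safe in auto)

lemma partial_sum_bound:
  assumes "i \<le> n"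
  shows "\<bar>\<Sum>u<i. need I u\<bar> \<le> Z" "0 \<le> (\<Sum>u<i. max (need I u) 0)" "(\<Sum>u<i. max (need I u) 0) \<le> Z"
    "0 \<le> (\<Sum>u<i. of_bool (P u)::int)" "(\<Sum>u<i. of_bool (P u)::int) \<le> int n"
proof -
  have le: "(\<Sum>u<i. \<bar>need I u\<bar>) \<le> (\<Sum>u<n. \<bar>need I u\<bar>)" using assms by (intro sum_mono2) auto
  have "\<bar>\<Sum>u<i. need I u\<bar> \<le> (\<Sum>u<i. \<bar>need I u\<bar>)" by (rule sum_abs)
  then show "\<bar>\<Sum>u<i. need I u\<bar> \<le> Z" using le Zsum by linarith
  have "(\<Sum>u<i. max (need I u) 0) \<le> (\<Sum>u<i. \<bar>need I u\<bar>)" by (intro sum_mono) auto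
  then show "(\<Sum>u<i. max (need I u) 0) \<le> Z" using le Zsum by linarith
  show "0 \<le> (\<Sum>u<i. max (need I u) 0)" by (intro sum_nonneg) auto
  show "0 \<le> (\<Sum>u<i. of_bool (P u)::int)" by (intro sum_nonneg) auto
  have "(\<Sum>u<i. of_bool (P u)::int) \<le> (\<Sum>u<i. 1)" by (intro sum_mono) auto
  then show "(\<Sum>u<i. of_bool (P u)::int) \<le> int n" using assms by simp
qed

lemma count_runs:
  assumes s: "base s" "clear s" "\<forall>u<n. arr s ''lab'' u = int (l u)" and l: "\<And>u. u < n \<Longrightarrow> l u < n"
  shows "runs W count_prog s (n * 100 + 18) (counted l n)"
  unfolding count_prog_def
proof (rule runs_Seq[OF mark_runs[OF assms]])
  fix s assume m: "marked l n s"
  show "runs W (Seq (Seq (Assign ''p'' (Num 0)) (Seq (Assign ''z'' (Num 0)) (Seq (Assign ''q'' (Num 0)) (Assign ''D'' (Num 0)))))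
       (For ''u'' count_cell)) s (n * 60 + 13) (counted l n)"
  proof (rule runs_Seq[where R = "counted l 0" and ?B1.0 = 8])
    have "counted l 0 (s\<lparr>var := (var s)(''p'' := 0, ''z'' := 0, ''q'' := 0, ''D'' := 0)\<rparr>)"
      using marked_cong[OF m, of "s\<lparr>var := (var s)(''p'' := 0, ''z'' := 0, ''q'' := 0, ''D'' := 0)\<rparr>"]
      by (simp add: counted_def)
    then show "runs W (Seq (Assign ''p'' (Num 0)) (Seq (Assign ''z'' (Num 0)) (Seq (Assign ''q'' (Num 0)) (Assign ''D'' (Num 0))))) s 8 (counted l 0)"
      using W Z1 by (intro runs_wp) simp_all
    fix s assume c: "counted l 0 s"
    show "runs W (For ''u'' count_cell) s (n * 57 + 5) (counted l n)"
    proof (rule runs_For_stable[where P = "counted l" and C = 50])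
      show "var s ''n'' = int n" using c by (simp add: counted_def marked_def base_def input_ok_def)
      show "counted l i (s\<lparr>var := (var s)(''u'' := a)\<rparr>)" if "counted l i s" for i s a
        using that marked_cong[of l n s "s\<lparr>var := (var s)(''u'' := a)\<rparr>"] by (simp add: counted_def)
      fix i s assume i: "i < n" and u: "var s ''u'' = int i" and nn: "var s ''n'' = int n" and c: "counted l i s"
      define seen where "seen \<longleftrightarrow> (\<exists>w<n. need I w \<noteq> 0 \<and> l w = i)"
      define p z q D t where "p = var s ''p''" and "z = var s ''z''" and "q = var s ''q''" and "D = var s ''D''"
        and "t = need I i"
      have v: "arr s ''T'' i = t" "arr s ''lab'' i = int (l i)" "arr s ''seen'' i = of_bool seen"
        using c i by (simp_all add: counted_def marked_def base_def seen_def t_def)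
      have "\<bar>q\<bar> \<le> Z" "0 \<le> D" "D \<le> Z" "0 \<le> p" "p \<le> int n" "0 \<le> z" "z \<le> int n"
        using c partial_sum_bound[OF less_imp_le[OF i]] by (simp_all add: counted_def p_def z_def q_def D_def)
      moreover have "\<bar>t\<bar> \<le> Z" using Zneed[OF i] by (simp add: t_def)
      moreover note safe = index_safe[OF i i] l[OF i] size_safe W Z1
      moreover have "counted l (Suc i) s'" if "arr s' = arr s" "var s' ''n'' = var s ''n''" "var s' ''k'' = var s ''k''"
        "var s' ''p'' = p + of_bool (l i = i)" "var s' ''z'' = z + of_bool (l i = i \<and> \<not> seen)"
        "var s' ''q'' = q + t" "var s' ''D'' = D + max t 0" for s'
        using c marked_cong[of l n s s'] that
        by (simp add: counted_def seen_def p_def z_def q_def D_def t_def)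
      note fin = this
      ultimately show "runs W count_cell s 50 (\<lambda>s'. var s' ''u'' = int i \<and> var s' ''n'' = int n \<and> counted l (Suc i) s')"
        unfolding count_cell_def
        apply (intro runs_wp)
         apply (cases "l i = i"; cases seen; cases "0 < t")
                apply (simp_all add: u nn v p_def[symmetric] z_def[symmetric] q_def[symmetric] D_def[symmetric])
        done
    qed (use c size_safe in auto)
  qed simp
next
  show "n * 27 + 5 + (n * 60 + 13) \<le> n * 100 + 18" by arith
qed

lemma sum_of_bool: "(\<Sum>u<n. of_bool (P u) :: int) = int (card {u. u < n \<and> P u})"
  by (simp add: Int_def)

end

section \<open>A single step of the push procedure in the program\<close>

definition move_prog :: com where
  "move_prog = Seq (Put ''ex'' (Var ''v'') (Minus (Get ''ex'' (Var ''v'')) (Num 1)))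
     (Seq (Put ''ex'' (Var ''w'') (Plus (Get ''ex'' (Var ''w'')) (Num 1))) (Assign ''v'' (Var ''w'')))"

definition scan_prog :: com where
  "scan_prog = Seq (Seq (Assign ''i'' (idx ''v'' ''w'')) (Assign ''j'' (idx ''w'' ''v'')))
     (Cond (Conj (Less (Num 0) (Get ''F'' (Var ''j''))) (Less (Minus (Get ''d'' (Var ''w'')) (Var ''K'')) (Get ''d'' (Var ''v''))))
        (Seq (Put ''F'' (Var ''j'') (Minus (Get ''F'' (Var ''j'')) (Num 1))) move_prog)
     (Cond (Conj (Less (Get ''F'' (Var ''i'')) (Get ''C'' (Var ''i''))) (Less (Plus (Get ''d'' (Var ''w'')) (Var ''K'')) (Get ''d'' (Var ''v''))))
        (Seq (Put ''F'' (Var ''i'') (Plus (Get ''F'' (Var ''i'')) (Num 1))) move_prog)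
        (Put ''cu'' (Var ''v'') (Plus (Var ''w'') (Num 1)))))"

definition lift_prog :: com where
  "lift_prog = Cond (Less (Get ''g'' (Var ''v'')) (Plus (Times (Num 3) (Var ''n'')) (Num 3)))
     (Seq (Put ''d'' (Var ''v'') (Plus (Get ''d'' (Var ''v'')) (Num 1)))
       (Seq (Put ''g'' (Var ''v'') (Plus (Get ''g'' (Var ''v'')) (Num 1))) (Put ''cu'' (Var ''v'') (Num 0))))
     (Seq (Assign ''fail'' (Num 1)) (Assign ''s'' (Var ''n'')))"

definition step_prog :: com where
  "step_prog = Cond (Less (Num 0) (Get ''ex'' (Var ''v'')))
     (Seq (Assign ''w'' (Get ''cu'' (Var ''v''))) (Cond (Equal (Var ''w'') (Var ''n'')) lift_prog scan_prog))
     (Seq (Cond (Less (Num 0) (Get ''ex'' (Var ''s''))) Skip (Assign ''s'' (Plus (Var ''s'') (Num 1)))) (Assign ''v'' (Var ''s'')))"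

lemmas step_prog_defs = step_prog_def lift_prog_def scan_prog_def move_prog_def

context ram_input begin

sublocale push_relabel n cap "need I"
  by standard (simp_all add: capacity_def)

definition kept :: "int \<times> int \<times> int \<times> int \<times> int \<Rightarrow> ram_state \<Rightarrow> bool" where
  "kept c s \<longleftrightarrow> base s \<and> (var s ''p'', var s ''z'', var s ''q'', var s ''D'', var s ''r'') = c"

definition represents :: "int \<Rightarrow> push_state \<Rightarrow> ram_state \<Rightarrow> bool" where
  "represents K a s \<longleftrightarrow> (\<forall>u<n. \<forall>v<n. arr s ''F'' (u * n + v) = fl a u v) \<and>
     (\<forall>u<n. arr s ''d'' u = lb a u \<and> arr s ''g'' u = int (rl a u) \<and> arr s ''cu'' u = int (cu a u) \<and> arr s ''ex'' u = ex a u) \<and>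
     var s ''s'' = int (src a) \<and> var s ''v'' = int (pos a) \<and> var s ''fail'' = of_bool (failed a) \<and> var s ''K'' = K"

lemma kept_cong:
  assumes "kept c s" "var s' ''n'' = var s ''n''" "var s' ''k'' = var s ''k''"
    "arr s' ''adj'' = arr s ''adj''" "arr s' ''delta'' = arr s ''delta''" "arr s' ''C'' = arr s ''C''" "arr s' ''T'' = arr s ''T''"
    "var s' ''p'' = var s ''p''" "var s' ''z'' = var s ''z''" "var s' ''q'' = var s ''q''" "var s' ''D'' = var s ''D''" "var s' ''r'' = var s ''r''"
  shows "kept c s'"
  using assms base_cong[of s s'] by (simp add: kept_def)

text \<open>A scale adds at most \<open>limit = 3 * n + 3\<close> to a label and then doubles it:
  \<open>2 * ((6 * n + 6) * (K - 1) + 3 * n + 3) = (6 * n + 6) * (2 * K - 1)\<close>. This is the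
  origin of the factor and keeps labels polynomial in \<open>n\<close>, although they are never
  reset between scales.\<close>

definition low :: "int \<Rightarrow> (nat \<Rightarrow> int) \<Rightarrow> bool" where
  "low K d \<longleftrightarrow> (\<forall>u<n. 0 \<le> d u \<and> d u \<le> (6 * int n + 6) * (K - 1))"

lemma scale_bounds:
  assumes "0 < K" "K \<le> 16 * int n * int n + 16"
  shows "(6 * int n + 6) * K \<le> Z" "K \<le> Z" "6 * int n + 6 \<le> Z"
proof -
  have "(6 * int n + 6) * K \<le> (6 * int n + 6) * (16 * int n * int n + 16)"
    using assms by (intro mult_left_mono) auto
  then show 1: "(6 * int n + 6) * K \<le> Z" using Zlimit by linarith
  have "1 * K \<le> (6 * int n + 6) * K" using assms by (intro mult_right_mono) auto
  then show "K \<le> Z" using 1 by linarith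
  have "(6 * int n + 6) * 1 \<le> (6 * int n + 6) * K" using assms by (intro mult_left_mono) auto
  then show "6 * int n + 6 \<le> Z" using order_trans[OF _ 1] by simp
qed

lemma flow_sum_bound:
  assumes "\<And>u v. u < n \<Longrightarrow> v < n \<Longrightarrow> 0 \<le> F u v \<and> F u v \<le> cap u v" "u < n"
  shows "0 \<le> out_flow n F u" "out_flow n F u \<le> 2 * int n" "0 \<le> in_flow n F u" "in_flow n F u \<le> 2 * int n"
proof -
  have F: "0 \<le> F u v \<and> F u v \<le> 2" if "u < n" "v < n" for u v
    using assms(1)[OF that] c_bound(2)[of u v] by linarith
  show "0 \<le> out_flow n F u" "0 \<le> in_flow n F u"
    unfolding out_flow_def in_flow_def using F assms(2) by (auto intro!: sum_nonneg)
  have "out_flow n F u \<le> (\<Sum>v<n. 2)" "in_flow n F u \<le> (\<Sum>v<n. 2)"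
    unfolding out_flow_def in_flow_def by (intro sum_mono; simp add: F assms(2))+
  then show "out_flow n F u \<le> 2 * int n" "in_flow n F u \<le> 2 * int n" by simp_all
qed

lemma core_safe:
  assumes a: "core K d a" and d: "low K d" and K: "0 < K" "K \<le> 16 * int n * int n + 16" and u: "u < n"
  shows "0 \<le> lb a u" "lb a u \<le> Z" "int (rl a u) \<le> Z" "\<bar>ex a u\<bar> \<le> 3 * Z" "int (cu a u) \<le> int n"
proof -
  note b = scale_bounds[OF K]
  note D = coreD[OF a]
  have rl: "int (rl a u) \<le> 3 * int n + 3" using D(9)[OF u] by (simp add: limit_def)
  have "d u \<le> (6 * int n + 6) * K - (6 * int n + 6)" using d u by (simp add: low_def algebra_simps)
  then show "lb a u \<le> Z" using D(10)[OF u] rl b(1) by linarith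
  show "0 \<le> lb a u" using D(10)[OF u] d u by (simp add: low_def)
  show "int (rl a u) \<le> Z" using rl b(3) by linarith
  show "\<bar>ex a u\<bar> \<le> 3 * Z" using D(3)[OF u] flow_sum_bound[of "fl a", OF _ u] D(1,2) Zneed[OF u] b(3) by force
  show "int (cu a u) \<le> int n" using D(6)[OF u] by simp
qed

lemma represents_push:
  assumes r: "represents K a s" and v: "v < n" "w < n" "v \<noteq> w" and ij: "i < n" "j < n"
    and F: "F = (\<lambda>x y. fl a x y + \<delta> * unit_arc i j x y)"
    and s': "arr s' ''F'' = (arr s ''F'')(i * n + j := fl a i j + \<delta>)"
      "arr s' ''ex'' = (arr s ''ex'')(v := ex a v - 1, w := ex a w + 1)"
      "arr s' ''d'' = arr s ''d''" "arr s' ''g'' = arr s ''g''" "arr s' ''cu'' = arr s ''cu''"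
      "var s' ''s'' = var s ''s''" "var s' ''v'' = int w" "var s' ''fail'' = var s ''fail''" "var s' ''K'' = var s ''K''"
  shows "represents K (a\<lparr>fl := F, ex := move v w (ex a), pos := w\<rparr>) s'"
  using r v ij s' unfolding represents_def
  by (auto simp: F unit_arc_def move_def of_bool_def index_eq_iff)

text \<open>The branches of the program are those of \<open>step\<close>, so only word safety and
  the representation have to be checked; as each takes constant time, the potential becomes a time
  bound.\<close>

lemma step_runs:
  assumes r: "represents K a s" and k: "kept c s" and a: "push_inv K d f a" "src a < n"
    and K: "0 < K" "K \<le> 16 * int n * int n + 16" and d: "low K d"
  shows "runs W step_prog s 100 (\<lambda>s'. represents K (step K a) s' \<and> kept c s')"
proof -
  define v w where "v = pos a" and "w = cu a v"
  have core: "core K d a" and se: "search f a" using a by (auto simp: push_inv_def)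
  have v: "v < n" using se a by (simp add: search_def v_def)
  have w: "w \<le> n" using coreD(6)[OF core v] by (simp add: w_def)
  have sn: "src a < n" by fact
  note cs = core_safe[OF core d K]
  have kn: "var s ''n'' = int n" using k by (simp add: kept_def base_def input_ok_def)
  have rv: "var s ''v'' = int v" "var s ''s'' = int (src a)" "var s ''K'' = K" "var s ''fail'' = of_bool (failed a)"
    "\<And>u. u < n \<Longrightarrow> arr s ''d'' u = lb a u" "\<And>u. u < n \<Longrightarrow> arr s ''g'' u = int (rl a u)"
    "\<And>u. u < n \<Longrightarrow> arr s ''cu'' u = int (cu a u)" "\<And>u. u < n \<Longrightarrow> arr s ''ex'' u = ex a u"
    "\<And>u y. u < n \<Longrightarrow> y < n \<Longrightarrow> arr s ''F'' (u * n + y) = fl a u y"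
    using r by (simp_all add: represents_def v_def)
  have rC: "\<And>u y. u < n \<Longrightarrow> y < n \<Longrightarrow> arr s ''C'' (u * n + y) = cap u y"
    using k by (simp add: kept_def base_def)
  note safe = scale_bounds[OF K] K(1) W Z1 size_safe cs[OF v] cs[OF sn]
  have cw: "cu a v = w" by (simp add: w_def)
  consider (idle) "ex a v \<le> 0" | (lift) "0 < ex a v" "w = n" | (push) "0 < ex a v" "w < n" using w by linarith
  then show ?thesis
  proof cases
    case idle
    show ?thesis
    proof (cases "0 < ex a (src a)")
      case True
      then have st: "step K a = a\<lparr>pos := src a\<rparr>" using idle by (simp add: step_def Let_def v_def)
      show ?thesis
        unfolding step_prog_defs using safe idle True v sn
        apply (intro runs_wp)
         apply (simp_all add: rv)
        apply (use r in \<open>simp add: represents_def st\<close>)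
        apply (rule kept_cong[OF k]; simp)
        done
    next
      case False
      then have st: "step K a = a\<lparr>src := src a + 1, pos := src a + 1\<rparr>" using idle by (simp add: step_def Let_def v_def)
      show ?thesis
        unfolding step_prog_defs using safe idle False v sn
        apply (intro runs_wp)
         apply (simp_all add: rv)
        apply (use r in \<open>simp add: represents_def st\<close>)
        apply (rule kept_cong[OF k]; simp)
        done
    qed
  next
    case lift
    show ?thesis
    proof (cases "rl a v < limit")
      case True
      then have st: "step K a = a\<lparr>lb := (lb a)(v := lb a v + 1), rl := (rl a)(v := rl a v + 1), cu := (cu a)(v := 0)\<rparr>"
        using lift by (simp add: step_def Let_def v_def w_def)
      show ?thesis
        unfolding step_prog_defs using safe lift True v
        apply (intro runs_wp)
         apply (simp_all add: rv kn cw limit_def)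
         apply (use r in \<open>simp add: represents_def st\<close>)
        apply (rule kept_cong[OF k]; simp)
        done
    next
      case False
      then have st: "step K a = a\<lparr>failed := True, src := n\<rparr>"
        using lift by (simp add: step_def Let_def v_def w_def)
      show ?thesis
        unfolding step_prog_defs using safe lift False v
        apply (intro runs_wp)
         apply (simp_all add: rv kn cw limit_def)
        apply (use r in \<open>simp add: represents_def st\<close>)
        apply (rule kept_cong[OF k]; simp)
        done
    qed
  next
    case push
    note D = coreD[OF core]
    define x y where "x = fl a v w" and "y = fl a w v"
    have xy: "0 \<le> x" "x \<le> 2" "0 \<le> y" "y \<le> 2" "0 \<le> cap v w" "cap v w \<le> 2"
      using D(1)[OF v push(2)] D(2)[OF v push(2)] D(1)[OF push(2) v] D(2)[OF push(2) v] c_bound[of v w] c_bound[of w v]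
      by (simp_all add: x_def y_def)
    have F: "arr s ''F'' (v * n + w) = x" "arr s ''F'' (w * n + v) = y"
      using rv(9) v push(2) by (simp_all add: x_def y_def)
    note safe2 = safe xy cs[OF push(2)] index_safe[OF v push(2)] index_safe[OF push(2) v]
    have vw: "v \<noteq> w" if "bwd K a v w \<or> fwd K a v w"
      using that D(1)[OF v v] D(2)[OF v v] c_diag[of v] by (auto simp: bwd_def fwd_def)
    show ?thesis
    proof (cases "bwd K a v w")
      case True
      have b: "0 < y" "lb a w - K < lb a v" using True by (simp_all add: bwd_def y_def)
      have ne: "v \<noteq> w" using True vw by blast
      have st: "step K a = a\<lparr>fl := \<lambda>p q. fl a p q + - 1 * unit_arc w v p q, ex := move v w (ex a), pos := w\<rparr>"
        using push True by (simp add: step_def Let_def v_def w_def)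
      note rp = represents_push[where \<delta> = "- 1", OF r v push(2) ne push(2) v refl, folded st x_def y_def]
      show ?thesis
        unfolding step_prog_defs using safe2 push v b ne
        apply (intro runs_wp)
         apply (simp_all add: rv kn cw rC F nat_index)
        apply (intro conjI; (linarith | (rule kept_cong[OF k]; simp) | (rule rp; simp add: rv)))
        done
    next
      case nb: False
      then have nb': "\<not> (0 < y \<and> lb a w - K < lb a v)" by (simp add: bwd_def y_def)
      show ?thesis
      proof (cases "fwd K a v w")
        case True
        have b: "x < cap v w" "lb a w + K < lb a v" using True by (simp_all add: fwd_def x_def)
        have ne: "v \<noteq> w" using True vw by blast
        have st: "step K a = a\<lparr>fl := \<lambda>p q. fl a p q + 1 * unit_arc v w p q, ex := move v w (ex a), pos := w\<rparr>"
          using push True nb by (simp add: step_def Let_def v_def w_def)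
        note rp = represents_push[where \<delta> = 1, OF r v push(2) ne v push(2) refl, folded st x_def y_def]
        show ?thesis
          unfolding step_prog_defs using safe2 push v b ne nb'
          apply (intro runs_wp)
           apply (cases "0 < y")
            apply (simp_all add: rv kn cw rC F nat_index)
           apply (intro conjI; (linarith | (rule kept_cong[OF k]; simp) | (rule rp; simp add: rv)))+
          done
      next
        case False
        then have nf: "\<not> (x < cap v w \<and> lb a w + K < lb a v)" by (simp add: fwd_def x_def)
        have st: "step K a = a\<lparr>cu := (cu a)(v := w + 1)\<rparr>"
          using push False nb by (simp add: step_def Let_def v_def w_def)
        have fin: "represents K (step K a) s'" if "arr s' ''cu'' = (arr s ''cu'')(v := int w + 1)"
          "arr s' ''F'' = arr s ''F''" "arr s' ''ex'' = arr s ''ex''" "arr s' ''d'' = arr s ''d''" "arr s' ''g'' = arr s ''g''"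
          "var s' ''s'' = var s ''s''" "var s' ''v'' = var s ''v''" "var s' ''fail'' = var s ''fail''" "var s' ''K'' = var s ''K''" for s'
          using r that by (simp add: represents_def st)
        show ?thesis
          unfolding step_prog_defs using safe2 push v nb' nf
          apply (intro runs_wp)
           apply (cases "0 < y"; cases "x < cap v w")
              apply (simp_all add: rv kn cw rC F nat_index)
              apply (intro conjI; (linarith | (rule kept_cong[OF k]; simp) | (rule fin; simp)))+
          done
      qed
    qed
  qed
qed

end

section \<open>One scale and the loop over scales\<close>

definition reset_cell :: com where
  "reset_cell = Seq (Put ''ex'' (Var ''u'') (Get ''T'' (Var ''u''))) (Seq (Put ''g'' (Var ''u'') (Num 0)) (Put ''cu'' (Var ''u'') (Num 0)))"

definition fill_cell :: com where
  "fill_cell = Seq (Assign ''i'' (idx ''u'' ''v''))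
     (Cond (Less (Plus (Get ''d'' (Var ''v'')) (Var ''K'')) (Get ''d'' (Var ''u'')))
       (Seq (Put ''F'' (Var ''i'') (Get ''C'' (Var ''i'')))
         (Seq (Put ''ex'' (Var ''u'') (Minus (Get ''ex'' (Var ''u'')) (Get ''C'' (Var ''i''))))
           (Put ''ex'' (Var ''v'') (Plus (Get ''ex'' (Var ''v'')) (Get ''C'' (Var ''i''))))))
       (Put ''F'' (Var ''i'') (Num 0)))"

definition double_cell :: com where
  "double_cell = Put ''d'' (Var ''u'') (Times (Num 2) (Get ''d'' (Var ''u'')))"

definition push_prog :: com where
  "push_prog = While (Less (Var ''s'') (Var ''n'')) step_prog"

definition next_scale_prog :: com where
  "next_scale_prog = Seq (For ''u'' double_cell)
       (Seq (Assign ''K'' (Plus (Var ''K'') (Var ''K''))) (Assign ''r'' (Plus (Var ''r'') (Num 1))))"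

definition scale_body :: com where
  "scale_body = Seq (For ''u'' reset_cell) (Seq (For ''u'' (For ''v'' fill_cell))
     (Seq (Seq (Assign ''s'' (Num 0)) (Assign ''v'' (Num 0)))
     (Seq push_prog next_scale_prog)))"

text \<open>\<open>K\<close> has been doubled before each later test, so at the end the last flow
  belongs to \<open>K / 2\<close>. Stopping only at \<open>K \<ge> 4 * n^2 + 1\<close> guarantees
  \<open>K / 2 > 2 * n^2\<close>, as required for minimality.\<close>

definition scale_prog :: com where
  "scale_prog = Seq (Seq (Assign ''fail'' (Num 0)) (Seq (Assign ''K'' (Num 1)) (Assign ''r'' (Num 0))))
     (While (Less (Var ''K'') (Plus (Times (Num 4) (Times (Var ''n'') (Var ''n''))) (Num 1))) scale_body)"

definition push_bound :: "nat \<Rightarrow> nat" where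
  "push_bound n = 8 * n ^ 2 + 2 * n * ((3 * n + 3) * (5 * n + 1) + n) + 2 * n + 1"

definition body_bound :: "nat \<Rightarrow> nat" where
  "body_bound n = n * (n * 67 + 60) + push_bound n * 103 + 50"

context ram_input begin

definition scaled :: "int \<times> int \<times> int \<times> int \<times> int \<Rightarrow> int \<Rightarrow> bool \<Rightarrow> (nat \<Rightarrow> int) \<Rightarrow> ram_state \<Rightarrow> bool" where
  "scaled c K f d s \<longleftrightarrow> kept c s \<and> var s ''K'' = K \<and> var s ''fail'' = of_bool f \<and> (\<forall>u<n. arr s ''d'' u = d u)"

lemma scaled_cong:
  assumes "scaled c K f d s" "var s' ''n'' = var s ''n''" "var s' ''k'' = var s ''k''"
    "arr s' ''adj'' = arr s ''adj''" "arr s' ''delta'' = arr s ''delta''" "arr s' ''C'' = arr s ''C''" "arr s' ''T'' = arr s ''T''"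
    "var s' ''p'' = var s ''p''" "var s' ''z'' = var s ''z''" "var s' ''q'' = var s ''q''" "var s' ''D'' = var s ''D''" "var s' ''r'' = var s ''r''"
    "var s' ''K'' = var s ''K''" "var s' ''fail'' = var s ''fail''" "arr s' ''d'' = arr s ''d''"
  shows "scaled c K f d s'"
  using assms kept_cong[of c s s'] by (simp add: scaled_def)

definition reset :: "int \<times> int \<times> int \<times> int \<times> int \<Rightarrow> int \<Rightarrow> bool \<Rightarrow> (nat \<Rightarrow> int) \<Rightarrow> nat \<Rightarrow> ram_state \<Rightarrow> bool" where
  "reset c K f d i s \<longleftrightarrow> scaled c K f d s \<and> (\<forall>u<i. arr s ''ex'' u = need I u \<and> arr s ''g'' u = 0 \<and> arr s ''cu'' u = 0)"

lemma kept_n: "kept c s \<Longrightarrow> var s ''n'' = int n"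
  by (simp add: kept_def base_def input_ok_def)

lemma reset_runs:
  assumes s: "scaled c K f d s"
  shows "runs W (For ''u'' reset_cell) s (n * 27 + 5) (reset c K f d n)"
proof (rule runs_For_stable[where P = "reset c K f d" and C = 20])
  show "var s ''n'' = int n" using s kept_n[of c s] by (simp add: scaled_def)
  show "reset c K f d 0 s" using s by (simp add: reset_def)
  show "reset c K f d i (s\<lparr>var := (var s)(''u'' := a)\<rparr>)" if "reset c K f d i s" for i s a
    using that scaled_cong[of c K f d s "s\<lparr>var := (var s)(''u'' := a)\<rparr>"] by (simp add: reset_def)
  fix i s assume i: "i < n" and u: "var s ''u'' = int i" and nn: "var s ''n'' = int n" and r: "reset c K f d i s"
  have T: "arr s ''T'' i = need I i" using r i by (simp add: reset_def scaled_def kept_def base_def)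
  note safe = index_safe[OF i i] Zneed[OF i] size_safe W Z1
  have fin: "reset c K f d (Suc i) s'" if "s' = s\<lparr>arr := (arr s)(''ex'' := (arr s ''ex'')(i := need I i), ''g'' := (arr s ''g'')(i := 0), ''cu'' := (arr s ''cu'')(i := 0))\<rparr>" for s'
    using r scaled_cong[of c K f d s s'] that by (auto simp: reset_def less_Suc_eq)
  show "runs W reset_cell s 20 (\<lambda>s'. var s' ''u'' = int i \<and> var s' ''n'' = int n \<and> reset c K f d (Suc i) s')"
    using safe unfolding reset_cell_def
    by (intro runs_wp) (simp_all add: u nn T fin)
qed (use size_safe in auto)

definition start_flow :: "int \<Rightarrow> (nat \<Rightarrow> int) \<Rightarrow> nat \<Rightarrow> nat \<Rightarrow> int" where
  "start_flow K d u v = (if d u > d v + K then cap u v else 0)"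

text \<open>The change of the excess at \<open>x\<close> when the pair \<open>(p, q)\<close>
  receives its starting flow; on the diagonal it is 0. \<open>gain\<close> sums it over the pairs
  scanned so far.\<close>

definition shift :: "int \<Rightarrow> (nat \<Rightarrow> int) \<Rightarrow> nat \<Rightarrow> nat \<Rightarrow> nat \<Rightarrow> int" where
  "shift K d p q x = start_flow K d p q * (of_bool (x = q) - of_bool (x = p))"

definition gain :: "int \<Rightarrow> (nat \<Rightarrow> int) \<Rightarrow> nat \<Rightarrow> nat \<Rightarrow> nat \<Rightarrow> int" where
  "gain K d i j x = (\<Sum>p<i. \<Sum>q<n. shift K d p q x) + (\<Sum>q<j. shift K d i q x)"

lemma gain_bound:
  assumes "i < n" "j < n"
  shows "\<bar>gain K d i j x\<bar> \<le> 2 * Z"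
proof -
  have s: "\<bar>shift K d p q x\<bar> \<le> 2" for p q
    using c_bound[of p q] by (auto simp: shift_def start_flow_def of_bool_def)
  have "\<bar>\<Sum>q<m. shift K d p q x\<bar> \<le> 2 * int m" for p m
  proof -
    have "\<bar>\<Sum>q<m. shift K d p q x\<bar> \<le> (\<Sum>q<m. \<bar>shift K d p q x\<bar>)" by (rule sum_abs)
    also have "\<dots> \<le> (\<Sum>q<m. 2)" by (intro sum_mono s)
    finally show ?thesis by simp
  qed
  note row = this
  have "\<bar>\<Sum>p<i. \<Sum>q<n. shift K d p q x\<bar> \<le> (\<Sum>p<i. \<bar>\<Sum>q<n. shift K d p q x\<bar>)" by (rule sum_abs)
  also have "\<dots> \<le> (\<Sum>p<i. 2 * int n)" by (intro sum_mono row)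
  also have "\<dots> = 2 * (int i * int n)" by simp
  finally show ?thesis using row[of i j] index_safe[OF assms] int_index_bounds[OF assms] Zn assms
    unfolding gain_def by linarith
qed

definition filled :: "int \<times> int \<times> int \<times> int \<times> int \<Rightarrow> int \<Rightarrow> bool \<Rightarrow> (nat \<Rightarrow> int) \<Rightarrow> nat \<Rightarrow> nat \<Rightarrow> ram_state \<Rightarrow> bool" where
  "filled c K f d i j s \<longleftrightarrow> scaled c K f d s \<and> (\<forall>u<n. arr s ''g'' u = 0 \<and> arr s ''cu'' u = 0 \<and> arr s ''ex'' u = need I u + gain K d i j u) \<and>
     (\<forall>u<i. \<forall>v<n. arr s ''F'' (u * n + v) = start_flow K d u v) \<and> (\<forall>v<j. arr s ''F'' (i * n + v) = start_flow K d i v)"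

lemma filled_cong:
  assumes "filled c K f d i j s" "arr s' = arr s" "var s' ''n'' = var s ''n''" "var s' ''k'' = var s ''k''"
    "var s' ''p'' = var s ''p''" "var s' ''z'' = var s ''z''" "var s' ''q'' = var s ''q''" "var s' ''D'' = var s ''D''" "var s' ''r'' = var s ''r''"
    "var s' ''K'' = var s ''K''" "var s' ''fail'' = var s ''fail''"
  shows "filled c K f d i j s'"
  using assms scaled_cong[of c K f d s s'] by (simp add: filled_def)

lemma filled_step:
  assumes fi: "filled c K f d i j s" and ij: "i < n" "j < n"
    and s': "arr s' ''F'' = (arr s ''F'')(i * n + j := start_flow K d i j)" "\<And>x. arr s' ''ex'' x = arr s ''ex'' x + shift K d i j x"
      "arr s' ''g'' = arr s ''g''" "arr s' ''cu'' = arr s ''cu''"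
    and keep: "var s' ''n'' = var s ''n''" "var s' ''k'' = var s ''k''"
    "arr s' ''adj'' = arr s ''adj''" "arr s' ''delta'' = arr s ''delta''" "arr s' ''C'' = arr s ''C''" "arr s' ''T'' = arr s ''T''"
    "var s' ''p'' = var s ''p''" "var s' ''z'' = var s ''z''" "var s' ''q'' = var s ''q''" "var s' ''D'' = var s ''D''" "var s' ''r'' = var s ''r''"
    "var s' ''K'' = var s ''K''" "var s' ''fail'' = var s ''fail''" "arr s' ''d'' = arr s ''d''"
  shows "filled c K f d i (Suc j) s'"
proof -
  have "arr s' ''F'' (u * n + v) = arr s ''F'' (u * n + v)" if "v < n" "(u, v) \<noteq> (i, j)" for u v
    using that ij s'(1) by (auto simp: index_eq_iff)
  moreover have "arr s' ''F'' (i * n + j) = start_flow K d i j" using s'(1) by simp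
  moreover have "scaled c K f d s'" using scaled_cong[OF _ keep] fi by (simp add: filled_def)
  ultimately show ?thesis using fi ij s'(2-4) unfolding filled_def
    by (simp add: less_Suc_eq gain_def)
qed

lemma fill_cell_runs:
  assumes fi: "filled c K f d i j s" and ij: "i < n" "j < n" and uv: "var s ''u'' = int i" "var s ''v'' = int j"
    and K: "0 < K" "K \<le> 16 * int n * int n + 16" and d: "low K d"
  shows "runs W fill_cell s 60 (\<lambda>s'. filled c K f d i (Suc j) s' \<and> var s' ''u'' = int i \<and> var s' ''v'' = int j \<and> var s' ''n'' = int n)"
proof -
  have kn: "var s ''n'' = int n" using fi kept_n[of c s] by (simp add: filled_def scaled_def)
  define C where "C = cap i j"
  have r: "var s ''K'' = K" "arr s ''C'' (i * n + j) = C" "arr s ''d'' i = d i" "arr s ''d'' j = d j"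
    using fi ij by (simp_all add: filled_def scaled_def kept_def base_def C_def)
  have ex: "\<bar>arr s ''ex'' u\<bar> \<le> 3 * Z" if "u < n" for u
    using fi that Zneed[OF that] gain_bound[OF ij, of K d u] by (auto simp: filled_def)
  have du: "0 \<le> d u" "d u \<le> Z" if "u < n" for u
  proof -
    have "d u \<le> (6 * int n + 6) * K - (6 * int n + 6)" "0 \<le> d u" using d that by (simp_all add: low_def algebra_simps)
    then show "0 \<le> d u" "d u \<le> Z" using scale_bounds(1)[OF K] by linarith+
  qed
  have C: "0 \<le> C" "C \<le> 2" using c_bound[of i j] by (simp_all add: C_def)
  note safe = scale_bounds[OF K] K(1) W Z1 size_safe index_safe[OF ij] ex[OF ij(1)] ex[OF ij(2)] du[OF ij(1)] du[OF ij(2)] C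
  note fs = filled_step[OF fi ij]
  show ?thesis
  proof (cases "d j + K < d i")
    case True
    \<comment> \<open>As \<open>K\<close> is positive the diagonal is never saturated, so the two
      updates of the excess concern different cells.\<close>
    then have ne: "i \<noteq> j" using K by auto
    have sf: "start_flow K d i j = C" using True by (simp add: start_flow_def C_def)
    show ?thesis
      unfolding fill_cell_def using safe True ne
      apply (intro runs_wp)
       apply (simp_all add: uv kn r nat_index)
      apply (intro conjI; (linarith | (rule fs; simp add: sf shift_def r)))
      done
  next
    case False
    have sf: "start_flow K d i j = 0" using False by (simp add: start_flow_def)
    show ?thesis
      unfolding fill_cell_def using safe False
      apply (intro runs_wp)
       apply (simp_all add: uv kn r nat_index)
      apply (rule fs; simp add: sf shift_def r)
      done
  qed
qed

lemma fill_runs: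
  assumes re: "reset c K f d n s" and K: "0 < K" "K \<le> 16 * int n * int n + 16" and d: "low K d"
  shows "runs W (For ''u'' (For ''v'' fill_cell)) s (n * (n * 67 + 12) + 5) (filled c K f d n 0)"
proof (rule runs_For_stable[where P = "\<lambda>i. filled c K f d i 0" and C = "n * 67 + 5"])
  show "var s ''n'' = int n" using re kept_n[of c s] by (simp add: reset_def scaled_def)
  show "filled c K f d 0 0 s" using re by (simp add: reset_def filled_def gain_def)
  show "filled c K f d i 0 (s\<lparr>var := (var s)(''u'' := a)\<rparr>)" if "filled c K f d i 0 s" for i s a
    using that by (rule filled_cong) simp_all
  fix i s assume i: "i < n" and u: "var s ''u'' = int i" and nn: "var s ''n'' = int n" and fi: "filled c K f d i 0 s"
  show "runs W (For ''v'' fill_cell) s (n * 67 + 5) (\<lambda>s'. var s' ''u'' = int i \<and> var s' ''n'' = int n \<and> filled c K f d (Suc i) 0 s')"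
  proof (rule runs_For_stable[where P = "\<lambda>j s. filled c K f d i j s \<and> var s ''u'' = int i" and C = 60])
    show "filled c K f d i j (s\<lparr>var := (var s)(''v'' := a)\<rparr>) \<and> var (s\<lparr>var := (var s)(''v'' := a)\<rparr>) ''u'' = int i"
      if "filled c K f d i j s \<and> var s ''u'' = int i" for j s a
      using that filled_cong[of c K f d i j s "s\<lparr>var := (var s)(''v'' := a)\<rparr>"] by simp
    show "runs W fill_cell s 60 (\<lambda>s'. var s' ''v'' = int j \<and> var s' ''n'' = int n \<and> filled c K f d i (Suc j) s' \<and> var s' ''u'' = int i)"
      if "j < n" "var s ''v'' = int j" "filled c K f d i j s \<and> var s ''u'' = int i" for j s
      using fill_cell_runs[OF conjunct1[OF that(3)] i that(1) conjunct2[OF that(3)] that(2) K d]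
      by (rule runs_weaken) simp_all
    have "gain K d i n = gain K d (Suc i) 0" by (simp add: gain_def fun_eq_iff)
    then show "var s ''u'' = int i \<and> var s ''n'' = int n \<and> filled c K f d (Suc i) 0 s"
      if "var s ''n'' = int n" "filled c K f d i n s \<and> var s ''u'' = int i" for s
      using that by (auto simp: filled_def less_Suc_eq)
  qed (use u nn fi size_safe in auto)
qed (use size_safe in auto)

text \<open>Over all pairs the shifts at \<open>x\<close> add up to inflow minus outflow of the
  starting flow, which turns the needs into the excesses prescribed by
  \<open>initial\<close>.\<close>

lemma filled_represents:
  assumes fi: "filled c K f d n 0 s" and s': "arr s' = arr s" "var s' ''s'' = 0" "var s' ''v'' = 0" "var s' ''K'' = var s ''K''"
    "var s' ''fail'' = var s ''fail''"
  shows "represents K (initial K d f) s'"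
proof -
  let ?F = "start_flow K d"
  have F: "fl (initial K d f) = ?F" by (simp add: initial_def Let_def start_flow_def fun_eq_iff)
  have "gain K d n 0 x = - out_flow n ?F x + in_flow n ?F x" if x: "x < n" for x
  proof -
    have "gain K d n 0 x = (\<Sum>p<n. \<Sum>q<n. ?F p q * of_bool (x = q)) - (\<Sum>p<n. \<Sum>q<n. ?F p q * of_bool (x = p))"
      by (simp add: gain_def shift_def algebra_simps sum_subtractf)
    also have "(\<Sum>p<n. \<Sum>q<n. ?F p q * of_bool (x = q)) = in_flow n ?F x"
      using x by (simp add: in_flow_def of_bool_def if_distrib sum.delta cong: if_cong)
    also have "(\<Sum>p<n. \<Sum>q<n. ?F p q * of_bool (x = p)) = (\<Sum>p<n. of_bool (x = p) * out_flow n ?F p)"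
      by (simp add: out_flow_def sum_distrib_left mult.commute)
    also have "\<dots> = (\<Sum>p<n. if p = x then out_flow n ?F p else 0)" by (intro sum.cong) auto
    also have "\<dots> = out_flow n ?F x" using x by simp
    finally show ?thesis by simp
  qed
  then show ?thesis using fi s'
    unfolding represents_def F by (simp add: filled_def scaled_def) (simp add: initial_def Let_def start_flow_def[abs_def])
qed

text \<open>The abstract \<open>push_state\<close> is the ghost value and its potential bounds the
  rounds; 103 is 100 for a step plus 3 for the test.\<close>

lemma push_loop:
  assumes r: "represents K (initial K d f) s" and k: "kept c s"
    and K: "0 < K" "K \<le> 16 * int n * int n + 16" and d: "low K d"
  shows "runs W push_prog s (push_bound n * 103 + 3)
    (\<lambda>s'. \<exists>a. push_inv K d f a \<and> src a = n \<and> represents K a s' \<and> kept c s')"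
  unfolding push_prog_def
proof (rule runs_While[where J = "\<lambda>a s. push_inv K d f a \<and> represents K a s \<and> kept c s" and g = "initial K d f"
      and m = "\<lambda>a. nat (potential K a)" and C = 100])
  show "push_inv K d f (initial K d f) \<and> represents K (initial K d f) s \<and> kept c s" using r k push_inv_initial by simp
  have "potential K (initial K d f) \<le> int (push_bound n)"
    using potential_initial[of K d f] by (simp add: push_bound_def algebra_simps)
  then have "nat (potential K (initial K d f)) \<le> push_bound n" by simp
  then have "nat (potential K (initial K d f)) * 103 \<le> push_bound n * 103" by (rule mult_le_mono1)
  then show "nat (potential K (initial K d f)) * (100 + bcost (Less (Var ''s'') (Var ''n''))) + bcost (Less (Var ''s'') (Var ''n'')) \<le> push_bound n * 103 + 3"
    by simp
next
  fix a s assume J: "push_inv K d f a \<and> represents K a s \<and> kept c s"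
  have nn: "var s ''n'' = int n" using J kept_n by blast
  have sv: "var s ''s'' = int (src a)" using J by (simp add: represents_def)
  have le: "src a \<le> n" using J by (auto simp: push_inv_def search_def)
  show "bsafe W (Less (Var ''s'') (Var ''n'')) s" using le size_safe by (simp add: nn sv)
  show "\<exists>a. push_inv K d f a \<and> src a = n \<and> represents K a s \<and> kept c s" if "\<not> bval (Less (Var ''s'') (Var ''n'')) s"
    using that J le by (intro exI[of _ a]) (simp add: nn sv)
  assume "bval (Less (Var ''s'') (Var ''n'')) s"
  then have lt: "src a < n" by (simp add: nn sv)
  have in': "push_inv K d f (step K a)" using push_inv_step J lt by blast
  have "potential K (step K a) < potential K a" using potential_step J lt K by blast
  moreover have "0 \<le> potential K (step K a)"
    using in' by (intro potential_nonneg) (auto simp: push_inv_def search_def)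
  ultimately have "nat (potential K (step K a)) < nat (potential K a)" by linarith
  then have next_state: "\<exists>g. (push_inv K d f g \<and> represents K g s' \<and> kept c s') \<and> nat (potential K g) < nat (potential K a)"
    if "represents K (step K a) s' \<and> kept c s'" for s'
    using in' that by blast
  have "runs W step_prog s 100 (\<lambda>s'. represents K (step K a) s' \<and> kept c s')"
    using J by (intro step_runs[OF _ _ _ lt K d, of s c f]) simp_all
  then show "runs W step_prog s 100 (\<lambda>s'. \<exists>g. (push_inv K d f g \<and> represents K g s' \<and> kept c s') \<and> nat (potential K g) < nat (potential K a))"
    by (rule runs_weaken) (simp, rule next_state)
qed

definition doubled :: "int \<times> int \<times> int \<times> int \<times> int \<Rightarrow> int \<Rightarrow> bool \<Rightarrow> push_state \<Rightarrow> nat \<Rightarrow> ram_state \<Rightarrow> bool" where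
  "doubled c K f a i s \<longleftrightarrow> kept c s \<and> var s ''K'' = K \<and> var s ''fail'' = of_bool f \<and>
     (\<forall>u<n. arr s ''d'' u = (if u < i then 2 * lb a u else lb a u)) \<and> (\<forall>u<n. \<forall>v<n. arr s ''F'' (u * n + v) = fl a u v)"

lemma doubled_cong:
  assumes "doubled c K f a i s" "var s' ''n'' = var s ''n''" "var s' ''k'' = var s ''k''"
    "arr s' ''adj'' = arr s ''adj''" "arr s' ''delta'' = arr s ''delta''" "arr s' ''C'' = arr s ''C''" "arr s' ''T'' = arr s ''T''"
    "var s' ''p'' = var s ''p''" "var s' ''z'' = var s ''z''" "var s' ''q'' = var s ''q''" "var s' ''D'' = var s ''D''" "var s' ''r'' = var s ''r''"
    "var s' ''K'' = var s ''K''" "var s' ''fail'' = var s ''fail''" "arr s' ''F'' = arr s ''F''"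
    "\<And>u. u < n \<Longrightarrow> arr s' ''d'' u = (if u < j then 2 * lb a u else lb a u)"
  shows "doubled c K f a j s'"
  using assms kept_cong[of c s s'] by (simp add: doubled_def)

lemma double_runs:
  assumes s: "doubled c K f a 0 s" and lb: "\<And>u. u < n \<Longrightarrow> 0 \<le> lb a u \<and> lb a u \<le> Z"
  shows "runs W (For ''u'' double_cell) s (n * 17 + 5) (doubled c K f a n)"
proof (rule runs_For_stable[where P = "doubled c K f a" and C = 10])
  show "var s ''n'' = int n" using s kept_n[of c s] by (simp add: doubled_def)
  show "doubled c K f a i (s\<lparr>var := (var s)(''u'' := b)\<rparr>)" if "doubled c K f a i s" for i s b
    using that by (rule doubled_cong) (use that in \<open>simp_all add: doubled_def\<close>)
  fix i s assume i: "i < n" and u: "var s ''u'' = int i" and nn: "var s ''n'' = int n" and r: "doubled c K f a i s"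
  have di: "arr s ''d'' i = lb a i" "\<And>u. u < n \<Longrightarrow> arr s ''d'' u = (if u < i then 2 * lb a u else lb a u)"
    using r i by (simp_all add: doubled_def)
  note safe = index_safe[OF i i] lb[OF i] size_safe W Z1
  show "runs W double_cell s 10 (\<lambda>s'. var s' ''u'' = int i \<and> var s' ''n'' = int n \<and> doubled c K f a (Suc i) s')"
    using safe unfolding double_cell_def
    apply (intro runs_wp)
     apply (simp_all add: u nn di(1))
    apply (rule doubled_cong[OF r]; simp add: di(2))
    done
qed (use s size_safe in auto)

definition feasible :: bool where
  "feasible \<longleftrightarrow> (\<exists>F. flow n cap (need I) F)"

text \<open>The range of \<open>F\<close> is asserted even for a failed run, since the values are
  summed up in any case and the sum has to fit into a word. Only the second part makes
  \<open>F\<close> a flow.\<close>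

definition answer :: "bool \<Rightarrow> int \<Rightarrow> ram_state \<Rightarrow> bool" where
  "answer f K s \<longleftrightarrow> (\<exists>F. (\<forall>u<n. \<forall>v<n. arr s ''F'' (u * n + v) = F u v \<and> 0 \<le> F u v \<and> F u v \<le> 2) \<and>
     (\<not> f \<and> (\<Sum>u<n. need I u) = 0 \<longrightarrow> flow n cap (need I) F \<and> (\<exists>d. optimal 1 K d F)))"

text \<open>
  The flow itself need not be kept between scales: for the analysis it suffices that some feasible
  flow is 2-optimal for the doubled labels.
\<close>

definition scaling :: "nat \<Rightarrow> int \<times> int \<times> int \<times> int \<Rightarrow> nat \<times> (nat \<Rightarrow> int) \<times> bool \<Rightarrow> ram_state \<Rightarrow> bool" where
  "scaling L c g s \<longleftrightarrow> (case g of (r, d, f) \<Rightarrow> (case c of (p, z, q, D) \<Rightarrow>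
     r \<le> L \<and> (2 :: int) ^ r \<le> 8 * int n * int n + 2 \<and> scaled (p, z, q, D, int r) (2 ^ r) f d s \<and> low (2 ^ r) d \<and>
     (feasible \<longrightarrow> \<not> f \<and> (\<exists>F. flow n cap (need I) F \<and> optimal 2 (2 ^ r) d F)) \<and>
     (0 < r \<longrightarrow> answer f (2 ^ (r - 1)) s)))"

text \<open>Feasibility provides a witness that is 2-optimal for the starting labels, and
  \<open>not_stuck\<close> turns it into the absence of failure; without failure
  \<open>flow_at_end\<close> applies, given that the needs sum to 0.\<close>

lemma push_inv_imp_answer:
  assumes a: "push_inv K d f a" "src a = n" and f: "feasible \<Longrightarrow> \<not> f \<and> (\<exists>F. flow n cap (need I) F \<and> optimal 2 K d F)"
  shows "feasible \<Longrightarrow> \<not> failed a \<and> flow n cap (need I) (fl a)"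
    "\<not> failed a \<Longrightarrow> (\<Sum>u<n. need I u) = 0 \<Longrightarrow> flow n cap (need I) (fl a)"
    "optimal 1 K (lb a) (fl a)"
proof -
  have core: "core K d a" using a by (simp add: push_inv_def)
  show "optimal 1 K (lb a) (fl a)" using core by (simp add: core_def)
  show *: "flow n cap (need I) (fl a)" if "\<not> failed a" "(\<Sum>u<n. need I u) = 0"
  proof -
    have "search f a" using a that by (auto simp: push_inv_def)
    then show ?thesis using flow_at_end[OF core _ a(2) that(2)] by blast
  qed
  assume fe: feasible
  then obtain F where F: "\<not> f" "flow n cap (need I) F" "optimal 2 K d F" using f by blast
  have "\<not> stuck a" using not_stuck[OF core F(2,3)] .
  then have "\<not> failed a" using a F(1) by (auto simp: push_inv_def search_def)
  then show "\<not> failed a \<and> flow n cap (need I) (fl a)" using * sum_need_flow[OF F(2)] by blast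
qed

lemma low_double:
  assumes core: "core K d a" and d: "low K d"
  shows "low (2 * K) (\<lambda>u. 2 * lb a u)"
  unfolding low_def
proof (intro allI impI)
  fix u assume u: "u < n"
  have "int (rl a u) \<le> 3 * int n + 3" using coreD(9)[OF core u] by (simp add: limit_def)
  moreover have "0 \<le> d u" "d u \<le> (6 * int n + 6) * (K - 1)" using d u by (simp_all add: low_def)
  moreover have "(6 * int n + 6) * (2 * K - 1) = 2 * ((6 * int n + 6) * (K - 1)) + (6 * int n + 6)" by (simp add: algebra_simps)
  ultimately show "0 \<le> 2 * lb a u \<and> 2 * lb a u \<le> (6 * int n + 6) * (2 * K - 1)"
    using coreD(10)[OF core u] by linarith
qed

lemma scale_body_runs:
  assumes s: "scaling L c (r, d, f) s" and K: "(2::int) ^ r < 4 * int n * int n + 1" and L: "4 * int n * int n < 2 ^ L"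
  shows "runs W scale_body s (body_bound n) (\<lambda>s'. \<exists>d' f'. scaling L c (Suc r, d', f') s')"
proof -
  obtain p z q D where c: "c = (p, z, q, D)" by (cases c) auto
  let ?K = "(2::int) ^ r" and ?c = "(p, z, q, D, int r)"
  have s': "scaled ?c ?K f d s" "low ?K d" and fe: "feasible \<Longrightarrow> \<not> f \<and> (\<exists>F. flow n cap (need I) F \<and> optimal 2 ?K d F)"
    using s by (auto simp: scaling_def c)
  have "0 \<le> int n * int n" by simp
  then have Kb: "0 < ?K" "?K \<le> 16 * int n * int n + 16" using K by (simp, linarith)
  have "(2::int) ^ r < 2 ^ L" using K L by linarith
  then have rL: "r < L" by simp
  have rZ: "int r \<le> Z"
  proof -
    have "int r < 2 ^ r" by (metis of_nat_less_two_power)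
    then show ?thesis using scale_bounds(2)[OF Kb] by linarith
  qed
  show ?thesis
    unfolding scale_body_def
  proof (rule runs_Seq[OF reset_runs[OF s'(1)]])
    fix s1 assume 1: "reset ?c ?K f d n s1"
    show "runs W (Seq (For ''u'' (For ''v'' fill_cell))
     (Seq (Seq (Assign ''s'' (Num 0)) (Assign ''v'' (Num 0)))
     (Seq push_prog next_scale_prog))) s1
      (n * (n * 67 + 30) + push_bound n * 103 + 40) (\<lambda>s'. \<exists>d' f'. scaling L c (Suc r, d', f') s')"
    proof (rule runs_Seq[OF fill_runs[OF 1 Kb s'(2)]])
      fix s2 assume 2: "filled ?c ?K f d n 0 s2"
      show "runs W (Seq (Seq (Assign ''s'' (Num 0)) (Assign ''v'' (Num 0)))
     (Seq push_prog next_scale_prog)) s2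
      (n * 18 + push_bound n * 103 + 35) (\<lambda>s'. \<exists>d' f'. scaling L c (Suc r, d', f') s')"
      proof (rule runs_Seq[where ?B1.0 = 4 and R = "\<lambda>s. represents ?K (initial ?K d f) s \<and> kept ?c s"])
        let ?s = "s2\<lparr>var := (var s2)(''s'' := 0, ''v'' := 0)\<rparr>"
        have "represents ?K (initial ?K d f) ?s" by (rule filled_represents[OF 2]) simp_all
        moreover have "kept ?c ?s"
        proof (rule kept_cong)
          show "kept ?c s2" using 2 by (simp add: filled_def scaled_def)
        qed simp_all
        ultimately show "runs W (Seq (Assign ''s'' (Num 0)) (Assign ''v'' (Num 0))) s2 4 (\<lambda>s. represents ?K (initial ?K d f) s \<and> kept ?c s)"
          using W Z1 by (intro runs_wp) simp_all
        fix s3 assume 3: "represents ?K (initial ?K d f) s3 \<and> kept ?c s3"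
        show "runs W (Seq push_prog next_scale_prog) s3
      (n * 17 + push_bound n * 103 + 30) (\<lambda>s'. \<exists>d' f'. scaling L c (Suc r, d', f') s')"
        proof (rule runs_Seq[OF push_loop[OF conjunct1[OF 3] conjunct2[OF 3] Kb s'(2)]])
          fix s4 assume "\<exists>a. push_inv ?K d f a \<and> src a = n \<and> represents ?K a s4 \<and> kept ?c s4"
          then obtain a where a: "push_inv ?K d f a" "src a = n" "represents ?K a s4" "kept ?c s4" by blast
          have core: "core ?K d a" using a by (simp add: push_inv_def)
          have db: "doubled ?c ?K (failed a) a 0 s4" using a by (simp add: represents_def doubled_def)
          note ans = push_inv_imp_answer[OF a(1,2) fe]
          have lbZ: "0 \<le> lb a u \<and> lb a u \<le> Z" if "u < n" for u using core_safe[OF core s'(2) Kb that] by blast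
          show "runs W next_scale_prog s4 (n * 17 + 20) (\<lambda>s'. \<exists>d' f'. scaling L c (Suc r, d', f') s')"
            unfolding next_scale_prog_def
          proof (rule runs_Seq[OF double_runs[OF db lbZ]])
            fix s5 assume 5: "doubled ?c ?K (failed a) a n s5"
            let ?s = "s5\<lparr>var := (var s5)(''K'' := ?K + ?K, ''r'' := int r + 1)\<rparr>"
            have v5: "var s5 ''K'' = ?K" "var s5 ''r'' = int r" using 5 by (simp_all add: doubled_def kept_def)
            have "base ?s" by (rule base_cong[of s5]) (use 5 in \<open>simp_all add: doubled_def kept_def\<close>)
            then have sc: "scaled (p, z, q, D, int (Suc r)) (2 ^ Suc r) (failed a) (\<lambda>u. 2 * lb a u) ?s"
              using 5 by (simp add: scaled_def doubled_def kept_def)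
            have "feasible \<longrightarrow> \<not> failed a \<and> (\<exists>F. flow n cap (need I) F \<and> optimal 2 (2 ^ Suc r) (\<lambda>u. 2 * lb a u) F)"
              using ans(1) optimal_double[OF ans(3)] by auto
            \<comment> \<open>\<open>answer\<close> speaks of the cost of the scale just completed,
              while the labels and \<open>K\<close> in memory are already doubled.\<close>
            moreover have "answer (failed a) ?K ?s"
              unfolding answer_def
            proof (intro exI[of _ "fl a"] conjI allI impI)
              fix u v assume uv: "u < n" "v < n"
              show "arr ?s ''F'' (u * n + v) = fl a u v" using 5 uv by (simp add: doubled_def)
              show "0 \<le> fl a u v" using coreD(1)[OF core uv] .
              show "fl a u v \<le> 2" using coreD(2)[OF core uv] c_bound(2)[of u v] by linarith
            qed (use ans(2,3) in auto)
            moreover have "(2::int) ^ Suc r \<le> 8 * int n * int n + 2" using K by simp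
            moreover have "low (2 ^ Suc r) (\<lambda>u. 2 * lb a u)" using low_double[OF core s'(2)] by simp
            ultimately have "scaling L c (Suc r, (\<lambda>u. 2 * lb a u), failed a) ?s"
              using sc rL by (simp add: scaling_def c)
            then have "\<exists>d' f'. scaling L c (Suc r, d', f') ?s" by blast
            then show "runs W (Seq (Assign ''K'' (Plus (Var ''K'') (Var ''K''))) (Assign ''r'' (Plus (Var ''r'') (Num 1)))) s5 8
              (\<lambda>s'. \<exists>d' f'. scaling L c (Suc r, d', f') s')"
              using scale_bounds(2)[OF Kb] Kb(1) rZ W Z1 by (intro runs_wp) (simp_all add: v5)
          qed simp_all
        qed (simp add: algebra_simps)
      qed (simp add: algebra_simps)
    qed (simp add: algebra_simps)
  qed (simp add: algebra_simps body_bound_def)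
qed

end

section \<open>Tally and verdict\<close>

definition tally_cell :: com where
  "tally_cell = Assign ''m'' (Plus (Var ''m'') (Get ''F'' (idx ''u'' ''v'')))"

text \<open>The test \<open>q = 0\<close> complements \<open>fail\<close>: with a negative sum of
  needs all positive excess can disappear without failure while deficits remain.\<close>

definition verdict :: bexp where
  "verdict = Conj (Less (Num 0) (Var ''n'')) (Conj (Equal (Var ''fail'') (Num 0)) (Conj (Equal (Var ''q'') (Num 0))
     (Conj (Neg (Less (Var ''k'') (Var ''m'')))
       (Neg (Conj (Neg (Equal (Var ''p'') (Num 1)))
         (Neg (Conj (Neg (Less (Var ''k'') (Plus (Var ''D'') (Var ''z''))))
           (Neg (Less (Var ''k'') (Minus (Var ''p'') (Num 1)))))))))))"

definition tally_prog :: com where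
  "tally_prog = Seq (Seq (Assign ''m'' (Num 0)) (For ''u'' (For ''v'' tally_cell)))
     (Cond verdict (Assign ''out'' (Num 1)) (Assign ''out'' (Num 0)))"

definition cdbe_prog :: "int \<Rightarrow> com" where
  "cdbe_prog e = Seq (init_prog e) (Seq merge_prog (Seq count_prog (Seq scale_prog tally_prog)))"

text \<open>With \<open>b\<close> the rounded-up binary logarithm of \<open>n + 1\<close>,
  \<open>n < 2 ^ b\<close> and therefore \<open>2 ^ (2 * b + 2)\<close> exceeds
  \<open>4 * n^2\<close>, the last value of \<open>K\<close> at which a scale may still
  start.\<close>

definition scales :: "nat \<Rightarrow> nat" where
  "scales n = 2 * nat \<lceil>log 2 (real n + 1)\<rceil> + 2"

definition time_bound :: "nat \<Rightarrow> nat" where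
  "time_bound n = n * (n * 107 + 32) + 5 + (n * (n * (n * 20 + 37) + 12) + 5) + (n * 100 + 18)
     + (scales n * (body_bound n + 9) + 20) + (n * (n * 17 + 12) + 60)"

lemma scales_bound: "4 * int n * int n < 2 ^ scales n"
proof -
  define b where "b = nat \<lceil>log 2 (real n + 1)\<rceil>"
  have "log 2 (real n + 1) \<le> real b" unfolding b_def by linarith
  then have "real n + 1 \<le> 2 powr real b" by (simp add: log_le_iff)
  then have "real (n + 1) \<le> real (2 ^ b)" by (simp add: powr_realpow)
  then have "n + 1 \<le> 2 ^ b" by (simp only: of_nat_le_iff)
  then have lt: "n < 2 ^ b" by simp
  have "n * n < 2 ^ b * 2 ^ b" using lt by (intro mult_strict_mono) auto
  then have "4 * n * n < 2 ^ scales n" by (simp add: scales_def b_def power_add power_mult power2_eq_square mult_2 flip: power_mult_distrib)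
  then have "int (4 * n * n) < int (2 ^ scales n)" by (simp only: of_nat_less_iff)
  then show ?thesis by simp
qed

context ram_input begin

lemma scale_runs:
  assumes s: "base s" "\<forall>u<n. arr s ''d'' u = 0" "(var s ''p'', var s ''z'', var s ''q'', var s ''D'') = c"
  shows "runs W scale_prog s (scales n * (body_bound n + 9) + 20)
    (\<lambda>s. \<exists>r d f. scaling (scales n) c (r, d, f) s \<and> 4 * int n * int n + 1 \<le> 2 ^ r)"
  unfolding scale_prog_def
proof (rule runs_Seq[where ?B1.0 = 6 and R = "scaling (scales n) c (0, (\<lambda>_. 0), False)"])
  let ?s = "s\<lparr>var := (var s)(''fail'' := 0, ''K'' := 1, ''r'' := 0)\<rparr>"
  have "base ?s" using s(1) by (rule base_cong) simp_all
  moreover have "feasible \<longrightarrow> (\<exists>F. flow n cap (need I) F \<and> optimal 2 1 (\<lambda>_. 0) F)"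
    using optimal_zero by (auto simp: feasible_def)
  ultimately have "scaling (scales n) c (0, (\<lambda>_. 0), False) ?s"
    using s by (cases c) (auto simp: scaling_def scaled_def kept_def low_def)
  then show "runs W (Seq (Assign ''fail'' (Num 0)) (Seq (Assign ''K'' (Num 1)) (Assign ''r'' (Num 0)))) s 6
    (scaling (scales n) c (0, (\<lambda>_. 0), False))"
    using W Z1 by (intro runs_wp) simp_all
next
  fix s assume 0: "scaling (scales n) c (0, (\<lambda>_. 0), False) s"
  let ?b = "Less (Var ''K'') (Plus (Times (Num 4) (Times (Var ''n'') (Var ''n''))) (Num 1))"
  have nn: "0 \<le> int n * int n" "int n * int n \<le> Z" using Zn by auto
  have v: "var s ''n'' = int n" "var s ''K'' = 2 ^ r" "(2::int) ^ r \<le> 8 * int n * int n + 2" if "scaling (scales n) c (r, d, f) s" for r d f s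
    using that kept_n[of _ s] by (auto simp: scaling_def scaled_def split: prod.splits)
  show "runs W (While ?b scale_body) s (scales n * (body_bound n + 9) + 14)
    (\<lambda>s. \<exists>r d f. scaling (scales n) c (r, d, f) s \<and> 4 * int n * int n + 1 \<le> 2 ^ r)"
  proof (rule runs_While[where J = "scaling (scales n) c" and m = "\<lambda>(r, _). scales n - r" and C = "body_bound n", OF 0])
    fix g s assume J: "scaling (scales n) c g s"
    obtain r d f where g: "g = (r, d, f)" by (cases g) auto
    note v = v[OF J[unfolded g]]
    have "(2::int) ^ r \<le> W" "(0::int) < 2 ^ r" using v(3) nn W Z1 by (linarith, simp)
    then show "bsafe W ?b s" using nn size_safe W Z1 by (simp add: v) 
    show "\<exists>r d f. scaling (scales n) c (r, d, f) s \<and> 4 * int n * int n + 1 \<le> 2 ^ r" if "\<not> bval ?b s"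
      using that J unfolding g by (intro exI[of _ r] exI[of _ d] exI[of _ f]) (simp add: v mult.assoc)
    assume "bval ?b s"
    then have "(2::int) ^ r < 4 * int n * int n + 1" by (simp add: v mult.assoc)
    then have "runs W scale_body s (body_bound n) (\<lambda>s'. \<exists>d' f'. scaling (scales n) c (Suc r, d', f') s')"
      using scale_body_runs[OF J[unfolded g] _ scales_bound] by blast
    then show "runs W scale_body s (body_bound n) (\<lambda>s'. \<exists>g'. scaling (scales n) c g' s' \<and> (case g' of (r, _) \<Rightarrow> scales n - r) < (case g of (r, _) \<Rightarrow> scales n - r))"
    proof (rule runs_weaken)
      fix s' assume "\<exists>d' f'. scaling (scales n) c (Suc r, d', f') s'"
      then obtain d' f' where sc: "scaling (scales n) c (Suc r, d', f') s'" by blast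
      then have "Suc r \<le> scales n" by (auto simp: scaling_def split: prod.splits)
      then show "\<exists>g'. scaling (scales n) c g' s' \<and> (case g' of (r, _) \<Rightarrow> scales n - r) < (case g of (r, _) \<Rightarrow> scales n - r)"
        using sc by (intro exI[of _ "(Suc r, d', f')"]) (simp add: g)
    qed simp
  next
    have "bcost ?b = 9" by simp
    then show "(case (0, \<lambda>_. 0, False) of (r, _) \<Rightarrow> scales n - r) * (body_bound n + bcost ?b) + bcost ?b \<le> scales n * (body_bound n + 9) + 14"
      by (simp del: bcost.simps)
  qed
qed simp

definition partial_total :: "(nat \<Rightarrow> nat \<Rightarrow> int) \<Rightarrow> nat \<Rightarrow> nat \<Rightarrow> int" where
  "partial_total F i j = (\<Sum>p<i. \<Sum>q<n. F p q) + (\<Sum>q<j. F i q)"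

definition tallied :: "int \<times> int \<times> int \<times> int \<times> int \<Rightarrow> bool \<Rightarrow> (nat \<Rightarrow> nat \<Rightarrow> int) \<Rightarrow> nat \<Rightarrow> nat \<Rightarrow> ram_state \<Rightarrow> bool" where
  "tallied c f F i j s \<longleftrightarrow> kept c s \<and> var s ''fail'' = of_bool f \<and> (\<forall>u<n. \<forall>v<n. arr s ''F'' (u * n + v) = F u v) \<and>
     var s ''m'' = partial_total F i j"

lemma tallied_cong:
  assumes "tallied c f F i j s" "arr s' = arr s" "var s' ''n'' = var s ''n''" "var s' ''k'' = var s ''k''"
    "var s' ''p'' = var s ''p''" "var s' ''z'' = var s ''z''" "var s' ''q'' = var s ''q''" "var s' ''D'' = var s ''D''" "var s' ''r'' = var s ''r''"
    "var s' ''fail'' = var s ''fail''" "var s' ''m'' = partial_total F i' j'"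
  shows "tallied c f F i' j' s'"
  using assms kept_cong[of c s s'] by (simp add: tallied_def)

lemma partial_total_bound:
  assumes F: "\<And>u v. u < n \<Longrightarrow> v < n \<Longrightarrow> 0 \<le> F u v \<and> F u v \<le> 2" and ij: "i < n \<and> j \<le> n \<or> i = n \<and> j = 0"
  shows "0 \<le> partial_total F i j" "partial_total F i j \<le> 2 * Z"
proof -
  show "0 \<le> partial_total F i j"
    unfolding partial_total_def using F ij by (intro add_nonneg_nonneg sum_nonneg) auto
  have "(\<Sum>p<i. \<Sum>q<n. F p q) \<le> (\<Sum>p<i. \<Sum>q<n. 2)" using F ij by (intro sum_mono) auto
  then have "(\<Sum>p<i. \<Sum>q<n. F p q) \<le> 2 * (int i * int n)" by simp
  moreover have "(\<Sum>q<j. F i q) \<le> (\<Sum>q<j. 2)" using F ij by (intro sum_mono) auto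
  then have "(\<Sum>q<j. F i q) \<le> 2 * int j" by simp
  moreover have "int i * int n \<le> int n * int n" using ij by (intro mult_right_mono) auto
  moreover have "int j \<le> int n" using ij by auto
  ultimately show "partial_total F i j \<le> 2 * Z"
    using Zn unfolding partial_total_def by linarith
qed

lemma tally_runs:
  assumes s: "kept c s" "var s ''fail'' = of_bool f" "\<forall>u<n. \<forall>v<n. arr s ''F'' (u * n + v) = F u v"
    and F: "\<And>u v. u < n \<Longrightarrow> v < n \<Longrightarrow> 0 \<le> F u v \<and> F u v \<le> 2"
  shows "runs W (Seq (Assign ''m'' (Num 0)) (For ''u'' (For ''v'' tally_cell))) s (n * (n * 17 + 12) + 7) (tallied c f F n 0)"
proof (rule runs_Seq[where ?B1.0 = 2 and R = "tallied c f F 0 0"])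
  have "kept c (s\<lparr>var := (var s)(''m'' := 0)\<rparr>)" using s(1) by (rule kept_cong) simp_all
  then have "tallied c f F 0 0 (s\<lparr>var := (var s)(''m'' := 0)\<rparr>)"
    using s by (simp add: tallied_def partial_total_def)
  then show "runs W (Assign ''m'' (Num 0)) s 2 (tallied c f F 0 0)"
    using W Z1 by (intro runs_wp) simp_all
  fix s assume t: "tallied c f F 0 0 s"
  show "runs W (For ''u'' (For ''v'' tally_cell)) s (n * (n * 17 + 12) + 5) (tallied c f F n 0)"
  proof (rule runs_For_stable[where P = "\<lambda>i. tallied c f F i 0" and C = "n * 17 + 5"])
    show "var s ''n'' = int n" using t kept_n[of c s] by (simp add: tallied_def)
    show "tallied c f F i 0 (s\<lparr>var := (var s)(''u'' := a)\<rparr>)" if "tallied c f F i 0 s" for i s a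
      using that by (rule tallied_cong) (use that in \<open>simp_all add: tallied_def\<close>)
    fix i s assume i: "i < n" and u: "var s ''u'' = int i" and nn: "var s ''n'' = int n" and ti: "tallied c f F i 0 s"
    show "runs W (For ''v'' tally_cell) s (n * 17 + 5) (\<lambda>s'. var s' ''u'' = int i \<and> var s' ''n'' = int n \<and> tallied c f F (Suc i) 0 s')"
    proof (rule runs_For_stable[where P = "\<lambda>j s. tallied c f F i j s \<and> var s ''u'' = int i" and C = 10])
      show "tallied c f F i j (s\<lparr>var := (var s)(''v'' := a)\<rparr>) \<and> var (s\<lparr>var := (var s)(''v'' := a)\<rparr>) ''u'' = int i"
        if "tallied c f F i j s \<and> var s ''u'' = int i" for j s a
        using that tallied_cong[OF conjunct1[OF that], of "s\<lparr>var := (var s)(''v'' := a)\<rparr>" i j] by (simp add: tallied_def)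
      fix j s assume j: "j < n" and v: "var s ''v'' = int j" and nn: "var s ''n'' = int n"
        and t: "tallied c f F i j s \<and> var s ''u'' = int i"
      have m: "var s ''m'' = partial_total F i j" and Fij: "arr s ''F'' (i * n + j) = F i j"
        using t i j by (auto simp: tallied_def)
      have bm: "0 \<le> partial_total F i j" "partial_total F i j \<le> 2 * Z"
        using partial_total_bound[of F i j] F i j by auto
      note safe = index_safe[OF i j] F[OF i j] bm size_safe W Z1
      have suc: "partial_total F i (Suc j) = partial_total F i j + F i j" by (simp add: partial_total_def)
      show "runs W tally_cell s 10 (\<lambda>s'. var s' ''v'' = int j \<and> var s' ''n'' = int n \<and> tallied c f F i (Suc j) s' \<and> var s' ''u'' = int i)"
        using safe unfolding tally_cell_def
        apply (intro runs_wp)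
         apply (simp_all add: conjunct2[OF t] v nn m Fij nat_index)
        apply (rule tallied_cong[OF conjunct1[OF t]]; simp add: suc)
        done
    next
      show "var s ''u'' = int i \<and> var s ''n'' = int n \<and> tallied c f F (Suc i) 0 s"
        if "var s ''n'' = int n" "tallied c f F i n s \<and> var s ''u'' = int i" for s
        using that by (simp add: tallied_def partial_total_def)
    qed (use u nn ti size_safe in auto)
  qed (use t size_safe in auto)
qed simp

text \<open>By idempotence the labels in use are exactly the fixed points of \<open>l\<close>, so
  sums over vertices count components.\<close>

lemma labels_card:
  assumes l: "joined A l"
  shows "(\<Sum>u<n. of_bool (l u = u)) = int (card (l ` {..<n}))"
    and "(\<Sum>u<n. of_bool (l u = u \<and> \<not> (\<exists>w<n. need I w \<noteq> 0 \<and> l w = u))) =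
      int (card {x \<in> l ` {..<n}. \<forall>u<n. l u = x \<longrightarrow> need I u = 0})"
proof -
  have fixpoints: "l ` {..<n} = {u. u < n \<and> l u = u}"
  proof
    show "l ` {..<n} \<subseteq> {u. u < n \<and> l u = u}" using l by (simp add: joined_def image_subset_iff)
    show "{u. u < n \<and> l u = u} \<subseteq> l ` {..<n}"
    proof
      fix u assume "u \<in> {u. u < n \<and> l u = u}"
      then have "u = l u" "u \<in> {..<n}" by simp_all
      then show "u \<in> l ` {..<n}" by (rule image_eqI)
    qed
  qed
  then show "(\<Sum>u<n. of_bool (l u = u)) = int (card (l ` {..<n}))" by (simp add: sum_of_bool)
  have "{x \<in> l ` {..<n}. \<forall>u<n. l u = x \<longrightarrow> need I u = 0} = {u. u < n \<and> (l u = u \<and> \<not> (\<exists>w<n. need I w \<noteq> 0 \<and> l w = u))}"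
    unfolding fixpoints by auto
  then show "(\<Sum>u<n. of_bool (l u = u \<and> \<not> (\<exists>w<n. need I w \<noteq> 0 \<and> l w = u))) =
      int (card {x \<in> l ` {..<n}. \<forall>u<n. l u = x \<longrightarrow> need I u = 0})" by (simp only: sum_of_bool)
qed

text \<open>Failure or a nonzero sum of needs refutes feasibility. Otherwise the stored
  \<open>F\<close> is a flow that is optimal for a cost above \<open>2 * n^2\<close>, hence of
  minimum size, and comparing its size with \<open>k\<close> decides the existence.\<close>

lemma flow_decision:
  assumes sc: "scaling L c (r, d, f) s" and r: "4 * int n * int n + 1 \<le> 2 ^ r" and n: "0 < n"
  shows "\<exists>F. (\<forall>u<n. \<forall>v<n. arr s ''F'' (u * n + v) = F u v \<and> 0 \<le> F u v \<and> F u v \<le> 2) \<and>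
    ((\<exists>F. flow n cap (need I) F \<and> total n F \<le> k) \<longleftrightarrow> \<not> f \<and> (\<Sum>u<n. need I u) = 0 \<and> total n F \<le> k)"
proof -
  \<comment> \<open>For \<open>0 < n\<close> the threshold exceeds the initial cost 1, so at least
    one scale has been run and \<open>answer\<close> is available.\<close>
  have "r \<noteq> 0"
  proof
    assume "r = 0"
    then have "4 * int n * int n \<le> 0" using r by simp
    moreover have "0 < int n * int n" using n by simp
    ultimately show False by linarith
  qed
  then have r0: "0 < r" "(2::int) ^ r = 2 * 2 ^ (r - 1)" by (simp_all flip: power_Suc)
  have K: "2 * int n ^ 2 < 2 ^ (r - 1)" using r r0(2) by (simp add: power2_eq_square)
  obtain F where F: "\<forall>u<n. \<forall>v<n. arr s ''F'' (u * n + v) = F u v \<and> 0 \<le> F u v \<and> F u v \<le> 2"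
    and ans: "\<not> f \<and> (\<Sum>u<n. need I u) = 0 \<Longrightarrow> flow n cap (need I) F \<and> (\<exists>d. optimal 1 (2 ^ (r - 1)) d F)"
    using sc r0(1) by (auto simp: scaling_def answer_def split: prod.splits)
  have "\<not> f \<and> (\<Sum>u<n. need I u) = 0 \<and> total n F \<le> k" if F': "flow n cap (need I) F'" "total n F' \<le> k" for F'
  proof -
    have "feasible" using F'(1) by (auto simp: feasible_def)
    then have nf: "\<not> f \<and> (\<Sum>u<n. need I u) = 0"
      using sc sum_need_flow[OF F'(1)] by (auto simp: scaling_def split: prod.splits)
    then obtain d where "flow n cap (need I) F" "optimal 1 (2 ^ (r - 1)) d F" using ans by blast
    then have "total n F \<le> total n F'" using optimal_imp_minimal[OF _ F'(1) _ K] by blast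
    then show ?thesis using nf F'(2) by simp
  qed
  then show ?thesis using F ans by blast
qed

lemma verdict_runs:
  assumes t: "tallied (p, z, q, D, r) f F n 0 s"
    and b: "\<bar>p\<bar> \<le> Z" "\<bar>z\<bar> \<le> Z" "\<bar>q\<bar> \<le> Z" "\<bar>D\<bar> \<le> Z" and F: "\<And>u v. u < n \<Longrightarrow> v < n \<Longrightarrow> 0 \<le> F u v \<and> F u v \<le> 2"
  shows "runs W (Cond verdict (Assign ''out'' (Num 1)) (Assign ''out'' (Num 0))) s 50
    (\<lambda>s. var s ''out'' = of_bool (0 < n \<and> \<not> f \<and> q = 0 \<and> total n F \<le> budget I \<and> (p = 1 \<or> D + z \<le> budget I \<and> p - 1 \<le> budget I)))"
proof -
  have v: "var s ''n'' = int n" "var s ''k'' = budget I" "var s ''fail'' = of_bool f" "var s ''p'' = p" "var s ''z'' = z"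
    "var s ''q'' = q" "var s ''D'' = D" "var s ''m'' = total n F"
    using t by (auto simp: tallied_def kept_def base_def input_ok_def partial_total_def total_def out_flow_def)
  have m: "0 \<le> total n F" "total n F \<le> 2 * Z"
    using partial_total_bound[of F n 0] F by (auto simp: partial_total_def total_def out_flow_def)
  have "bsafe W verdict s"
    unfolding verdict_def bsafe.simps asafe.simps aval.simps v
    using b m Zk size_safe W Z1 by (intro conjI) (cases f; simp)+
  moreover have "bval verdict s \<longleftrightarrow> 0 < n \<and> \<not> f \<and> q = 0 \<and> total n F \<le> budget I \<and> (p = 1 \<or> D + z \<le> budget I \<and> p - 1 \<le> budget I)"
    unfolding verdict_def bval.simps aval.simps v by (simp add: not_less)
  moreover have "cost (Cond verdict (Assign ''out'' (Num 1)) (Assign ''out'' (Num 0))) \<le> 50"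
    by (simp add: verdict_def)
  ultimately show ?thesis
    using W Z1 by (intro runs_wp) simp_all
qed

theorem cdbe_prog_runs:
  assumes "input_ok s"
  shows "runs W (cdbe_prog e) s (time_bound n) (\<lambda>s. var s ''out'' = of_bool (CDBE S I))"
  unfolding cdbe_prog_def
proof (rule runs_Seq[OF init_runs[OF assms]])
  fix s1 assume 1: "base s1 \<and> clear s1 \<and> (\<forall>u<n. arr s1 ''lab'' u = int u)"
  show "runs W (Seq merge_prog (Seq count_prog (Seq scale_prog tally_prog))) s1
    (n * (n * (n * 20 + 37) + 12) + 5 + (n * 100 + 18)
     + (scales n * (body_bound n + 9) + 20) + (n * (n * 17 + 12) + 60)) (\<lambda>s. var s ''out'' = of_bool (CDBE S I))"
  proof (rule runs_Seq[OF merge_runs])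
    fix s2 assume "base s2 \<and> clear s2 \<and> (\<exists>l. joined A l \<and> (\<forall>u<n. arr s2 ''lab'' u = int (l u)))"
    then obtain l where 2: "base s2" "clear s2" "\<forall>u<n. arr s2 ''lab'' u = int (l u)" and l: "joined A l" by blast
    have ln: "l u < n" if "u < n" for u using l that by (simp add: joined_def)
    interpret c: cdbe S I l n
      by standard (use EA valid order l in \<open>simp_all add: joined_def\<close>)
    define p z q D where "p = int (card (l ` {..<n}))" and "z = int (card c.untouched)" and "q = (\<Sum>u<n. need I u)" and "D = c.demand"
    show "runs W (Seq count_prog (Seq scale_prog tally_prog)) s2
      (n * 100 + 18 + (scales n * (body_bound n + 9) + 20) + (n * (n * 17 + 12) + 60)) (\<lambda>s. var s ''out'' = of_bool (CDBE S I))"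
    proof (rule runs_Seq[OF count_runs[OF 2 ln]])
      fix s3 assume c: "counted l n s3"
      have b3: "base s3" "\<forall>u<n. arr s3 ''d'' u = 0" using c by (simp_all add: counted_def marked_def)
      have vars: "(var s3 ''p'', var s3 ''z'', var s3 ''q'', var s3 ''D'') = (p, z, q, D)"
        using c labels_card[OF l] by (simp add: counted_def p_def z_def q_def D_def c.demand_def c.untouched_def)
      have bounds: "\<bar>p\<bar> \<le> Z" "\<bar>z\<bar> \<le> Z" "\<bar>q\<bar> \<le> Z" "\<bar>D\<bar> \<le> Z"
      proof -
        have pz: "p = (\<Sum>u<n. of_bool (l u = u))"
          "z = (\<Sum>u<n. of_bool (l u = u \<and> \<not> (\<exists>w<n. need I w \<noteq> 0 \<and> l w = u)))"
          using labels_card[OF l] by (simp_all add: p_def z_def c.untouched_def)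
        have "0 \<le> p" "p \<le> int n" "0 \<le> z" "z \<le> int n"
          unfolding pz by (rule partial_sum_bound(4,5)[OF order.refl])+
        then show "\<bar>p\<bar> \<le> Z" "\<bar>z\<bar> \<le> Z" using size_safe(3) by linarith+
        show "\<bar>q\<bar> \<le> Z" using partial_sum_bound(1)[OF order.refl] by (simp add: q_def)
        show "\<bar>D\<bar> \<le> Z" using partial_sum_bound(2,3)[OF order.refl] by (simp add: D_def c.demand_def)
      qed
      show "runs W (Seq scale_prog tally_prog) s3 ((scales n * (body_bound n + 9) + 20) + (n * (n * 17 + 12) + 60))
        (\<lambda>s. var s ''out'' = of_bool (CDBE S I))"
      proof (rule runs_Seq[OF scale_runs[OF b3 vars]])
        fix s4 assume "\<exists>r d f. scaling (scales n) (p, z, q, D) (r, d, f) s4 \<and> 4 * int n * int n + 1 \<le> 2 ^ r"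
        then obtain r d f where sc: "scaling (scales n) (p, z, q, D) (r, d, f) s4" and r: "4 * int n * int n + 1 \<le> 2 ^ r" by blast
        have k4: "kept (p, z, q, D, int r) s4" "var s4 ''fail'' = of_bool f" using sc by (auto simp: scaling_def scaled_def)
        obtain F where F: "\<And>u v. u < n \<Longrightarrow> v < n \<Longrightarrow> arr s4 ''F'' (u * n + v) = F u v \<and> 0 \<le> F u v \<and> F u v \<le> 2"
          and dec: "0 < n \<Longrightarrow> (\<exists>F. flow n cap (need I) F \<and> total n F \<le> budget I) \<longleftrightarrow> \<not> f \<and> (\<Sum>u<n. need I u) = 0 \<and> total n F \<le> budget I"
          using flow_decision[OF sc r, of "budget I"] by (cases "0 < n") auto
        show "runs W tally_prog s4 (n * (n * 17 + 12) + 60) (\<lambda>s. var s ''out'' = of_bool (CDBE S I))"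
          unfolding tally_prog_def
        proof (rule runs_Seq[OF tally_runs[OF k4]])
          show "\<forall>u<n. \<forall>v<n. arr s4 ''F'' (u * n + v) = F u v" using F by blast
          show "0 \<le> F u v \<and> F u v \<le> 2" if "u < n" "v < n" for u v using F[OF that] by blast
          fix s5 assume t: "tallied (p, z, q, D, int r) f F n 0 s5"
          have "runs W (Cond verdict (Assign ''out'' (Num 1)) (Assign ''out'' (Num 0))) s5 50
            (\<lambda>s. var s ''out'' = of_bool (0 < n \<and> \<not> f \<and> q = 0 \<and> total n F \<le> budget I \<and> (p = 1 \<or> D + z \<le> budget I \<and> p - 1 \<le> budget I)))"
            by (rule verdict_runs[OF t bounds]) (use F in blast)
          moreover have "(0 < n \<and> \<not> f \<and> q = 0 \<and> total n F \<le> budget I \<and> (p = 1 \<or> D + z \<le> budget I \<and> p - 1 \<le> budget I)) \<longleftrightarrow> CDBE S I"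
            using dec unfolding c.CDBE_iff p_def z_def q_def D_def by auto
          ultimately show "runs W (Cond verdict (Assign ''out'' (Num 1)) (Assign ''out'' (Num 0))) s5 50
            (\<lambda>s. var s ''out'' = of_bool (CDBE S I))" by simp
        qed simp
      qed simp
    qed simp_all
  qed (use 1 in \<open>simp_all\<close>)
qed (simp add: time_bound_def)

end

section \<open>Word size and running time\<close>

definition word_exponent :: nat where
  "word_exponent = 24"

lemma ram_inputI:
  assumes EA: "EA \<in> S" and valid: "valid_input I"
  defines "b \<equiv> int (order I) + \<bar>budget I\<bar> + (\<Sum>v<order I. \<bar>balance I v\<bar>) + 2"
  shows "ram_input S I (order I) (b ^ word_exponent) (100 * b ^ 3)"
proof
  let ?n = "order I"
  have bal: "0 \<le> (\<Sum>v<?n. \<bar>balance I v\<bar>)" by (intro sum_nonneg) auto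
  then have b: "2 \<le> b" "int ?n + 1 \<le> b" "\<bar>budget I\<bar> \<le> b" "(\<Sum>v<?n. \<bar>balance I v\<bar>) \<le> b"
    unfolding b_def by linarith+
  have sq: "b \<le> b ^ 2" "b ^ 2 \<le> b ^ 3" "1 \<le> b ^ 3"
    using power_increasing[of 1 2 b] power_increasing[of 2 3 b] one_le_power[of b 3] b(1) by auto
  have nn: "int ?n * int ?n \<le> b ^ 2" using b(2) unfolding power2_eq_square by (intro mult_mono) auto
  have bb: "\<bar>balance I v\<bar> \<le> b" if "v < ?n" for v
    using member_le_sum[of v "{..<?n}" "\<lambda>v. \<bar>balance I v\<bar>"] that b(4) by auto
  have need: "\<bar>need I v\<bar> \<le> \<bar>balance I v\<bar> + int ?n" for v
  proof -
    have le: "(\<Sum>w<?n. incidence (parcs (graph I)) v w) \<le> (\<Sum>w<?n. 1)" "(\<Sum>w<?n. incidence (parcs (graph I)) w v) \<le> (\<Sum>w<?n. 1)"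
      by (intro sum_mono; simp add: incidence_def)+
    have "0 \<le> (\<Sum>w<?n. incidence (parcs (graph I)) v w)" "0 \<le> (\<Sum>w<?n. incidence (parcs (graph I)) w v)"
      by (intro sum_nonneg; simp add: incidence_def)+
    then show ?thesis using le unfolding need_def out_flow_def in_flow_def by simp
  qed
  show "EA \<in> S" "valid_input I" "order I = order I" using assms by simp_all
  \<comment> \<open>\<open>100 * Z = 10000 * b ^ 3\<close>, and as \<open>b\<close> is at least 2
    the remaining 21 of the 24 powers cover 10000.\<close>
  have "(2::int) ^ 21 \<le> b ^ 21" using b(1) by (intro power_mono) auto
  then have "10000 \<le> b ^ 21" by simp
  then have "10000 * b ^ 3 \<le> b ^ 21 * b ^ 3" using b(1) by (intro mult_right_mono) auto
  then show "100 * (100 * b ^ 3) \<le> b ^ word_exponent" by (simp add: word_exponent_def flip: power_add)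
  show "4 \<le> 100 * b ^ 3" using sq(3) by linarith
  show "int ?n * int ?n + 4 * int ?n \<le> 100 * b ^ 3" using nn b(2) sq by linarith
  show "\<bar>balance I v\<bar> \<le> 100 * b ^ 3" if "v < ?n" for v using bb[OF that] sq b(1) by linarith
  show "\<bar>need I v\<bar> \<le> 100 * b ^ 3" if "v < ?n" for v using bb[OF that] need[of v] sq b by linarith
  have "(\<Sum>v<?n. \<bar>need I v\<bar>) \<le> (\<Sum>v<?n. \<bar>balance I v\<bar> + int ?n)" by (intro sum_mono need)
  also have "\<dots> = (\<Sum>v<?n. \<bar>balance I v\<bar>) + int ?n * int ?n" by (simp add: sum.distrib)
  finally show "(\<Sum>v<?n. \<bar>need I v\<bar>) \<le> 100 * b ^ 3" using nn b(4) sq by linarith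
  show "\<bar>budget I\<bar> \<le> 100 * b ^ 3" using b(3) sq b(1) by linarith
  have "(int ?n + 1) * (int ?n * int ?n + 1) \<le> b * b ^ 2"
  proof (intro mult_mono)
    have "int ?n * int ?n + 1 \<le> (int ?n + 1) ^ 2" by (simp add: power2_eq_square algebra_simps)
    also have "\<dots> \<le> b ^ 2" using b(2) by (intro power_mono) auto
    finally show "int ?n * int ?n + 1 \<le> b ^ 2" .
  qed (use b in auto)
  moreover have "b * b ^ 2 = b ^ 3" by (simp add: power3_eq_cube power2_eq_square)
  moreover have "(6 * int ?n + 6) * (16 * int ?n * int ?n + 16) = 96 * ((int ?n + 1) * (int ?n * int ?n + 1))"
    by (simp add: algebra_simps)
  ultimately show "(6 * int ?n + 6) * (16 * int ?n * int ?n + 16) \<le> 100 * b ^ 3" using sq(3) by linarith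
qed

lemma initial_input_ok:
  assumes "ram_input S I n W Z" "order I = n"
  shows "ram_input.input_ok I n (initial_state I)"
proof -
  have "(u * n + v) div n = u" "(u * n + v) mod n = v" "u * n + v < n * n" if "u < n" "v < n" for u v
    using that index_less by simp_all
  then show ?thesis
    unfolding ram_input.input_ok_def[OF assms(1)]
    using assms(2) by (simp add: initial_state_def Let_def incidence_def)
qed

lemma time_bound_le: "time_bound n \<le> 20000 * (n + 1) ^ 3 * (scales n + 1)"
proof -
  define N where "N = (n + 1) ^ 3"
  have N: "N = n * (n * n) + 3 * (n * n) + 3 * n + 1"
    by (simp add: N_def power3_eq_cube algebra_simps)
  have p: "push_bound n = 30 * (n * (n * n)) + 46 * (n * n) + 8 * n + 1"
    by (simp add: push_bound_def power2_eq_square algebra_simps)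
  have b: "body_bound n + 9 \<le> 10000 * N"
    unfolding body_bound_def p N by (simp add: algebra_simps)
  have r: "n * (n * 107 + 32) + 5 + (n * (n * (n * 20 + 37) + 12) + 5) + (n * 100 + 18) + 20 + (n * (n * 17 + 12) + 60) \<le> 10000 * N"
    unfolding N by (simp add: algebra_simps)
  have "scales n * (body_bound n + 9) \<le> scales n * (10000 * N)" using b by (rule mult_le_mono2)
  then have "time_bound n \<le> 10000 * N + scales n * (10000 * N)" using r unfolding time_bound_def by linarith
  also have "\<dots> \<le> 20000 * N * (scales n + 1)" by (simp add: algebra_simps)
  finally show ?thesis by (simp add: N_def)
qed

text \<open>The count is of order \<open>n^3 log n\<close>; as \<open>ln (ln n)\<close> tends to
  infinity, the extra factor is pure slack, and only large \<open>n\<close> matter.\<close>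

lemma time_bound_bigo: "(\<lambda>n. real (time_bound n)) \<in> O(\<lambda>n. real n ^ 3 * ln (real n) * ln (ln (real n)))"
proof -
  have "(\<lambda>n. real (time_bound n)) \<in> O(\<lambda>n. (real n + 1) ^ 3 * (2 * log 2 (real n + 1) + 5))"
  proof (rule bigoI[where c = 20000], rule always_eventually, rule allI)
    fix n
    have l: "0 \<le> log 2 (real n + 1)" by simp
    \<comment> \<open>\<open>scales n + 1\<close> is twice a rounded-up logarithm plus 3; rounding
      up adds less than 1, so 5 suffices.\<close>
    have "real (scales n) + 1 \<le> 2 * log 2 (real n + 1) + 5"
      using l by (simp add: scales_def) linarith
    have "real (time_bound n) \<le> real (20000 * (n + 1) ^ 3 * (scales n + 1))"
      using time_bound_le[of n] by (simp only: of_nat_le_iff)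
    also have "\<dots> = 20000 * (real n + 1) ^ 3 * (real (scales n) + 1)" by (simp add: algebra_simps)
    also have "\<dots> \<le> 20000 * (real n + 1) ^ 3 * (2 * log 2 (real n + 1) + 5)"
      by (intro mult_left_mono) (fact, simp)
    finally show "norm (real (time_bound n)) \<le> 20000 * norm ((real n + 1) ^ 3 * (2 * log 2 (real n + 1) + 5))"
      using l by (simp add: abs_mult)
  qed
  also have "(\<lambda>n. (real n + 1) ^ 3 * (2 * log 2 (real n + 1) + 5)) \<in> O(\<lambda>n. real n ^ 3 * ln (real n) * ln (ln (real n)))"
    by real_asymp
  finally show ?thesis .
qed

theorem theorem4p4:
  fixes S :: "edit_op set"
  assumes "{EA} \<subseteq> S" and "S \<subseteq> {EA, ED}"
  shows "solvable_in_time (CDBE S) (\<lambda>n. real n ^ 3 * ln (real n) * ln (ln (real n)))"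
  unfolding solvable_in_time_def
proof (rule exI[of _ "cdbe_prog (of_bool (ED \<in> S))"], rule exI[of _ word_exponent], rule exI[of _ time_bound], intro conjI allI impI)
  show "(\<lambda>n. real (time_bound n)) \<in> O(\<lambda>n. real n ^ 3 * ln (real n) * ln (ln (real n)))"
    by (rule time_bound_bigo)
  fix I assume valid: "valid_input I"
  have EA: "EA \<in> S" using assms by simp
  note ri = ram_inputI[OF EA valid, folded word_bound_def]
  obtain t s where "exec (word_bound word_exponent I) (cdbe_prog (of_bool (ED \<in> S))) (initial_state I) t s"
    "t \<le> time_bound (order I)" "var s ''out'' = of_bool (CDBE S I)"
    using ram_input.cdbe_prog_runs[OF ri initial_input_ok[OF ri refl]]
    unfolding ram_input.e_def[OF ri] runs_def by blast
  then show "\<exists>t s. exec (word_bound word_exponent I) (cdbe_prog (of_bool (ED \<in> S))) (initial_state I) t s \<and>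
      t \<le> time_bound (order I) \<and> var s ''out'' = (if CDBE S I then 1 else 0)"
    by (intro exI[of _ t] exI[of _ s]) simp
qed

end
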